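(* Let $0<q<1$, $w\in\mathbb{C}\setminus\{0\}$, and let $(\mathcal{A}_q,\mathcal{H},\mathcal{D})$ be the $\mathcal{U}_q(\mathfrak{su}(2))$-equivariant spectral triple on the standard Podleś sphere. Let $\mathbb{A}=\sum_i a_i[\mathcal{D},b_i]$ (finite sum, $a_i,b_i\in\mathcal{A}_q$) be a selfadjoint one-form, let $\mathcal{D}_{\mathbb{A}}:=\mathcal{D}+\mathbb{A}$ and $X_{\mathbb{A}}:=\mathcal{D}_{\mathbb{A}}^2-\mathcal{D}^2=\mathcal{D}\mathbb{A}+\mathbb{A}\mathcal{D}+\mathbb{A}^2$, and assume $\|X_{\mathbb{A}}\mathcal{D}^{-2}\|<1$. Then the heat trace expansion of $\mathcal{D}_{\mathbb{A}}$ is the same as that of $\mathcal{D}$ up to terms which vanish at $t=0$: $$\operatorname{Tr}e^{-t|\mathcal{D}_{\mathbb{A}}|}-\operatorname{Tr}e^{-t|\mathcal{D}|}\longrightarrow0\quad\text{as }t\to0^+ .$$ Consequently, the leading terms of the spectral action (the terms which do not vanish in the limit $\Lambda\to\infty$) do not depend on $\mathbb{A}$: for $f\in\mathcal{C}$, $$\operatorname{Tr}f(|\mathcal{D}_{\mathbb{A}}|/\Lambda)-\operatorname{Tr}f(|\mathcal{D}|/\Lambda)\longrightarrow0\quad\text{as }\Lambda\to\infty .$$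
   Context: $\mathbb{N}=\{0,1,2,\dots\}$ and $[n]:=\frac{q^{-n}-q^n}{q^{-1}-q}$. Spectral triple. $\mathcal{A}_q$ is the complex $*$-algebra generated by $A=A^*,B,B^*$ with $AB=q^2BA$, $AB^*=q^{-2}B^*A$, $BB^*=q^{-2}A(1-A)$, $B^*B=A(1-q^2A)$. $\mathcal{H}_{1/2}$ has orthonormal basis $|l,m\rangle$, $l\in\frac12+\mathbb{N}$, $m\in\{-l,\dots,l\}$; $\mathcal{H}=\mathcal{H}_+\oplus\mathcal{H}_-$ with $\mathcal{H}_\pm=\mathcal{H}_{1/2}$. $\mathcal{A}_q$ acts by $\pi=\pi_+\oplus\pi_-$ (the symbol $\pi$ is omitted), where $\pi_\pm$ are the $*$-representations $$\pi_\pm(A)|l,m\rangle=A^+_{l,m}|l+1,m\rangle+A^0_{l,m}|l,m\rangle+A^-_{l,m}|l-1,m\rangle,$$ $$\pi_\pm(B)|l,m\rangle=B^+_{l,m}|l+1,m+1\rangle+B^0_{l,m}|l,m+1\rangle+B^-_{l,m}|l-1,m+1\rangle,$$ with $A^+_{l,m}=-q^{m+l+1/2}\sqrt{[l-m+1][l+m+1]}\,\alpha_l^+$, $A^0_{l,m}=\frac{q^{-1/2}}{1+q^2}\big([l-m+1][l+m]-q^2[l-m][l+m+1]\big)\alpha^0_l+\frac1{1+q^2}$, $A^-_{l,m}=q^{m-l-1/2}\sqrt{[l-m][l+m]}\,\alpha^-_l$, $B^+_{l,m}=q^m\sqrt{[l+m+1][l+m+2]}\,\alpha^+_l$, $B^0_{l,m}=q^m\sqrt{[l+m+1][l-m]}\,\alpha^0_l$,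 $B^-_{l,m}=q^m\sqrt{[l-m][l-m-1]}\,\alpha_l^-$, where $\alpha^-_{l+1}=-q^{2l+2}\alpha^+_l$ and for $\pi_+$: $\alpha^0_l=q^{-1/2}\frac{(q-q^{-1})[l-\frac12][l+\frac32]+q}{[2l][2l+2]}$, $\alpha^+_l=\frac{q^{-l-2}}{\sqrt{[2l+2]([4l+4]+[2][2l+2])}}$; for $\pi_-$: $\alpha^0_l=q^{-1/2}\frac{(q-q^{-1})[l-\frac12][l+\frac32]-q^{-1}}{[2l][2l+2]}$, $\alpha^+_l=\frac{q^{-l-1}}{\sqrt{[2l+2]([4l+4]+[2][2l+2])}}$; and $\pi_\pm(B^* )=\pi_\pm(B)^*$. With $D|l,m\rangle=[l+\frac12]|l,m\rangle$, $\mathcal{D}=\begin{pmatrix}0&\bar wD\\ wD&0\end{pmatrix}$ and $|\mathcal{D}|=|w|(D\oplus D)$; the commutators $[\mathcal{D},b]$, $b\in\mathcal{A}_q$, extend to bounded operators. Class $\mathcal{C}$. With $\mathcal{L}(d\phi)(x)=\int_0^\infty e^{-sx}\,d\phi(s)$ for $x\in\mathbb{R}^+=(0,\infty)$, $\mathcal{C}$ is the set of functions $f=\mathcal{L}(d\phi)$ where $d\phi$ is a non-negative (not necessarily finite) Borel measure on $\mathbb{R}^+$ such that $\int_0^\infty e^{st}\,d\phi(s)<\infty$ for every $t\ge0$. *)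

theory Defs
  imports "HOL-Analysis.Analysis" "HOL-Library.Function_Algebras"
begin

section \<open>The Hilbert space\<close>

text \<open>
  The library has no complex Hilbert spaces, so \<open>\<H> = \<H>\<^sub>+ \<oplus> \<H>\<^sub>-\<close> is realised as the
  space of square-summable families of coefficients with respect to the orthonormal basis
  \<open>|l,m\<rangle>\<^sub>\<plusminus>\<close>. The half-integers \<open>l\<close> and \<open>m\<close> are real numbers, and a vector vanishes at every
  triple that does not label a basis vector. Addition of vectors is the pointwise addition of
  \<open>Function_Algebras\<close>.
\<close>

datatype summand = Plus | Minus

type_synonym label = "summand \<times> real \<times> real"
type_synonym vec = "label \<Rightarrow> complex"

definition labels :: "label set" where
  "labels = {(s, l, m). (\<exists>n::nat. l = real n + 1/2) \<and> (\<exists>k::nat. real k \<le> 2 * l \<and> m = - l + real k)}"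

definition ket :: "label \<Rightarrow> vec" where
  "ket i = (\<lambda>j. if j = i \<and> i \<in> labels then 1 else 0)"

definition hilb :: "vec set" where
  "hilb = {x. (\<forall>i. i \<notin> labels \<longrightarrow> x i = 0) \<and> (\<lambda>i. (cmod (x i))\<^sup>2) summable_on labels}"

definition ip :: "vec \<Rightarrow> vec \<Rightarrow> complex" where
  "ip x y = (\<Sum>\<^sub>\<infinity>i\<in>labels. cnj (x i) * y i)"

definition vnorm :: "vec \<Rightarrow> real" where
  "vnorm x = sqrt (\<Sum>\<^sub>\<infinity>i\<in>labels. (cmod (x i))\<^sup>2)"

definition vscale :: "complex \<Rightarrow> vec \<Rightarrow> vec" where
  "vscale c x = (\<lambda>i. c * x i)"


section \<open>Operators\<close>

text \<open>
  A (possibly unbounded) operator is its graph. In this way equality of operators includes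
  equality of the domains, \<open>Domain T\<close> is the domain of definition, and the algebraic operations
  below carry the usual maximal domains.
\<close>

type_synonym oper = "(vec \<times> vec) set"

definition linear_op :: "oper \<Rightarrow> bool" where
  "linear_op T \<longleftrightarrow> T \<subseteq> hilb \<times> hilb \<and> single_valued T \<and> (0, 0) \<in> T
     \<and> (\<forall>(x, y) \<in> T. \<forall>(x', y') \<in> T. (x + x', y + y') \<in> T)
     \<and> (\<forall>(x, y) \<in> T. \<forall>c. (vscale c x, vscale c y) \<in> T)"

definition op_apply :: "oper \<Rightarrow> vec \<Rightarrow> vec" where
  "op_apply T x = (THE y. (x, y) \<in> T)"

definition op_id :: oper where
  "op_id = Id_on hilb"

definition op_add :: "oper \<Rightarrow> oper \<Rightarrow> oper" where
  "op_add S T = {(x, y + z) | x y z. (x, y) \<in> S \<and> (x, z) \<in> T}"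

definition op_diff :: "oper \<Rightarrow> oper \<Rightarrow> oper" where
  "op_diff S T = {(x, y - z) | x y z. (x, y) \<in> S \<and> (x, z) \<in> T}"

definition op_scale :: "complex \<Rightarrow> oper \<Rightarrow> oper" where
  "op_scale c T = {(x, vscale c y) | x y. (x, y) \<in> T}"

text \<open>The operator product \<open>S T\<close> applies \<open>T\<close> first, as opposed to relational composition.\<close>

definition op_mult :: "oper \<Rightarrow> oper \<Rightarrow> oper" where
  "op_mult S T = T O S"

definition op_sum :: "nat \<Rightarrow> (nat \<Rightarrow> oper) \<Rightarrow> oper" where
  "op_sum n F = {(x, \<Sum>i<n. y i) | x y. x \<in> hilb \<and> (\<forall>i<n. (x, y i) \<in> F i)}"

definition commutator :: "oper \<Rightarrow> oper \<Rightarrow> oper" where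
  "commutator S T = op_diff (op_mult S T) (op_mult T S)"

definition op_closure :: "oper \<Rightarrow> oper" where
  "op_closure T = {(x, y). x \<in> hilb \<and> y \<in> hilb \<and>
     (\<forall>e>0. \<exists>(u, v) \<in> T. vnorm (x - u) < e \<and> vnorm (y - v) < e)}"

definition adjoint :: "oper \<Rightarrow> oper" where
  "adjoint T = {(x, y). x \<in> hilb \<and> y \<in> hilb \<and> (\<forall>(u, v) \<in> T. ip u y = ip v x)}"

text \<open>
  Density of the domain need not be required separately: the adjoint, taken as a relation, is
  single-valued only if \<open>T\<close> is densely defined.
\<close>

definition selfadjoint :: "oper \<Rightarrow> bool" where
  "selfadjoint T \<longleftrightarrow> linear_op T \<and> adjoint T = T"

definition positive_selfadjoint :: "oper \<Rightarrow> bool" where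
  "positive_selfadjoint T \<longleftrightarrow> selfadjoint T \<and> (\<forall>(x, y) \<in> T. 0 \<le> Re (ip x y))"

text \<open>The modulus \<open>|T| = (T\<^sup>* T)\<^sup>1\<^sup>/\<^sup>2\<close>.\<close>

definition op_abs :: "oper \<Rightarrow> oper" where
  "op_abs T = (THE S. positive_selfadjoint S \<and> op_mult S S = op_mult (adjoint T) T)"

definition op_norm :: "oper \<Rightarrow> ennreal" where
  "op_norm T = (SUP (x, y) \<in> {(x, y) \<in> T. vnorm x \<le> 1}. ennreal (vnorm y))"

definition bounded_op :: "oper \<Rightarrow> bool" where
  "bounded_op T \<longleftrightarrow> linear_op T \<and> Domain T = hilb \<and> op_norm T < \<infinity>"

definition trace_class :: "oper \<Rightarrow> bool" where
  "trace_class T \<longleftrightarrow> bounded_op T \<and>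
     (\<lambda>i. ip (ket i) (op_apply (op_abs T) (ket i))) summable_on labels"

definition op_trace :: "oper \<Rightarrow> complex" where
  "op_trace T = (\<Sum>\<^sub>\<infinity>i\<in>labels. ip (ket i) (op_apply T (ket i)))"


section \<open>Borel functional calculus\<close>

definition projection :: "oper \<Rightarrow> bool" where
  "projection P \<longleftrightarrow> bounded_op P \<and> selfadjoint P \<and> op_mult P P = P"

definition pvm :: "(real set \<Rightarrow> oper) \<Rightarrow> bool" where
  "pvm E \<longleftrightarrow> (\<forall>S \<in> sets borel. projection (E S)) \<and> E UNIV = op_id
     \<and> (\<forall>S \<in> sets borel. \<forall>T \<in> sets borel. E (S \<inter> T) = op_mult (E S) (E T))
     \<and> (\<forall>x \<in> hilb. measure_space UNIV (sets borel)
           (\<lambda>S. ennreal (Re (ip x (op_apply (E S) x)))))"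

definition scalar_measure :: "(real set \<Rightarrow> oper) \<Rightarrow> vec \<Rightarrow> real measure" where
  "scalar_measure E x = measure_of UNIV (sets borel) (\<lambda>S. ennreal (Re (ip x (op_apply (E S) x))))"

text \<open>
  \<open>spectral_integral E f S\<close> states that \<open>S = \<integral> f dE\<close> for a real Borel function \<open>f\<close>. By polarisation
  the quadratic form determines a linear operator on its domain.
\<close>

definition spectral_integral :: "(real set \<Rightarrow> oper) \<Rightarrow> (real \<Rightarrow> real) \<Rightarrow> oper \<Rightarrow> bool" where
  "spectral_integral E f S \<longleftrightarrow> linear_op S
     \<and> Domain S = {x \<in> hilb. (\<integral>\<^sup>+r. ennreal ((f r)\<^sup>2) \<partial>scalar_measure E x) < \<infinity>}
     \<and> (\<forall>(x, y) \<in> S. ip x y = complex_of_real (\<integral>r. f r \<partial>scalar_measure E x))"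

text \<open>The operator \<open>f(T)\<close>, where \<open>T = \<integral> r dE(r)\<close> is the spectral resolution of \<open>T\<close>.\<close>

definition fun_calc :: "(real \<Rightarrow> real) \<Rightarrow> oper \<Rightarrow> oper" where
  "fun_calc f T = (THE S. \<exists>E. pvm E \<and> spectral_integral E (\<lambda>r. r) T \<and> spectral_integral E f S)"


section \<open>The spectral triple on the standard Podles sphere\<close>

definition qnum :: "real \<Rightarrow> real \<Rightarrow> real" where
  "qnum q x = (q powr (- x) - q powr x) / (inverse q - q)"

fun alpha0 :: "real \<Rightarrow> summand \<Rightarrow> real \<Rightarrow> real" where
  "alpha0 q Plus l = q powr (- 1/2) *
     ((q - inverse q) * qnum q (l - 1/2) * qnum q (l + 3/2) + q) / (qnum q (2*l) * qnum q (2*l + 2))"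
| "alpha0 q Minus l = q powr (- 1/2) *
     ((q - inverse q) * qnum q (l - 1/2) * qnum q (l + 3/2) - inverse q) / (qnum q (2*l) * qnum q (2*l + 2))"

fun alpha_up :: "real \<Rightarrow> summand \<Rightarrow> real \<Rightarrow> real" where
  "alpha_up q Plus l = q powr (- l - 2) /
     sqrt (qnum q (2*l + 2) * (qnum q (4*l + 4) + qnum q 2 * qnum q (2*l + 2)))"
| "alpha_up q Minus l = q powr (- l - 1) /
     sqrt (qnum q (2*l + 2) * (qnum q (4*l + 4) + qnum q 2 * qnum q (2*l + 2)))"

text \<open>\<open>\<alpha>\<^sup>-\<^sub>l\<^sub>+\<^sub>1 = - q\<^sup>2\<^sup>l\<^sup>+\<^sup>2 \<alpha>\<^sup>+\<^sub>l\<close>, shifted by one.\<close>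

definition alpha_down :: "real \<Rightarrow> summand \<Rightarrow> real \<Rightarrow> real" where
  "alpha_down q s l = - (q powr (2*l)) * alpha_up q s (l - 1)"

definition A_up :: "real \<Rightarrow> summand \<Rightarrow> real \<Rightarrow> real \<Rightarrow> real" where
  "A_up q s l m = - (q powr (m + l + 1/2)) * sqrt (qnum q (l - m + 1) * qnum q (l + m + 1)) * alpha_up q s l"

definition A_zero :: "real \<Rightarrow> summand \<Rightarrow> real \<Rightarrow> real \<Rightarrow> real" where
  "A_zero q s l m = q powr (- 1/2) / (1 + q\<^sup>2) *
     (qnum q (l - m + 1) * qnum q (l + m) - q\<^sup>2 * qnum q (l - m) * qnum q (l + m + 1)) * alpha0 q s l
     + 1 / (1 + q\<^sup>2)"

definition A_down :: "real \<Rightarrow> summand \<Rightarrow> real \<Rightarrow> real \<Rightarrow> real" where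
  "A_down q s l m = q powr (m - l - 1/2) * sqrt (qnum q (l - m) * qnum q (l + m)) * alpha_down q s l"

definition B_up :: "real \<Rightarrow> summand \<Rightarrow> real \<Rightarrow> real \<Rightarrow> real" where
  "B_up q s l m = q powr m * sqrt (qnum q (l + m + 1) * qnum q (l + m + 2)) * alpha_up q s l"

definition B_zero :: "real \<Rightarrow> summand \<Rightarrow> real \<Rightarrow> real \<Rightarrow> real" where
  "B_zero q s l m = q powr m * sqrt (qnum q (l + m + 1) * qnum q (l - m)) * alpha0 q s l"

definition B_down :: "real \<Rightarrow> summand \<Rightarrow> real \<Rightarrow> real \<Rightarrow> real" where
  "B_down q s l m = q powr m * sqrt (qnum q (l - m) * qnum q (l - m - 1)) * alpha_down q s l"

fun A_ket :: "real \<Rightarrow> label \<Rightarrow> vec" where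
  "A_ket q (s, l, m) =
     vscale (complex_of_real (A_up q s l m)) (ket (s, l + 1, m))
     + vscale (complex_of_real (A_zero q s l m)) (ket (s, l, m))
     + vscale (complex_of_real (A_down q s l m)) (ket (s, l - 1, m))"

fun B_ket :: "real \<Rightarrow> label \<Rightarrow> vec" where
  "B_ket q (s, l, m) =
     vscale (complex_of_real (B_up q s l m)) (ket (s, l + 1, m + 1))
     + vscale (complex_of_real (B_zero q s l m)) (ket (s, l, m + 1))
     + vscale (complex_of_real (B_down q s l m)) (ket (s, l - 1, m + 1))"

text \<open>
  The operator with prescribed values on the basis. It is used for \<open>F\<close> with matrix coefficients
  \<open>F i j\<close> that, for each \<open>j\<close>, vanish for all but finitely many \<open>i\<close>; if these values extend to a
  bounded operator, then this is that extension.
\<close>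

definition extend_from_basis :: "(label \<Rightarrow> vec) \<Rightarrow> oper" where
  "extend_from_basis F = {(x, y). x \<in> hilb \<and> y \<in> hilb \<and> y = (\<lambda>j. \<Sum>\<^sub>\<infinity>i\<in>labels. x i * F i j)}"

definition pi_A :: "real \<Rightarrow> oper" where
  "pi_A q = extend_from_basis (A_ket q)"

definition pi_B :: "real \<Rightarrow> oper" where
  "pi_B q = extend_from_basis (B_ket q)"

text \<open>
  The image of the algebra \<open>\<A>\<^sub>q\<close> under the representation \<open>\<pi> = \<pi>\<^sub>+ \<oplus> \<pi>\<^sub>-\<close>: the unital complex
  algebra generated by \<open>\<pi>(A) = \<pi>(A)\<^sup>*\<close>, \<open>\<pi>(B)\<close> and \<open>\<pi>(B\<^sup>*) = \<pi>(B)\<^sup>*\<close>. The defining relations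
  \<open>A B = q\<^sup>2 B A\<close>, \<open>A B\<^sup>* = q\<^sup>-\<^sup>2 B\<^sup>* A\<close>, \<open>B B\<^sup>* = q\<^sup>-\<^sup>2 A (1 - A)\<close>, \<open>B\<^sup>* B = A (1 - q\<^sup>2 A)\<close> of \<open>\<A>\<^sub>q\<close> are
  identities between these operators. Elements of \<open>\<A>\<^sub>q\<close> enter one-forms only through \<open>\<pi>\<close>.
\<close>

inductive_set podles_algebra :: "real \<Rightarrow> oper set" for q :: real where
  gen_A: "pi_A q \<in> podles_algebra q"
| gen_B: "pi_B q \<in> podles_algebra q"
| gen_B_star: "adjoint (pi_B q) \<in> podles_algebra q"
| unit: "op_id \<in> podles_algebra q"
| add: "a \<in> podles_algebra q \<Longrightarrow> b \<in> podles_algebra q \<Longrightarrow> op_add a b \<in> podles_algebra q"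
| scale: "a \<in> podles_algebra q \<Longrightarrow> op_scale c a \<in> podles_algebra q"
| mult: "a \<in> podles_algebra q \<Longrightarrow> b \<in> podles_algebra q \<Longrightarrow> op_mult a b \<in> podles_algebra q"

text \<open>
  The off-diagonal operator with entries \<open>cnj w D\<close> (upper right) and \<open>w D\<close> (lower left), where
  \<open>D |l,m\<rangle> = [l + 1/2] |l,m\<rangle>\<close>, on its maximal domain.
\<close>

fun dirac_coeffs :: "real \<Rightarrow> complex \<Rightarrow> vec \<Rightarrow> vec" where
  "dirac_coeffs q w x (Plus, l, m) = cnj w * complex_of_real (qnum q (l + 1/2)) * x (Minus, l, m)"
| "dirac_coeffs q w x (Minus, l, m) = w * complex_of_real (qnum q (l + 1/2)) * x (Plus, l, m)"

definition dirac :: "real \<Rightarrow> complex \<Rightarrow> oper" where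
  "dirac q w = {(x, y). x \<in> hilb \<and> y \<in> hilb \<and> y = dirac_coeffs q w x}"

text \<open>
  \<open>\<Sum>\<^sub>i\<^sub><\<^sub>n a\<^sub>i [\<D>, b\<^sub>i]\<close>. The commutators are defined on the domain of \<open>\<D>\<close>, and the closure is their
  bounded extension to the Hilbert space.
\<close>

definition one_form :: "real \<Rightarrow> complex \<Rightarrow> nat \<Rightarrow> (nat \<Rightarrow> oper) \<Rightarrow> (nat \<Rightarrow> oper) \<Rightarrow> oper" where
  "one_form q w n a b = op_sum n (\<lambda>i. op_mult (a i) (op_closure (commutator (dirac q w) (b i))))"


section \<open>The class of test functions\<close>

definition laplace :: "real measure \<Rightarrow> real \<Rightarrow> real" where
  "laplace \<phi> x = (\<integral>s. exp (- s * x) \<partial>\<phi>)"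

text \<open>
  Functions on the positive half-line are represented as extensional functions.
\<close>

definition class_C :: "(real \<Rightarrow> real) set" where
  "class_C = {f. \<exists>\<phi>. sets \<phi> = sets (restrict_space borel {0<..})
     \<and> (\<forall>t\<ge>0. (\<integral>\<^sup>+s. ennreal (exp (s * t)) \<partial>\<phi>) < \<infinity>)
     \<and> f = restrict (laplace \<phi>) {0<..}}"

end

theory Submission
  imports Defs
begin

text \<open>
  The coefficients of the generators decay like \<open>q\<^sup>l\<close> fast enough that every commutator \<open>[\<D>, b]\<close> is a
  bounded band matrix, so \<open>\<A>\<close> is bounded, by \<open>a\<close> say, and preserves the domain of \<open>\<D>\<close>. Hence
  \<open>\<D>\<^sub>\<A>\<close> is selfadjoint with compact resolvent and has an orthonormal basis of eigenvectors; the
  condition on \<open>X\<^sub>\<A>\<close> excludes the eigenvalue \<open>0\<close>. Since \<open>x \<mapsto> exp (- s \<surd>x)\<close> is convex and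
  decreasing, Peierls' inequality \<open>Tr exp (- s \<bar>T\<bar>) \<ge> \<Sum>\<^sub>i exp (- s \<parallel>T e\<^sub>i\<parallel>)\<close> for orthonormal bases
  \<open>e\<^sub>i\<close>, applied to \<open>\<D>\<^sub>\<A>\<close> on the eigenvectors of \<open>\<bar>\<D>\<bar>\<close> and conversely, gives
  \<open>exp (- s a) Tr exp (- s \<bar>\<D>\<bar>) \<le> Tr exp (- s \<bar>\<D>\<^sub>\<A>\<bar>) \<le> exp (s a) Tr exp (- s \<bar>\<D>\<bar>)\<close>.
  The eigenvalues of \<open>\<bar>\<D>\<bar>\<close> grow exponentially in \<open>l\<close> while their multiplicities are linear in \<open>l\<close>, so
  \<open>Tr exp (- s \<bar>\<D>\<bar>) = O(s\<^sup>-\<^sup>1\<^sup>/\<^sup>2)\<close> and the two heat traces differ by \<open>O(s\<^sup>1\<^sup>/\<^sup>2)\<close>. Integrating this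
  estimate against \<open>\<phi>\<close> yields the statement for \<open>f \<in> \<C>\<close>.

  A spectral resolution of an operator with an orthonormal eigenbasis is the obvious atomic one: if
  \<open>B\<close> lies strictly on one side of the eigenvalue of \<open>e\<close>, then comparing \<open>\<langle>E(B) e, T E(B) e\<rangle>\<close> with
  \<open>\<integral> r d\<mu>\<close> shows \<open>E(B) e = 0\<close>. This makes the functional calculus single-valued.
\<close>

section \<open>The Hilbert space\<close>

text \<open>The modulus is not operator Lipschitz, so boundedness of the perturbation does not bound
  |D_A| - |D|. What survives is a comparison of vector norms: ||D_A x|| and || |D| x || differ by at
  most a ||x|| on the common domain. Peierls' inequality is therefore stated through ||T e_i||, that
  is through the square of T, and moduli are never compared as operators. The modulus and the
  functional calculus are definite descriptions, so much of the operator theory is about uniqueness: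
  of positive square roots and of projection-valued measures, each for operators with an eigenbasis.
  The exponent 1/2 comes from exp (- x) <= 1 / sqrt x at each eigenvalue, because the inverse square
  roots of the eigenvalues have a finite sum. A kernel vector of D_A has to be excluded because the
  test functions live on the open half-line. The exponential moments of \<phi> absorb the factor exp
  (s a) of the error.\<close>

lemma hilb_boundI:
  assumes "\<And>i. i \<notin> labels \<Longrightarrow> x i = 0" "0 \<le> C"
    and "\<And>F. finite F \<Longrightarrow> F \<subseteq> labels \<Longrightarrow> (\<Sum>i\<in>F. (cmod (x i))\<^sup>2) \<le> C\<^sup>2"
  shows "x \<in> hilb" "vnorm x \<le> C"
proof -
  have s: "(\<lambda>i. (cmod (x i))\<^sup>2) summable_on labels"
    by (rule nonneg_bdd_above_summable_on) (auto intro!: bdd_aboveI[where M = "C\<^sup>2"] assms(3))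
  then show "x \<in> hilb" using assms(1) by (auto simp: hilb_def)
  have "(\<Sum>\<^sub>\<infinity>i\<in>labels. (cmod (x i))\<^sup>2) \<le> C\<^sup>2"
    by (rule infsum_le_finite_sums[OF s]) (use assms(3) in auto)
  then show "vnorm x \<le> C" using assms(2) by (simp add: vnorm_def real_le_lsqrt)
qed

lemma hilb_outside: "x \<in> hilb \<Longrightarrow> i \<notin> labels \<Longrightarrow> x i = 0"
  unfolding hilb_def by blast

lemma hilb_summable: "x \<in> hilb \<Longrightarrow> (\<lambda>i. (cmod (x i))\<^sup>2) summable_on labels"
  by (auto simp: hilb_def)

lemma vnorm_nonneg [simp]: "0 \<le> vnorm x"
  by (simp add: vnorm_def infsum_nonneg)

lemma vnorm_power2: "(vnorm x)\<^sup>2 = (\<Sum>\<^sub>\<infinity>i\<in>labels. (cmod (x i))\<^sup>2)"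
  by (simp add: vnorm_def infsum_nonneg)

lemma sum_le_vnorm:
  assumes "x \<in> hilb" "finite F" "F \<subseteq> labels"
  shows "(\<Sum>i\<in>F. (cmod (x i))\<^sup>2) \<le> (vnorm x)\<^sup>2"
  unfolding vnorm_power2
  by (rule finite_sum_le_infsum) (use assms hilb_summable in auto)

lemma coord_le_vnorm:
  assumes "x \<in> hilb" shows "cmod (x i) \<le> vnorm x"
proof (cases "i \<in> labels")
  case True
  have "(cmod (x i))\<^sup>2 \<le> (vnorm x)\<^sup>2" using sum_le_vnorm[OF assms, of "{i}"] True by simp
  then show ?thesis by (simp add: power2_le_iff_abs_le)
qed (use hilb_outside[OF assms] in auto)

lemma hilb_zero [simp, intro]: "0 \<in> hilb"
  by (simp add: hilb_def)

lemma vnorm_zero [simp]: "vnorm 0 = 0"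
  by (simp add: vnorm_def)

lemma vscale_apply [simp]: "vscale c x i = c * x i"
  by (simp add: vscale_def)

lemma vscale_simps [simp]: "vscale 1 x = x" "vscale 0 x = 0" "vscale c 0 = 0"
  "vscale c (vscale d x) = vscale (c * d) x"
  by (auto simp: vscale_def fun_eq_iff)

lemma vscale_add: "vscale c (x + y) = vscale c x + vscale c y"
  by (auto simp: fun_eq_iff algebra_simps)

lemma vscale_diff: "vscale c (x - y) = vscale c x - vscale c y"
  by (auto simp: fun_eq_iff algebra_simps)

lemma hilb_scale [simp, intro]: "x \<in> hilb \<Longrightarrow> vscale c x \<in> hilb"
  by (auto simp: hilb_def vscale_def norm_mult power_mult_distrib intro!: summable_on_cmult_right)

lemma vnorm_scale: "vnorm (vscale c x) = cmod c * vnorm x"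
  by (simp add: vnorm_def vscale_def norm_mult power_mult_distrib infsum_cmult_right' real_sqrt_mult)

lemma sq_add_le: "(cmod (a + b))\<^sup>2 \<le> 2 * (cmod a)\<^sup>2 + 2 * (cmod b)\<^sup>2"
proof -
  have "(cmod (a + b))\<^sup>2 \<le> (cmod a + cmod b)\<^sup>2" by (simp add: norm_triangle_ineq power_mono)
  also have "\<dots> \<le> 2 * (cmod a)\<^sup>2 + 2 * (cmod b)\<^sup>2"
    using sum_squares_bound[of "cmod a" "cmod b"] by (simp add: power2_sum)
  finally show ?thesis .
qed

lemma hilb_add [simp, intro]:
  assumes "x \<in> hilb" "y \<in> hilb" shows "x + y \<in> hilb"
proof -
  have "(\<lambda>i. 2 * (cmod (x i))\<^sup>2 + 2 * (cmod (y i))\<^sup>2) summable_on labels"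
    using assms by (intro summable_on_add summable_on_cmult_right hilb_summable)
  then have "(\<lambda>i. (cmod ((x + y) i))\<^sup>2) summable_on labels"
    by (rule summable_on_comparison_test) (simp_all add: sq_add_le)
  then show ?thesis using assms by (auto simp: hilb_def)
qed

lemma diff_eq_add_vscale: "x - y = x + vscale (-1) y"
  by (auto simp: fun_eq_iff)

lemma hilb_diff [simp, intro]: "x \<in> hilb \<Longrightarrow> y \<in> hilb \<Longrightarrow> x - y \<in> hilb"
  by (simp add: diff_eq_add_vscale)

lemma hilb_sum [intro]: "(\<And>i. i \<in> I \<Longrightarrow> f i \<in> hilb) \<Longrightarrow> sum f I \<in> hilb"
  by (induction I rule: infinite_finite_induct) auto

section \<open>The inner product and the Cauchy-Schwarz inequality\<close>

lemma ip_summable: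
  assumes "x \<in> hilb" "y \<in> hilb"
  shows "(\<lambda>i. cnj (x i) * y i) summable_on labels"
proof -
  have *: "(\<lambda>i. (cmod (x i))\<^sup>2 + (cmod (y i))\<^sup>2) summable_on labels"
    using assms by (intro summable_on_add hilb_summable)
  have "(\<lambda>i. norm (cnj (x i) * y i)) summable_on labels"
  proof (rule summable_on_comparison_test[OF *])
    fix i
    show "norm (cnj (x i) * y i) \<le> (cmod (x i))\<^sup>2 + (cmod (y i))\<^sup>2"
    proof -
      have "0 \<le> cmod (x i) * cmod (y i)" by simp
      then show ?thesis using sum_squares_bound[of "cmod (x i)" "cmod (y i)"]
        by (simp only: norm_mult complex_mod_cnj)
    qed
  qed auto
  then show ?thesis by (rule abs_summable_summable)
qed

lemma ip_add_right: "x \<in> hilb \<Longrightarrow> y \<in> hilb \<Longrightarrow> z \<in> hilb \<Longrightarrow> ip x (y + z) = ip x y + ip x z"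
  unfolding ip_def by (subst infsum_add[symmetric]) (simp_all add: ip_summable ring_distribs)

lemma ip_scale_right: "ip x (vscale c y) = c * ip x y"
  unfolding ip_def by (subst infsum_cmult_right'[symmetric]) (auto simp: algebra_simps)

lemma cnj_ip: "cnj (ip x y) = ip y x"
  unfolding ip_def by (subst infsum_cnj[symmetric]) (simp add: mult.commute)

lemma ip_scale_left: "ip (vscale c x) y = cnj c * ip x y"
  using arg_cong[OF ip_scale_right[of y c x], of cnj] by (simp add: cnj_ip)

lemma ip_add_left: "x \<in> hilb \<Longrightarrow> y \<in> hilb \<Longrightarrow> z \<in> hilb \<Longrightarrow> ip (x + y) z = ip x z + ip y z"
  using arg_cong[OF ip_add_right[of z x y], of cnj] by (simp add: cnj_ip)

lemma ip_diff_right: "x \<in> hilb \<Longrightarrow> y \<in> hilb \<Longrightarrow> z \<in> hilb \<Longrightarrow> ip x (y - z) = ip x y - ip x z"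
  by (simp add: diff_eq_add_vscale ip_add_right ip_scale_right)

lemma ip_diff_left: "x \<in> hilb \<Longrightarrow> y \<in> hilb \<Longrightarrow> z \<in> hilb \<Longrightarrow> ip (x - y) z = ip x z - ip y z"
  by (simp add: diff_eq_add_vscale ip_add_left ip_scale_left)

lemma ip_zero [simp]: "ip 0 x = 0" "ip x 0 = 0"
  by (simp_all add: ip_def)

lemmas ip_simps = ip_add_right ip_add_left ip_diff_right ip_diff_left ip_scale_left ip_scale_right

lemma ip_sum_right:
  "x \<in> hilb \<Longrightarrow> (\<And>i. i \<in> I \<Longrightarrow> f i \<in> hilb) \<Longrightarrow> ip x (sum f I) = (\<Sum>i\<in>I. ip x (f i))"
  by (induction I rule: infinite_finite_induct) (auto simp: ip_add_right hilb_sum)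

lemma ip_sum_left:
  "x \<in> hilb \<Longrightarrow> (\<And>i. i \<in> I \<Longrightarrow> f i \<in> hilb) \<Longrightarrow> ip (sum f I) x = (\<Sum>i\<in>I. ip (f i) x)"
  by (induction I rule: infinite_finite_induct) (auto simp: ip_add_left hilb_sum)

lemma ip_self:
  assumes "x \<in> hilb" shows "ip x x = complex_of_real ((vnorm x)\<^sup>2)"
proof -
  have "ip x x = (\<Sum>\<^sub>\<infinity>i\<in>labels. complex_of_real ((cmod (x i))\<^sup>2))"
    unfolding ip_def by (rule infsum_cong) (simp only: mult.commute complex_norm_square)
  also have "\<dots> = complex_of_real (\<Sum>\<^sub>\<infinity>i\<in>labels. (cmod (x i))\<^sup>2)"
    by (intro infsumI has_sum_of_real has_sum_infsum hilb_summable assms)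
  finally show ?thesis by (simp add: vnorm_power2)
qed

lemma vnorm_eq_zero:
  assumes "x \<in> hilb" "vnorm x = 0" shows "x = 0"
  using coord_le_vnorm[OF assms(1)] assms(2) by (auto simp: fun_eq_iff)

lemma cauchy_schwarz:
  assumes x: "x \<in> hilb" and y: "y \<in> hilb"
  shows "cmod (ip x y) \<le> vnorm x * vnorm y"
proof (cases "vnorm x = 0")
  case True
  then show ?thesis using vnorm_eq_zero[OF x] by simp
next
  case False
  define c where "c = ip x y / complex_of_real ((vnorm x)\<^sup>2)"
  have "ip (y - vscale c x) (y - vscale c x)
      = ip y y - c * ip y x - cnj c * ip x y + cnj c * c * ip x x"
    using x y by (simp add: ip_simps algebra_simps)
  also have "\<dots> = complex_of_real ((vnorm y)\<^sup>2 - (cmod (ip x y))\<^sup>2 / (vnorm x)\<^sup>2)"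
  proof -
    have 1: "ip y x = cnj (ip x y)" by (simp add: cnj_ip)
    have 2: "ip x y * cnj (ip x y) = complex_of_real ((cmod (ip x y))\<^sup>2)"
      by (simp only: complex_norm_square)
    show ?thesis unfolding c_def ip_self[OF x] ip_self[OF y] 1 using False 2
      by (simp add: field_simps power2_eq_square)
  qed
  finally have "complex_of_real ((vnorm (y - vscale c x))\<^sup>2)
      = complex_of_real ((vnorm y)\<^sup>2 - (cmod (ip x y))\<^sup>2 / (vnorm x)\<^sup>2)"
    using x y by (simp only: ip_self hilb_diff hilb_scale)
  then have "(vnorm (y - vscale c x))\<^sup>2 = (vnorm y)\<^sup>2 - (cmod (ip x y))\<^sup>2 / (vnorm x)\<^sup>2"
    by (simp only: of_real_eq_iff)
  then have "(cmod (ip x y))\<^sup>2 / (vnorm x)\<^sup>2 \<le> (vnorm y)\<^sup>2"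
    by (metis diff_ge_0_iff_ge zero_le_power2)
  then have "(cmod (ip x y))\<^sup>2 \<le> (vnorm x * vnorm y)\<^sup>2"
    using False by (simp add: divide_le_eq power_mult_distrib mult.commute)
  then show ?thesis by (rule power2_le_imp_le) simp
qed

lemma vnorm_power2_add:
  assumes "x \<in> hilb" "y \<in> hilb"
  shows "(vnorm (x + y))\<^sup>2 = (vnorm x)\<^sup>2 + 2 * Re (ip x y) + (vnorm y)\<^sup>2"
proof -
  have "complex_of_real ((vnorm (x + y))\<^sup>2) = ip x x + (ip x y + cnj (ip x y)) + ip y y"
    using assms by (simp only: ip_self[symmetric] hilb_add cnj_ip) (simp add: ip_simps)
  then have "complex_of_real ((vnorm (x + y))\<^sup>2) = complex_of_real ((vnorm x)\<^sup>2 + 2 * Re (ip x y) + (vnorm y)\<^sup>2)"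
    using assms by (simp only: ip_self complex_add_cnj of_real_add)
  then show ?thesis by (simp only: of_real_eq_iff)
qed

lemma vnorm_triangle:
  assumes "x \<in> hilb" "y \<in> hilb"
  shows "vnorm (x + y) \<le> vnorm x + vnorm y"
proof (rule power2_le_imp_le)
  have "Re (ip x y) \<le> vnorm x * vnorm y"
    using cauchy_schwarz[OF assms] complex_Re_le_cmod order_trans by blast
  then show "(vnorm (x + y))\<^sup>2 \<le> (vnorm x + vnorm y)\<^sup>2"
    using vnorm_power2_add[OF assms] by (simp add: power2_sum)
qed simp

lemma vnorm_minus_commute: "vnorm (x - y) = vnorm (y - x)"
  by (simp add: vnorm_def norm_minus_commute)

lemma vnorm_triangle_diff:
  "x \<in> hilb \<Longrightarrow> y \<in> hilb \<Longrightarrow> vnorm x \<le> vnorm (x - y) + vnorm y"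
  using vnorm_triangle[of "x - y" y] by simp

lemma vnorm_triangle_diff2:
  "x \<in> hilb \<Longrightarrow> y \<in> hilb \<Longrightarrow> vnorm (x - y) \<le> vnorm x + vnorm y"
  using vnorm_triangle[of x "vscale (-1) y"] by (simp add: diff_eq_add_vscale vnorm_scale)

lemma abs_vnorm_diff:
  "x \<in> hilb \<Longrightarrow> y \<in> hilb \<Longrightarrow> \<bar>vnorm x - vnorm y\<bar> \<le> vnorm (x - y)"
  using vnorm_triangle_diff[of x y] vnorm_triangle_diff[of y x]
  by (simp add: vnorm_minus_commute[of y x])

lemma hilb_ket [simp, intro]: "ket i \<in> hilb"
proof -
  have "(\<lambda>j. (cmod (ket i j))\<^sup>2) summable_on labels"
    by (rule finite_nonzero_values_imp_summable_on)
      (rule finite_subset[of _ "{i}"], auto simp: ket_def)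
  then show ?thesis by (auto simp: hilb_def ket_def)
qed

lemma ip_ket:
  assumes "i \<in> labels" shows "ip (ket i) x = x i"
proof -
  have "ip (ket i) x = (\<Sum>\<^sub>\<infinity>j\<in>{i}. cnj (ket i j) * x j)"
    unfolding ip_def by (rule infsum_cong_neutral) (use assms in \<open>auto simp: ket_def\<close>)
  then show ?thesis using assms by (simp add: ket_def)
qed

text \<open>A coordinate is bounded by the norm, so the sequence converges coordinatewise. The
  Cauchy estimate passes to the limit in every finite partial sum, which gives both membership of
  the limit and convergence in norm.\<close>

lemma hilb_complete:
  assumes X: "\<And>n. X n \<in> hilb"
    and C: "\<And>e. 0 < e \<Longrightarrow> \<exists>N. \<forall>m\<ge>N. \<forall>n\<ge>N. vnorm (X m - X n) < e"
  shows "\<exists>x\<in>hilb. (\<lambda>n::nat. vnorm (X n - x)) \<longlonglongrightarrow> 0"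
proof -
  have "Cauchy (\<lambda>n. X n i)" for i
  proof (rule metric_CauchyI)
    fix e :: real assume "0 < e"
    from C[OF this] obtain N where N: "\<And>m n. m \<ge> N \<Longrightarrow> n \<ge> N \<Longrightarrow> vnorm (X m - X n) < e" by blast
    have "dist (X m i) (X n i) \<le> vnorm (X m - X n)" for m n
      using coord_le_vnorm[of "X m - X n" i] X by (simp add: dist_norm)
    with N show "\<exists>M. \<forall>m\<ge>M. \<forall>n\<ge>M. dist (X m i) (X n i) < e"
      by (meson le_less_trans)
  qed
  then have "\<exists>L. (\<lambda>n. X n i) \<longlonglongrightarrow> L" for i
    using Cauchy_convergent_iff convergent_def by blast
  then obtain x where x: "\<And>i. (\<lambda>n. X n i) \<longlonglongrightarrow> x i" by metis
  have out: "x i = 0" if "i \<notin> labels" for i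
    using x[of i] hilb_outside[OF X that] by (simp add: LIMSEQ_const_iff)
  have key: "X n - x \<in> hilb \<and> vnorm (X n - x) \<le> e"
    if N: "\<And>m. m \<ge> N \<Longrightarrow> vnorm (X m - X n) < e" for n e N
  proof -
    have e: "0 \<le> e" using N[of N] vnorm_nonneg by (meson dual_order.strict_implies_order order_refl order_trans)
    have "(\<Sum>i\<in>F. (cmod ((X n - x) i))\<^sup>2) \<le> e\<^sup>2" if F: "finite F" "F \<subseteq> labels" for F
    proof (rule tendsto_upperbound)
      show "(\<lambda>m. \<Sum>i\<in>F. (cmod (X n i - X m i))\<^sup>2) \<longlonglongrightarrow> (\<Sum>i\<in>F. (cmod ((X n - x) i))\<^sup>2)"
        by (auto intro!: tendsto_intros x)
      show "\<forall>\<^sub>F m in sequentially. (\<Sum>i\<in>F. (cmod (X n i - X m i))\<^sup>2) \<le> e\<^sup>2"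
      proof (rule eventually_sequentiallyI)
        fix m assume "N \<le> m"
        have "(\<Sum>i\<in>F. (cmod ((X n - X m) i))\<^sup>2) \<le> (vnorm (X n - X m))\<^sup>2"
          by (rule sum_le_vnorm[of "X n - X m" F]) (use X F in auto)
        also have "\<dots> \<le> e\<^sup>2" using N[OF \<open>N \<le> m\<close>] by (simp add: vnorm_minus_commute power_mono)
        finally show "(\<Sum>i\<in>F. (cmod (X n i - X m i))\<^sup>2) \<le> e\<^sup>2" by simp
      qed
    qed simp
    moreover have "(X n - x) i = 0" if "i \<notin> labels" for i
      using out[OF that] hilb_outside[OF X that] by simp
    ultimately show ?thesis using hilb_boundI[of "X n - x" e] e by blast
  qed
  obtain N0 where N0: "\<And>m n. m \<ge> N0 \<Longrightarrow> n \<ge> N0 \<Longrightarrow> vnorm (X m - X n) < 1" using C[of 1] by auto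
  have "X N0 - x \<in> hilb" using key[of N0 N0 1] N0 by blast
  then have "X N0 - (X N0 - x) \<in> hilb" using X by blast
  then have xh: "x \<in> hilb" by simp
  have "(\<lambda>n. vnorm (X n - x)) \<longlonglongrightarrow> 0"
  proof (rule LIMSEQ_I)
    fix r :: real assume "0 < r"
    then obtain N where N: "\<And>m n. m \<ge> N \<Longrightarrow> n \<ge> N \<Longrightarrow> vnorm (X m - X n) < r/2" using C[of "r/2"] by auto
    have "vnorm (X n - x) \<le> r/2" if "n \<ge> N" for n using key[of N n "r/2"] N that by blast
    then show "\<exists>no. \<forall>n\<ge>no. norm (vnorm (X n - x) - 0) < r"
      using \<open>0 < r\<close> by (intro exI[of _ N]) force
  qed
  with xh show ?thesis by blast
qed

lemma ip_tendsto_right: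
  assumes "z \<in> hilb" "\<And>n. X n \<in> hilb" "x \<in> hilb" "(\<lambda>n. vnorm (X n - x)) \<longlonglongrightarrow> 0"
  shows "(\<lambda>n. ip z (X n)) \<longlonglongrightarrow> ip z x"
proof (rule LIM_zero_cancel, rule Lim_null_comparison)
  show "\<forall>\<^sub>F n in sequentially. norm (ip z (X n) - ip z x) \<le> vnorm z * vnorm (X n - x)"
    using assms cauchy_schwarz by (auto simp: ip_diff_right[symmetric])
  show "(\<lambda>n. vnorm z * vnorm (X n - x)) \<longlonglongrightarrow> 0"
    using tendsto_mult_right_zero[OF assms(4)] .
qed

lemma vnorm_tendsto:
  assumes "\<And>n. X n \<in> hilb" "x \<in> hilb" "(\<lambda>n. vnorm (X n - x)) \<longlonglongrightarrow> 0"
  shows "(\<lambda>n. vnorm (X n)) \<longlonglongrightarrow> vnorm x"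
proof (rule LIM_zero_cancel, rule Lim_null_comparison[OF _ assms(3)])
  show "\<forall>\<^sub>F n in sequentially. norm (vnorm (X n) - vnorm x) \<le> vnorm (X n - x)"
    using assms abs_vnorm_diff by auto
qed

section \<open>Orthonormal systems\<close>

definition orthonormal :: "('j \<Rightarrow> vec) \<Rightarrow> 'j set \<Rightarrow> bool" where
  "orthonormal e J \<longleftrightarrow> (\<forall>j\<in>J. e j \<in> hilb) \<and> (\<forall>i\<in>J. \<forall>j\<in>J. ip (e i) (e j) = (if i = j then 1 else 0))"

text \<open>The double orthogonal complement, which in a Hilbert space is the closed linear span.
  Membership is then tested by orthogonality and needs no limits.\<close>

definition closed_span :: "('j \<Rightarrow> vec) \<Rightarrow> 'j set \<Rightarrow> vec set" where
  "closed_span e J = {x \<in> hilb. \<forall>z\<in>hilb. (\<forall>j\<in>J. ip (e j) z = 0) \<longrightarrow> ip z x = 0}"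

text \<open>Totality is expressed by a trivial orthogonal complement, the form in which a maximality
  argument delivers it. The index set is arbitrary.\<close>

definition onb :: "('j \<Rightarrow> vec) \<Rightarrow> 'j set \<Rightarrow> bool" where
  "onb e J \<longleftrightarrow> orthonormal e J \<and> (\<forall>x\<in>hilb. (\<forall>j\<in>J. ip (e j) x = 0) \<longrightarrow> x = 0)"

lemma orthonormal_hilb: "orthonormal e J \<Longrightarrow> j \<in> J \<Longrightarrow> e j \<in> hilb"
  and orthonormal_ip: "orthonormal e J \<Longrightarrow> i \<in> J \<Longrightarrow> j \<in> J \<Longrightarrow> ip (e i) (e j) = (if i = j then 1 else 0)"
  and orthonormal_self: "orthonormal e J \<Longrightarrow> j \<in> J \<Longrightarrow> ip (e j) (e j) = 1"
  and onb_orthonormal: "onb e J \<Longrightarrow> orthonormal e J"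
  and onb_hilb: "onb e J \<Longrightarrow> j \<in> J \<Longrightarrow> e j \<in> hilb"
  and onb_total: "onb e J \<Longrightarrow> x \<in> hilb \<Longrightarrow> (\<And>j. j \<in> J \<Longrightarrow> ip (e j) x = 0) \<Longrightarrow> x = 0"
  by (auto simp: orthonormal_def onb_def)

lemma orthonormal_vnorm: "orthonormal e J \<Longrightarrow> j \<in> J \<Longrightarrow> vnorm (e j) = 1"
proof -
  assume *: "orthonormal e J" "j \<in> J"
  have "complex_of_real ((vnorm (e j))\<^sup>2) = complex_of_real 1"
    using orthonormal_self[OF *] ip_self[OF orthonormal_hilb[OF *]] by simp
  then have "(vnorm (e j))\<^sup>2 = 1" by (simp only: of_real_eq_iff)
  then show ?thesis using vnorm_nonneg[of "e j"] by (simp add: power2_eq_1_iff)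
qed

lemma onb_eqI:
  assumes "onb e J" "x \<in> hilb" "y \<in> hilb" "\<And>j. j \<in> J \<Longrightarrow> ip (e j) x = ip (e j) y"
  shows "x = y"
proof -
  have "x - y = 0"
    using assms by (intro onb_total[OF assms(1)]) (auto simp: ip_diff_right onb_hilb)
  then show ?thesis by simp
qed

lemma onb_closed_span: "onb e J \<Longrightarrow> x \<in> hilb \<Longrightarrow> x \<in> closed_span e J"
  unfolding closed_span_def using onb_total ip_zero(1) by fastforce

lemma closed_span_hilb: "x \<in> closed_span e J \<Longrightarrow> x \<in> hilb"
  by (simp add: closed_span_def)

lemma closed_span_add: "x \<in> closed_span e J \<Longrightarrow> y \<in> closed_span e J \<Longrightarrow> x + y \<in> closed_span e J"
  by (auto simp: closed_span_def ip_add_right)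

lemma closed_span_scale: "x \<in> closed_span e J \<Longrightarrow> vscale c x \<in> closed_span e J"
  by (auto simp: closed_span_def ip_scale_right)

lemma onb_ket: "onb ket labels"
proof -
  have "x = 0" if "x \<in> hilb" "\<forall>i\<in>labels. ip (ket i) x = 0" for x
    using that hilb_outside[OF that(1)] by (metis ext ip_ket zero_fun_apply)
  moreover have "ip (ket i) (ket j) = (if i = j then 1 else 0)" if "i \<in> labels" "j \<in> labels" for i j
    using that by (simp add: ip_ket) (simp add: ket_def)
  ultimately show ?thesis unfolding onb_def orthonormal_def by blast
qed

section \<open>Bessel's inequality, the Riesz-Fischer theorem and Parseval's identity\<close>

lemma orthonormal_finite_sum:
  fixes c :: "'j \<Rightarrow> complex"
  assumes "orthonormal e J" "finite F" "F \<subseteq> J"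
  defines "p \<equiv> (\<Sum>j\<in>F. vscale (c j) (e j))"
  shows "p \<in> hilb" "\<And>k. k \<in> J \<Longrightarrow> ip (e k) p = (if k \<in> F then c k else 0)"
    "(vnorm p)\<^sup>2 = (\<Sum>j\<in>F. (cmod (c j))\<^sup>2)"
proof -
  show p: "p \<in> hilb" unfolding p_def using assms by (intro hilb_sum hilb_scale orthonormal_hilb[OF assms(1)]) auto
  show ip: "ip (e k) p = (if k \<in> F then c k else 0)" if "k \<in> J" for k
  proof -
    have "ip (e k) p = (\<Sum>j\<in>F. ip (e k) (vscale (c j) (e j)))"
      unfolding p_def using assms that by (intro ip_sum_right) (auto intro: orthonormal_hilb)
    also have "\<dots> = (\<Sum>j\<in>F. if k = j then c j else 0)"
      using assms that by (intro sum.cong) (auto simp: ip_scale_right orthonormal_ip)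
    finally show ?thesis using assms by simp
  qed
  have "ip p p = (\<Sum>j\<in>F. ip (vscale (c j) (e j)) p)"
    using p assms by (subst (1) p_def) (intro ip_sum_left, auto intro: orthonormal_hilb)
  also have "\<dots> = (\<Sum>j\<in>F. complex_of_real ((cmod (c j))\<^sup>2))"
    using assms ip by (intro sum.cong) (auto simp: ip_scale_left complex_norm_square mult.commute subset_iff simp del: of_real_power)
  finally have "complex_of_real ((vnorm p)\<^sup>2) = complex_of_real (\<Sum>j\<in>F. (cmod (c j))\<^sup>2)"
    using ip_self[OF p] by simp
  then show "(vnorm p)\<^sup>2 = (\<Sum>j\<in>F. (cmod (c j))\<^sup>2)" by (simp only: of_real_eq_iff)
qed

lemma bessel_finite:
  assumes "orthonormal e J" "x \<in> hilb" "finite F" "F \<subseteq> J"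
  shows "(\<Sum>j\<in>F. (cmod (ip (e j) x))\<^sup>2) \<le> (vnorm x)\<^sup>2"
proof -
  \<comment> \<open>The orthogonal projection of \<open>x\<close> onto the span of the chosen
    vectors. Since <p, x> = ||p||^2, Cauchy-Schwarz gives ||p|| <= ||x||.\<close>
  define p where "p = (\<Sum>j\<in>F. vscale (ip (e j) x) (e j))"
  note p = orthonormal_finite_sum[OF assms(1,3,4), where c = "\<lambda>j. ip (e j) x", folded p_def]
  have "ip p x = (\<Sum>j\<in>F. ip (vscale (ip (e j) x) (e j)) x)"
    unfolding p_def using assms by (intro ip_sum_left) (auto intro: orthonormal_hilb)
  also have "\<dots> = complex_of_real ((vnorm p)\<^sup>2)"
    unfolding p(3) of_real_sum complex_norm_square by (simp add: ip_scale_left mult.commute)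
  finally have "Re (ip p x) = (vnorm p)\<^sup>2" by simp
  then have "(vnorm p)\<^sup>2 \<le> vnorm p * vnorm x"
    using cauchy_schwarz[OF p(1) assms(2)] complex_Re_le_cmod[of "ip p x"] by simp
  then have "vnorm p \<le> vnorm x"
    using vnorm_nonneg[of p] vnorm_nonneg[of x]
    by (cases "vnorm p = 0") (auto simp: power2_eq_square)
  then show ?thesis using p(3) by (metis power_mono vnorm_nonneg)
qed

lemma bessel_summable:
  assumes "orthonormal e J" "x \<in> hilb"
  shows "(\<lambda>j. (cmod (ip (e j) x))\<^sup>2) summable_on J"
  by (rule nonneg_bdd_above_summable_on)
    (auto intro!: bdd_aboveI[where M = "(vnorm x)\<^sup>2"] bessel_finite assms)

text \<open>The sum over an arbitrary index set is approximated along an increasing sequence of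
  finite sets \<open>F n\<close>, each within \<open>\<delta> n\<close> of the total. The
  corresponding partial sums of vectors form a Cauchy sequence, and its limit has the prescribed
  coefficients.\<close>

lemma riesz_fischer:
  assumes o: "orthonormal e J" and S: "((\<lambda>j. (cmod (c j))\<^sup>2) has_sum S) J"
  shows "\<exists>p \<in> closed_span e J. (\<forall>j\<in>J. ip (e j) p = c j) \<and> (vnorm p)\<^sup>2 = S"
proof -
  let ?s = "\<lambda>F. \<Sum>j\<in>F. (cmod (c j))\<^sup>2"
  define \<delta> where "\<delta> n = inverse (real (Suc n))" for n
  have \<delta>: "0 < \<delta> n" for n by (simp add: \<delta>_def)
  have \<delta>0: "\<delta> \<longlonglongrightarrow> 0" unfolding \<delta>_def by (rule LIMSEQ_inverse_real_of_nat)
  have "\<exists>G. finite G \<and> G \<subseteq> J \<and> (\<forall>H. finite H \<and> G \<subseteq> H \<and> H \<subseteq> J \<longrightarrow> dist (?s H) S < \<delta> n)" for n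
    using tendstoD[OF S[unfolded has_sum_def] \<delta>[of n]]
    unfolding eventually_finite_subsets_at_top by blast
  then obtain G where G: "\<And>n. finite (G n)" "\<And>n. G n \<subseteq> J"
    "\<And>n H. finite H \<Longrightarrow> G n \<subseteq> H \<Longrightarrow> H \<subseteq> J \<Longrightarrow> dist (?s H) S < \<delta> n" by metis
  define F where "F n = (\<Union>k\<le>n. G k)" for n
  have F: "finite (F n)" "F n \<subseteq> J" for n using G by (auto simp: F_def)
  have Fm: "F m \<subseteq> F n" if "m \<le> n" for m n using that by (fastforce simp: F_def)
  have Fd: "\<bar>?s H - S\<bar> < \<delta> n" if "finite H" "F n \<subseteq> H" "H \<subseteq> J" for H n
    using G(3)[of H n] that by (auto simp: F_def dist_real_def)
  define p where "p n = (\<Sum>j\<in>F n. vscale (c j) (e j))" for n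
  note pn = orthonormal_finite_sum[OF o F(1) F(2), where c = c, folded p_def]
  have diff: "(vnorm (p m - p n))\<^sup>2 < 2 * \<delta> n" if "n \<le> m" for m n
  proof -
    have "p m - p n = (\<Sum>j\<in>F m - F n. vscale (c j) (e j))"
      unfolding p_def using Fm[OF that] F by (simp add: sum_diff)
    then have "(vnorm (p m - p n))\<^sup>2 = ?s (F m - F n)"
      using orthonormal_finite_sum(3)[OF o, of "F m - F n" c] F by auto
    also have "\<dots> = ?s (F m) - ?s (F n)" using Fm[OF that] F by (simp add: sum_diff)
    also have "\<dots> < 2 * \<delta> n" using Fd[of "F m" n] Fd[of "F n" n] F Fm[OF that] by fastforce
    finally show ?thesis .
  qed
  have "\<exists>q\<in>hilb. (\<lambda>n. vnorm (p n - q)) \<longlonglongrightarrow> 0"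
  proof (rule hilb_complete)
    fix \<epsilon> :: real assume "0 < \<epsilon>"
    then have "0 < (\<epsilon>/2)\<^sup>2 / 2" by simp
    from LIMSEQ_D[OF \<delta>0 this] obtain N where "norm (\<delta> N - 0) < (\<epsilon>/2)\<^sup>2 / 2"
      by blast
    then have N: "\<delta> N < (\<epsilon>/2)\<^sup>2 / 2" by (simp only: diff_zero real_norm_def)
    have near: "vnorm (p m - p N) < \<epsilon>/2" if "N \<le> m" for m
    proof -
      have "(vnorm (p m - p N))\<^sup>2 < (\<epsilon>/2)\<^sup>2" using diff[OF that] N by linarith
      then show ?thesis by (rule power2_less_imp_less) (use \<open>0 < \<epsilon>\<close> in simp)
    qed
    have "vnorm (p m - p n) < \<epsilon>" if "N \<le> m" "N \<le> n" for m n
      using vnorm_triangle_diff2[of "p m - p N" "p n - p N"] near[OF that(1)] near[OF that(2)] pn(1)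
      by simp
    then show "\<exists>N. \<forall>m\<ge>N. \<forall>n\<ge>N. vnorm (p m - p n) < \<epsilon>" by blast
  qed (rule pn(1))
  then obtain q where q: "q \<in> hilb" "(\<lambda>n. vnorm (p n - q)) \<longlonglongrightarrow> 0" by blast
  have ipq: "(\<lambda>n. ip z (p n)) \<longlonglongrightarrow> ip z q" if "z \<in> hilb" for z
    by (rule ip_tendsto_right[OF that pn(1) q])
  have "ip (e j) q = c j" if j: "j \<in> J" for j
  proof (cases "\<exists>n. j \<in> F n")
    case True
    then obtain N where "j \<in> F N" by blast
    then have "\<forall>\<^sub>F n in sequentially. ip (e j) (p n) = c j"
      using pn(2)[OF j] Fm by (intro eventually_sequentiallyI[of N]) auto
    then have "(\<lambda>n. ip (e j) (p n)) \<longlonglongrightarrow> c j" by (rule tendsto_eventually)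
    then show ?thesis using ipq[OF orthonormal_hilb[OF o j]] LIMSEQ_unique by blast
  next
    \<comment> \<open>Adding an index missed by every \<open>F n\<close> changes the partial sum by
      at most \<open>2 * \<delta> n\<close>, so its coefficient is 0.\<close>
    case False
    have "(cmod (c j))\<^sup>2 \<le> 2 * \<delta> n" for n
    proof -
      have "?s (insert j (F n)) = (cmod (c j))\<^sup>2 + ?s (F n)" using False F by simp
      moreover have "F n \<subseteq> insert j (F n)" by blast
      ultimately show ?thesis
        using Fd[of "insert j (F n)" n] Fd[of "F n" n] F j by fastforce
    qed
    moreover have "(\<lambda>n. 2 * \<delta> n) \<longlonglongrightarrow> 0" using tendsto_mult_right_zero[OF \<delta>0] .
    ultimately have "(cmod (c j))\<^sup>2 \<le> 0" by (meson LIMSEQ_le_const)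
    then have "c j = 0" by simp
    moreover have "ip (e j) (p n) = 0" for n using pn(2)[OF j] False by simp
    ultimately show ?thesis
      using ipq[OF orthonormal_hilb[OF o j]] by (simp add: LIMSEQ_const_iff)
  qed
  moreover have "q \<in> closed_span e J"
    unfolding closed_span_def
  proof (intro CollectI conjI ballI impI q(1))
    fix z assume z: "z \<in> hilb" "\<forall>j\<in>J. ip (e j) z = 0"
    have "ip z (p n) = 0" for n
    proof -
      have "ip z (p n) = (\<Sum>j\<in>F n. ip z (vscale (c j) (e j)))"
        unfolding p_def using z F by (intro ip_sum_right hilb_scale orthonormal_hilb[OF o]) blast+
      also have "\<dots> = 0"
      proof (rule sum.neutral, rule ballI)
        fix j assume "j \<in> F n"
        then have "ip (e j) z = 0" using z F by blast
        then have "ip z (e j) = 0" by (metis cnj_ip complex_cnj_zero)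
        then show "ip z (vscale (c j) (e j)) = 0" by (simp add: ip_scale_right)
      qed
      finally show ?thesis .
    qed
    then show "ip z q = 0" using ipq[OF z(1)] by (simp add: LIMSEQ_const_iff)
  qed
  moreover have "(vnorm q)\<^sup>2 = S"
  proof (rule LIMSEQ_unique)
    show "(\<lambda>n. (vnorm (p n))\<^sup>2) \<longlonglongrightarrow> (vnorm q)\<^sup>2"
      by (intro tendsto_power vnorm_tendsto[OF pn(1) q])
    show "(\<lambda>n. (vnorm (p n))\<^sup>2) \<longlonglongrightarrow> S"
    proof (rule LIM_zero_cancel, rule Lim_null_comparison[OF _ \<delta>0])
      show "\<forall>\<^sub>F n in sequentially. norm ((vnorm (p n))\<^sup>2 - S) \<le> \<delta> n"
        using Fd F by (auto simp: pn(3) less_imp_le)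
    qed
  qed
  ultimately show ?thesis by blast
qed

text \<open>The Riesz-Fischer vector with the coefficients of \<open>x\<close> has the right norm.
  Its difference from \<open>x\<close> is orthogonal to all \<open>e j\<close> and lies in the
  closed span, hence is orthogonal to itself.\<close>

lemma parseval:
  assumes o: "orthonormal e J" and x: "x \<in> closed_span e J"
  shows "((\<lambda>j. (cmod (ip (e j) x))\<^sup>2) has_sum (vnorm x)\<^sup>2) J"
proof -
  note xh = closed_span_hilb[OF x]
  obtain S where S: "((\<lambda>j. (cmod (ip (e j) x))\<^sup>2) has_sum S) J"
    using bessel_summable[OF o xh] summable_iff_has_sum_infsum by blast
  from riesz_fischer[OF o S] obtain p where p: "p \<in> closed_span e J"
    "\<And>j. j \<in> J \<Longrightarrow> ip (e j) p = ip (e j) x" "(vnorm p)\<^sup>2 = S" by blast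
  note ph = closed_span_hilb[OF p(1)]
  have "x - p \<in> closed_span e J"
    using closed_span_add[OF x closed_span_scale[OF p(1), of "-1"]] by (simp add: diff_eq_add_vscale)
  moreover have "ip (e j) (x - p) = 0" if "j \<in> J" for j
    using p(2)[OF that] orthonormal_hilb[OF o that] xh ph by (simp add: ip_diff_right)
  ultimately have "ip (x - p) (x - p) = 0" using xh ph unfolding closed_span_def by blast
  then have "vnorm (x - p) = 0" using ip_self[of "x - p"] xh ph by simp
  then have "x - p = 0" using vnorm_eq_zero xh ph by blast
  then show ?thesis using S p(3) by simp
qed

lemma parseval_Re:
  assumes o: "orthonormal e J" and x: "x \<in> closed_span e J" and y: "y \<in> closed_span e J"
  shows "((\<lambda>j. Re (cnj (ip (e j) x) * ip (e j) y)) has_sum Re (ip x y)) J"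
proof -
  note h = closed_span_hilb[OF x] closed_span_hilb[OF y]
  have pol: "Re (cnj a * b) = ((cmod (a + b))\<^sup>2 - (cmod a)\<^sup>2 - (cmod b)\<^sup>2) / 2" for a b
    by (simp add: cmod_power2) (simp add: power2_eq_square algebra_simps)
  have "((\<lambda>j. ((cmod (ip (e j) (x + y)))\<^sup>2 + - (cmod (ip (e j) x))\<^sup>2 + - (cmod (ip (e j) y))\<^sup>2) * (1/2))
      has_sum ((vnorm (x + y))\<^sup>2 + - (vnorm x)\<^sup>2 + - (vnorm y)\<^sup>2) * (1/2)) J"
    by (intro has_sum_cmult_left has_sum_add has_sum_uminusI parseval[OF o] closed_span_add x y)
  moreover have "((vnorm (x + y))\<^sup>2 + - (vnorm x)\<^sup>2 + - (vnorm y)\<^sup>2) * (1/2) = Re (ip x y)"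
    using vnorm_power2_add[OF h] by simp
  moreover have "((cmod (ip (e j) (x + y)))\<^sup>2 + - (cmod (ip (e j) x))\<^sup>2 + - (cmod (ip (e j) y))\<^sup>2) * (1/2)
      = Re (cnj (ip (e j) x) * ip (e j) y)" if "j \<in> J" for j
    using orthonormal_hilb[OF o that] h unfolding pol by (simp only: ip_add_right) simp
  ultimately show ?thesis by (metis (no_types, lifting) has_sum_cong)
qed

text \<open>Only \<open>x\<close> lies in the closed span, so \<open>z\<close> is replaced by its
  projection \<open>p\<close>, which has the same coefficients. The imaginary part is the real part
  of the identity for \<open>vscale (- \<i>) x\<close>.\<close>

lemma parseval_ip:
  assumes o: "orthonormal e J" and z: "z \<in> hilb" and x: "x \<in> closed_span e J"
  shows "((\<lambda>j. cnj (ip (e j) z) * ip (e j) x) has_sum ip z x) J"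
proof -
  note xh = closed_span_hilb[OF x]
  obtain S where S: "((\<lambda>j. (cmod (ip (e j) z))\<^sup>2) has_sum S) J"
    using bessel_summable[OF o z] summable_iff_has_sum_infsum by blast
  from riesz_fischer[OF o S] obtain p where p: "p \<in> closed_span e J"
    "\<And>j. j \<in> J \<Longrightarrow> ip (e j) p = ip (e j) z" by blast
  note ph = closed_span_hilb[OF p(1)]
  have "ip (z - p) x = 0"
  proof -
    have "ip (e j) (z - p) = 0" if "j \<in> J" for j
      using p(2)[OF that] orthonormal_hilb[OF o that] z ph by (simp add: ip_diff_right)
    then show ?thesis using x z ph unfolding closed_span_def by blast
  qed
  then have zp: "ip z x = ip p x" using z ph xh by (simp add: ip_diff_left)
  have re: "((\<lambda>j. Re (cnj (ip (e j) p) * ip (e j) x)) has_sum Re (ip p x)) J"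
    by (rule parseval_Re[OF o p(1) x])
  have "((\<lambda>j. Re (cnj (ip (e j) p) * ip (e j) (vscale (- \<i>) x))) has_sum Re (ip p (vscale (- \<i>) x))) J"
    by (rule parseval_Re[OF o p(1) closed_span_scale[OF x]])
  then have im: "((\<lambda>j. Im (cnj (ip (e j) p) * ip (e j) x)) has_sum Im (ip p x)) J"
    by (simp add: ip_scale_right algebra_simps)
  have "((\<lambda>j. complex_of_real (Re (cnj (ip (e j) p) * ip (e j) x)) + \<i> * complex_of_real (Im (cnj (ip (e j) p) * ip (e j) x)))
      has_sum (complex_of_real (Re (ip p x)) + \<i> * complex_of_real (Im (ip p x)))) J"
    by (intro has_sum_add has_sum_cmult_right has_sum_of_real re im)
  then have "((\<lambda>j. cnj (ip (e j) p) * ip (e j) x) has_sum ip p x) J"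
    by (simp only: complex_eq[symmetric])
  then show ?thesis unfolding zp by (simp add: p(2) cong: has_sum_cong)
qed

section \<open>Diagonal operators\<close>

lemma linear_op_hilb: "linear_op T \<Longrightarrow> (x, y) \<in> T \<Longrightarrow> x \<in> hilb \<and> y \<in> hilb"
  and linear_op_zero: "linear_op T \<Longrightarrow> (0, 0) \<in> T"
  and linear_op_unique: "linear_op T \<Longrightarrow> (x, y) \<in> T \<Longrightarrow> (x, y') \<in> T \<Longrightarrow> y = y'"
  and linear_op_add: "linear_op T \<Longrightarrow> (x, y) \<in> T \<Longrightarrow> (x', y') \<in> T \<Longrightarrow> (x + x', y + y') \<in> T"
  and linear_op_scale: "linear_op T \<Longrightarrow> (x, y) \<in> T \<Longrightarrow> (vscale c x, vscale c y) \<in> T"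
  unfolding linear_op_def single_valued_def by blast+

lemma linear_op_diff: "linear_op T \<Longrightarrow> (x, y) \<in> T \<Longrightarrow> (x', y') \<in> T \<Longrightarrow> (x - x', y - y') \<in> T"
  unfolding diff_eq_add_vscale by (blast intro: linear_op_add linear_op_scale)

lemma op_apply_eq: "linear_op T \<Longrightarrow> (x, y) \<in> T \<Longrightarrow> op_apply T x = y"
  unfolding op_apply_def using linear_op_unique by blast

lemma op_apply_in: "linear_op T \<Longrightarrow> x \<in> Domain T \<Longrightarrow> (x, op_apply T x) \<in> T"
  using op_apply_eq by blast

lemma selfadjoint_linear: "selfadjoint T \<Longrightarrow> linear_op T"
  by (simp add: selfadjoint_def)

lemma selfadjoint_sym: "selfadjoint T \<Longrightarrow> (x, y) \<in> T \<Longrightarrow> (u, v) \<in> T \<Longrightarrow> ip u y = ip v x"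
  unfolding selfadjoint_def adjoint_def by blast

lemma selfadjoint_memI:
  assumes "selfadjoint T" "x \<in> hilb" "y \<in> hilb" "\<And>u v. (u, v) \<in> T \<Longrightarrow> ip u y = ip v x"
  shows "(x, y) \<in> T"
proof -
  have "(x, y) \<in> adjoint T" using assms unfolding adjoint_def by blast
  then show ?thesis using assms(1) by (simp add: selfadjoint_def)
qed

lemma onb_parseval:
  "onb e J \<Longrightarrow> x \<in> hilb \<Longrightarrow> ((\<lambda>j. (cmod (ip (e j) x))\<^sup>2) has_sum (vnorm x)\<^sup>2) J"
  by (intro parseval onb_orthonormal onb_closed_span)

lemma onb_parseval_ip:
  "onb e J \<Longrightarrow> z \<in> hilb \<Longrightarrow> x \<in> hilb \<Longrightarrow> ((\<lambda>j. cnj (ip (e j) z) * ip (e j) x) has_sum ip z x) J"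
  by (intro parseval_ip onb_orthonormal onb_closed_span)

text \<open>The operator with eigenvectors \<open>e j\<close> and eigenvalues \<open>f j\<close>.
  Because \<open>y\<close> is merely some vector with the right coefficients, the domain is
  automatically maximal.\<close>

definition diag_op :: "('j \<Rightarrow> vec) \<Rightarrow> 'j set \<Rightarrow> ('j \<Rightarrow> real) \<Rightarrow> oper" where
  "diag_op e J f = {(x, y). x \<in> hilb \<and> y \<in> hilb
     \<and> (\<forall>j\<in>J. ip (e j) y = complex_of_real (f j) * ip (e j) x)}"

lemma diag_opI:
  "x \<in> hilb \<Longrightarrow> y \<in> hilb \<Longrightarrow> (\<And>j. j \<in> J \<Longrightarrow> ip (e j) y = complex_of_real (f j) * ip (e j) x)
    \<Longrightarrow> (x, y) \<in> diag_op e J f"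
  by (simp add: diag_op_def)

lemma diag_opD:
  assumes "(x, y) \<in> diag_op e J f"
  shows "x \<in> hilb" "y \<in> hilb" "j \<in> J \<Longrightarrow> ip (e j) y = complex_of_real (f j) * ip (e j) x"
  using assms by (auto simp: diag_op_def)

lemma diag_op_cong: "(\<And>j. j \<in> J \<Longrightarrow> f j = g j) \<Longrightarrow> diag_op e J f = diag_op e J g"
  by (auto simp: diag_op_def)

lemma diag_op_linear:
  assumes "onb e J" shows "linear_op (diag_op e J f)"
proof -
  have h: "e j \<in> hilb" if "j \<in> J" for j using assms that by (rule onb_hilb)
  have "single_valued (diag_op e J f)"
    unfolding single_valued_def
  proof (intro allI impI)
    fix x y y' assume *: "(x, y) \<in> diag_op e J f" "(x, y') \<in> diag_op e J f"
    show "y = y'"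
      by (rule onb_eqI[OF assms]) (use diag_opD[OF *(1)] diag_opD[OF *(2)] in auto)
  qed
  then show ?thesis unfolding linear_op_def
    by (auto simp: diag_op_def h ip_add_right ip_scale_right algebra_simps)
qed

lemma diag_op_basis:
  assumes "onb e J" "j \<in> J"
  shows "(e j, vscale (complex_of_real (f j)) (e j)) \<in> diag_op e J f"
  using assms onb_hilb[OF assms]
  by (intro diag_opI) (auto simp: ip_scale_right orthonormal_ip[OF onb_orthonormal])

lemma diag_op_has_sum:
  assumes "onb e J" "(x, y) \<in> diag_op e J f"
  shows "((\<lambda>j. (f j)\<^sup>2 * (cmod (ip (e j) x))\<^sup>2) has_sum (vnorm y)\<^sup>2) J"
proof -
  have "((\<lambda>j. (cmod (ip (e j) y))\<^sup>2) has_sum (vnorm y)\<^sup>2) J"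
    by (rule onb_parseval[OF assms(1) diag_opD(2)[OF assms(2)]])
  moreover have "(cmod (ip (e j) y))\<^sup>2 = (f j)\<^sup>2 * (cmod (ip (e j) x))\<^sup>2" if "j \<in> J" for j
    using diag_opD(3)[OF assms(2) that] by (simp add: norm_mult power_mult_distrib)
  ultimately show ?thesis by (metis (no_types, lifting) has_sum_cong)
qed

lemma diag_op_exists:
  assumes "onb e J" "x \<in> hilb" "(\<lambda>j. (f j)\<^sup>2 * (cmod (ip (e j) x))\<^sup>2) summable_on J"
  obtains y where "(x, y) \<in> diag_op e J f"
proof -
  have "(\<lambda>j. (cmod (complex_of_real (f j) * ip (e j) x))\<^sup>2) summable_on J"
    using assms(3) by (simp add: norm_mult power_mult_distrib)
  then obtain S where "((\<lambda>j. (cmod (complex_of_real (f j) * ip (e j) x))\<^sup>2) has_sum S) J"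
    using summable_iff_has_sum_infsum by blast
  from riesz_fischer[OF onb_orthonormal[OF assms(1)] this] obtain y where "y \<in> closed_span e J"
    "\<And>j. j \<in> J \<Longrightarrow> ip (e j) y = complex_of_real (f j) * ip (e j) x" by blast
  then have "(x, y) \<in> diag_op e J f" using assms(2) closed_span_hilb[of y] by (intro diag_opI)
  then show ?thesis by (rule that)
qed

lemma diag_op_Domain:
  assumes "onb e J"
  shows "Domain (diag_op e J f)
    = {x \<in> hilb. (\<lambda>j. (f j)\<^sup>2 * (cmod (ip (e j) x))\<^sup>2) summable_on J}"
proof (intro set_eqI iffI)
  fix x assume "x \<in> Domain (diag_op e J f)"
  then obtain y where "(x, y) \<in> diag_op e J f" by blast
  then show "x \<in> {x \<in> hilb. (\<lambda>j. (f j)\<^sup>2 * (cmod (ip (e j) x))\<^sup>2) summable_on J}"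
    using has_sum_imp_summable[OF diag_op_has_sum[OF assms]] diag_opD(1) by blast
next
  fix x assume "x \<in> {x \<in> hilb. (\<lambda>j. (f j)\<^sup>2 * (cmod (ip (e j) x))\<^sup>2) summable_on J}"
  then show "x \<in> Domain (diag_op e J f)" using diag_op_exists[OF assms] by blast
qed

lemma diag_op_ip:
  assumes "onb e J" "(x, y) \<in> diag_op e J f" "u \<in> hilb"
  shows "((\<lambda>j. complex_of_real (f j) * (cnj (ip (e j) u) * ip (e j) x)) has_sum ip u y) J"
proof -
  have "((\<lambda>j. cnj (ip (e j) u) * ip (e j) y) has_sum ip u y) J"
    by (rule onb_parseval_ip[OF assms(1,3) diag_opD(2)[OF assms(2)]])
  moreover have "cnj (ip (e j) u) * ip (e j) y = complex_of_real (f j) * (cnj (ip (e j) u) * ip (e j) x)"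
    if "j \<in> J" for j using diag_opD(3)[OF assms(2) that] by simp
  ultimately show ?thesis by (metis (no_types, lifting) has_sum_cong)
qed

lemma diag_op_quadratic:
  assumes "onb e J" "(x, y) \<in> diag_op e J f"
  shows "((\<lambda>j. f j * (cmod (ip (e j) x))\<^sup>2) has_sum Re (ip x y)) J"
proof -
  have "complex_of_real (f j) * (cnj (ip (e j) x) * ip (e j) x) = complex_of_real (f j * (cmod (ip (e j) x))\<^sup>2)" for j
    by (simp only: of_real_mult complex_norm_square mult.commute)
  then have "((\<lambda>j. complex_of_real (f j * (cmod (ip (e j) x))\<^sup>2)) has_sum ip x y) J"
    using diag_op_ip[OF assms diag_opD(1)[OF assms(2)]] by (simp only:)
  from has_sum_Re[OF this] show ?thesis by simp
qed

lemma diag_op_sym: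
  assumes "onb e J" "(x, y) \<in> diag_op e J f" "(u, v) \<in> diag_op e J f"
  shows "ip u y = ip v x"
proof -
  have "((\<lambda>j. complex_of_real (f j) * (cnj (ip (e j) u) * ip (e j) x)) has_sum ip u y) J"
    by (rule diag_op_ip[OF assms(1,2) diag_opD(1)[OF assms(3)]])
  moreover have "((\<lambda>j. cnj (ip (e j) v) * ip (e j) x) has_sum ip v x) J"
    by (rule onb_parseval_ip[OF assms(1) diag_opD(2)[OF assms(3)] diag_opD(1)[OF assms(2)]])
  moreover have "cnj (ip (e j) v) * ip (e j) x = complex_of_real (f j) * (cnj (ip (e j) u) * ip (e j) x)"
    if "j \<in> J" for j using diag_opD(3)[OF assms(3) that] by simp
  ultimately show ?thesis by (metis (no_types, lifting) has_sum_cong has_sum_unique)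
qed

lemma eigenvector_coeff:
  assumes "onb e J" "j \<in> J" "(e j, vscale (complex_of_real (f j)) (e j)) \<in> T"
    and "\<And>u v. (u, v) \<in> T \<Longrightarrow> ip u y = ip v x"
  shows "ip (e j) y = complex_of_real (f j) * ip (e j) x"
  using assms(4)[OF assms(3)] by (simp add: ip_scale_left)

lemma diag_op_selfadjoint:
  assumes "onb e J" shows "selfadjoint (diag_op e J f)"
proof -
  have "adjoint (diag_op e J f) \<subseteq> diag_op e J f"
  proof
    fix p assume p: "p \<in> adjoint (diag_op e J f)"
    obtain x y where xy: "p = (x, y)" by (cases p)
    have "x \<in> hilb" "y \<in> hilb" and *: "\<And>u v. (u, v) \<in> diag_op e J f \<Longrightarrow> ip u y = ip v x"
      using p unfolding xy adjoint_def by auto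
    then show "p \<in> diag_op e J f" unfolding xy
      by (intro diag_opI eigenvector_coeff[OF assms _ diag_op_basis[OF assms]])
  qed
  moreover have "diag_op e J f \<subseteq> adjoint (diag_op e J f)"
    using diag_op_sym[OF assms, of _ _ f] by (auto simp: adjoint_def dest: diag_opD(1,2))
  ultimately show ?thesis using diag_op_linear[OF assms] by (auto simp: selfadjoint_def)
qed

lemma diag_op_positive:
  assumes "onb e J" "\<And>j. j \<in> J \<Longrightarrow> 0 \<le> f j"
  shows "positive_selfadjoint (diag_op e J f)"
  unfolding positive_selfadjoint_def
  using diag_op_selfadjoint[OF assms(1)] has_sum_nonneg[OF diag_op_quadratic[OF assms(1)]] assms(2)
  by fastforce

text \<open>A selfadjoint operator has no proper symmetric extension: testing against the
  eigenvectors places \<open>T\<close> inside the diagonal operator, and the latter is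
  symmetric.\<close>

lemma selfadjoint_eq_diag_op:
  assumes o: "onb e J" and T: "selfadjoint T"
    and ev: "\<And>j. j \<in> J \<Longrightarrow> (e j, vscale (complex_of_real (f j)) (e j)) \<in> T"
  shows "T = diag_op e J f"
proof
  show sub: "T \<subseteq> diag_op e J f"
  proof
    fix p assume p: "p \<in> T"
    obtain x y where xy: "p = (x, y)" by (cases p)
    have "x \<in> hilb" "y \<in> hilb" using linear_op_hilb[OF selfadjoint_linear[OF T]] p xy by auto
    then show "p \<in> diag_op e J f" unfolding xy
      by (intro diag_opI eigenvector_coeff[OF o _ ev] selfadjoint_sym[OF T p[unfolded xy]])
  qed
  show "diag_op e J f \<subseteq> T"
  proof
    fix p assume p: "p \<in> diag_op e J f"
    obtain x y where xy: "p = (x, y)" by (cases p)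
    show "p \<in> T" unfolding xy
      by (rule selfadjoint_memI[OF T])
        (use p xy sub diag_op_sym[OF o] diag_opD(1,2) in \<open>blast+\<close>)
  qed
qed

lemma diag_op_square:
  assumes o: "onb e J"
  shows "op_mult (diag_op e J f) (diag_op e J f) = diag_op e J (\<lambda>j. (f j)\<^sup>2)"
proof
  show "op_mult (diag_op e J f) (diag_op e J f) \<subseteq> diag_op e J (\<lambda>j. (f j)\<^sup>2)"
    by (auto simp: op_mult_def diag_op_def power2_eq_square)
  show "diag_op e J (\<lambda>j. (f j)\<^sup>2) \<subseteq> op_mult (diag_op e J f) (diag_op e J f)"
  proof
    fix p assume p: "p \<in> diag_op e J (\<lambda>j. (f j)\<^sup>2)"
    obtain x y where xy: "p = (x, y)" by (cases p)
    note p' = p[unfolded xy]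
    \<comment> \<open>By f^2 <= f^4 + 1 the domain of the square lies inside the domain of the
      operator, so the intermediate vector exists.\<close>
    have "(\<lambda>j. ((f j)\<^sup>2)\<^sup>2 * (cmod (ip (e j) x))\<^sup>2 + (cmod (ip (e j) x))\<^sup>2) summable_on J"
      by (intro summable_on_add has_sum_imp_summable[OF diag_op_has_sum[OF o p']]
          bessel_summable[OF onb_orthonormal[OF o] diag_opD(1)[OF p']])
    then have "(\<lambda>j. (f j)\<^sup>2 * (cmod (ip (e j) x))\<^sup>2) summable_on J"
    proof (rule summable_on_comparison_test)
      fix j
      have "(f j)\<^sup>2 \<le> ((f j)\<^sup>2)\<^sup>2 + 1"
        using sum_squares_bound[of "(f j)\<^sup>2" 1] zero_le_power2[of "f j"] by (simp only: mult_1_right one_power2)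
      from mult_right_mono[OF this, of "(cmod (ip (e j) x))\<^sup>2"]
      show "(f j)\<^sup>2 * (cmod (ip (e j) x))\<^sup>2 \<le> ((f j)\<^sup>2)\<^sup>2 * (cmod (ip (e j) x))\<^sup>2 + (cmod (ip (e j) x))\<^sup>2"
        by (simp add: algebra_simps)
    qed simp
    from diag_op_exists[OF o diag_opD(1)[OF p'] this] obtain z where z: "(x, z) \<in> diag_op e J f" .
    then have "(z, y) \<in> diag_op e J f"
      using diag_opD[OF p'] diag_opD[OF z] by (intro diag_opI) (auto simp: power2_eq_square)
    with z show "p \<in> op_mult (diag_op e J f) (diag_op e J f)"
      unfolding op_mult_def xy by blast
  qed
qed

text \<open>For an eigenvector \<open>e j\<close> of the square let \<mu> = |f j| and d = S (e j) -
  \<mu> e j. Then S d = - \<mu> d, and positivity of \<open>S\<close> forces d = 0 if \<mu> > 0. If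
  \<mu> = 0, then ||S (e j)||^2 = <S^2 (e j), e j> = 0.\<close>

lemma positive_root_unique:
  assumes o: "onb e J" and S: "positive_selfadjoint S"
    and SS: "op_mult S S = diag_op e J (\<lambda>j. (f j)\<^sup>2)"
  shows "S = diag_op e J (\<lambda>j. \<bar>f j\<bar>)"
proof (rule selfadjoint_eq_diag_op[OF o])
  show sa: "selfadjoint S" using S by (simp add: positive_selfadjoint_def)
  note lin = selfadjoint_linear[OF sa]
  fix j assume j: "j \<in> J"
  let ?\<mu> = "\<bar>f j\<bar>"
  have "(e j, vscale (complex_of_real ((f j)\<^sup>2)) (e j)) \<in> op_mult S S"
    unfolding SS by (rule diag_op_basis[OF o j])
  then obtain z where z: "(e j, z) \<in> S" "(z, vscale (complex_of_real ((f j)\<^sup>2)) (e j)) \<in> S"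
    unfolding op_mult_def by blast
  note zh = linear_op_hilb[OF lin z(1)] linear_op_hilb[OF lin z(2)]
  define d where "d = z - vscale (complex_of_real ?\<mu>) (e j)"
  have dh: "d \<in> hilb" unfolding d_def using zh by auto
  have "(d, vscale (complex_of_real ((f j)\<^sup>2)) (e j) - vscale (complex_of_real ?\<mu>) z) \<in> S"
    unfolding d_def by (intro linear_op_diff[OF lin] z linear_op_scale[OF lin])
  moreover have "vscale (complex_of_real ((f j)\<^sup>2)) (e j) - vscale (complex_of_real ?\<mu>) z
      = vscale (complex_of_real (- ?\<mu>)) d"
  proof -
    have "complex_of_real ((f j)\<^sup>2) = complex_of_real ?\<mu> * complex_of_real ?\<mu>"
      by (simp only: of_real_mult[symmetric] abs_mult_self_eq power2_eq_square)
    then show ?thesis unfolding d_def by (simp only: vscale_diff vscale_simps) (simp add: fun_eq_iff)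
  qed
  ultimately have "0 \<le> Re (ip d (vscale (complex_of_real (- ?\<mu>)) d))"
    using S by (auto simp: positive_selfadjoint_def)
  then have *: "?\<mu> * (vnorm d)\<^sup>2 \<le> 0" using ip_self[OF dh] by (simp add: ip_scale_right)
  have "z = vscale (complex_of_real ?\<mu>) (e j)"
  proof (cases "f j = 0")
    case True
    then have "(z, 0) \<in> S" using z(2) by simp
    from selfadjoint_sym[OF sa z(1) this] have "ip z z = 0" by simp
    then have "vnorm z = 0" using ip_self zh by simp
    then show ?thesis using True vnorm_eq_zero zh by simp
  next
    case False
    then have "vnorm d = 0" using * by (simp add: mult_le_0_iff)
    then have "d = 0" using vnorm_eq_zero dh by blast
    then show ?thesis by (simp add: d_def)
  qed
  then show "(e j, vscale (complex_of_real ?\<mu>) (e j)) \<in> S" using z(1) by simp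
qed

text \<open>The hypothesis concerns \<open>op_mult (adjoint T) T\<close> because the Dirac operator
  is off-diagonal in the ket basis and only its square is diagonal there.\<close>

lemma op_abs_eq_diag_op:
  assumes o: "onb e J" and T: "op_mult (adjoint T) T = diag_op e J (\<lambda>j. (f j)\<^sup>2)"
  shows "op_abs T = diag_op e J (\<lambda>j. \<bar>f j\<bar>)"
  unfolding op_abs_def
proof (rule the_equality)
  show "positive_selfadjoint (diag_op e J (\<lambda>j. \<bar>f j\<bar>)) \<and>
    op_mult (diag_op e J (\<lambda>j. \<bar>f j\<bar>)) (diag_op e J (\<lambda>j. \<bar>f j\<bar>)) = op_mult (adjoint T) T"
    using diag_op_positive[OF o] diag_op_square[OF o, of "\<lambda>j. \<bar>f j\<bar>"] by (simp add: T)
qed (use positive_root_unique[OF o] T in simp)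

lemma op_abs_diag_op:
  assumes "onb e J" shows "op_abs (diag_op e J f) = diag_op e J (\<lambda>j. \<bar>f j\<bar>)"
  using diag_op_selfadjoint[OF assms, of f] diag_op_square[OF assms, of f]
  by (intro op_abs_eq_diag_op[OF assms]) (simp add: selfadjoint_def)

text \<open>For \<open>c = 0\<close> the left side would keep the domain of the unscaled operator,
  while the right side would be defined everywhere.\<close>

lemma op_scale_diag_op:
  assumes "c \<noteq> 0"
  shows "op_scale (complex_of_real c) (diag_op e J f) = diag_op e J (\<lambda>j. c * f j)"
proof
  show "op_scale (complex_of_real c) (diag_op e J f) \<subseteq> diag_op e J (\<lambda>j. c * f j)"
    by (auto simp: op_scale_def diag_op_def ip_scale_right)
  show "diag_op e J (\<lambda>j. c * f j) \<subseteq> op_scale (complex_of_real c) (diag_op e J f)"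
  proof
    fix p assume p: "p \<in> diag_op e J (\<lambda>j. c * f j)"
    obtain x y where xy: "p = (x, y)" by (cases p)
    have "(x, vscale (complex_of_real (1 / c)) y) \<in> diag_op e J f"
      using diag_opD[OF p[unfolded xy]] assms by (intro diag_opI) (auto simp: ip_scale_right)
    moreover have "y = vscale (complex_of_real c) (vscale (complex_of_real (1 / c)) y)"
      using assms by (simp add: fun_eq_iff)
    ultimately show "p \<in> op_scale (complex_of_real c) (diag_op e J f)"
      unfolding op_scale_def xy by blast
  qed
qed

lemma diag_op_bounded:
  assumes o: "onb e J" and f: "\<And>j. j \<in> J \<Longrightarrow> \<bar>f j\<bar> \<le> C"
  shows "bounded_op (diag_op e J f)"
proof -
  have f2: "(f j)\<^sup>2 \<le> C\<^sup>2" if "j \<in> J" for j using power_mono[OF f[OF that], of 2] by simp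
  have dom: "Domain (diag_op e J f) = hilb"
  proof -
    have "(\<lambda>j. (f j)\<^sup>2 * (cmod (ip (e j) x))\<^sup>2) summable_on J" if "x \<in> hilb" for x
      by (rule summable_on_comparison_test[OF summable_on_cmult_right[OF
            bessel_summable[OF onb_orthonormal[OF o] that], of "C\<^sup>2"]])
        (auto intro!: mult_right_mono f2)
    then show ?thesis by (auto simp: diag_op_Domain[OF o])
  qed
  have "vnorm y \<le> \<bar>C\<bar>" if xy: "(x, y) \<in> diag_op e J f" and x: "vnorm x \<le> 1" for x y
  proof -
    have "(vnorm y)\<^sup>2 \<le> C\<^sup>2 * (vnorm x)\<^sup>2"
    proof (rule has_sum_mono[OF diag_op_has_sum[OF o xy]])
      show "((\<lambda>j. C\<^sup>2 * (cmod (ip (e j) x))\<^sup>2) has_sum C\<^sup>2 * (vnorm x)\<^sup>2) J"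
        by (intro has_sum_cmult_right parseval onb_orthonormal onb_closed_span o diag_opD(1)[OF xy])
    qed (auto intro!: mult_right_mono f2)
    also have "\<dots> \<le> C\<^sup>2 * 1" using x by (intro mult_left_mono) (auto simp: power_le_one)
    finally have "(vnorm y)\<^sup>2 \<le> \<bar>C\<bar>\<^sup>2" by simp
    then show ?thesis by (rule power2_le_imp_le) simp
  qed
  then have "op_norm (diag_op e J f) \<le> ennreal \<bar>C\<bar>"
    unfolding op_norm_def by (intro SUP_least) (auto intro!: ennreal_leI)
  also have "\<dots> < \<infinity>" by simp
  finally show ?thesis using dom diag_op_linear[OF o] by (simp add: bounded_op_def)
qed

section \<open>Functional calculus\<close>

lemma nn_integral_count_space_has_sum:
  fixes g :: "'a \<Rightarrow> real"
  assumes "\<And>j. j \<in> J \<Longrightarrow> 0 \<le> g j" "(g has_sum S) J"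
  shows "(\<integral>\<^sup>+j. ennreal (g j) \<partial>count_space J) = ennreal S"
proof -
  have "g summable_on J" using assms(2) by (rule has_sum_imp_summable)
  then have a: "Infinite_Set_Sum.abs_summable_on g J"
    using summable_on_iff_abs_summable_on_real[of g J] abs_summable_equivalent[of g J] by blast
  have "(\<integral>\<^sup>+j. ennreal (g j) \<partial>count_space J) = ennreal (infsetsum g J)"
    by (rule nn_integral_conv_infsetsum[OF a assms(1)])
  also have "infsetsum g J = S"
    using infsetsum_infsum[OF a] infsumI[OF assms(2)] by simp
  finally show ?thesis .
qed

lemma summable_on_iff_nn_integral:
  fixes g :: "'a \<Rightarrow> real"
  assumes "\<And>j. j \<in> J \<Longrightarrow> 0 \<le> g j"
  shows "g summable_on J \<longleftrightarrow> (\<integral>\<^sup>+j. ennreal (g j) \<partial>count_space J) < \<infinity>"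
proof -
  have "(\<integral>\<^sup>+j. ennreal (norm (g j)) \<partial>count_space J) = (\<integral>\<^sup>+j. ennreal (g j) \<partial>count_space J)"
    using assms by (intro nn_integral_cong) auto
  then have "integrable (count_space J) g \<longleftrightarrow> (\<integral>\<^sup>+j. ennreal (g j) \<partial>count_space J) < \<infinity>"
    by (simp add: integrable_iff_bounded)
  then show ?thesis
    using summable_on_iff_abs_summable_on_real[of g J] abs_summable_equivalent[of g J]
    unfolding abs_summable_on_def by blast
qed

lemma lebesgue_integral_count_space_has_sum:
  fixes g :: "'a \<Rightarrow> real"
  assumes "(g has_sum S) J"
  shows "(\<integral>j. g j \<partial>count_space J) = S"
proof -
  have a: "Infinite_Set_Sum.abs_summable_on g J"
    using has_sum_imp_summable[OF assms] summable_on_iff_abs_summable_on_real[of g J]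
      abs_summable_equivalent[of g J] by blast
  show ?thesis
    using infsetsum_infsum[OF a] infsumI[OF assms] by (simp add: infsetsum_def)
qed

definition diag_measure :: "('j \<Rightarrow> vec) \<Rightarrow> 'j set \<Rightarrow> ('j \<Rightarrow> real) \<Rightarrow> vec \<Rightarrow> real measure" where
  "diag_measure e J l x = distr (density (count_space J) (\<lambda>j. ennreal ((cmod (ip (e j) x))\<^sup>2))) borel l"

definition diag_pvm :: "('j \<Rightarrow> vec) \<Rightarrow> 'j set \<Rightarrow> ('j \<Rightarrow> real) \<Rightarrow> real set \<Rightarrow> oper" where
  "diag_pvm e J l S = diag_op e J (\<lambda>j. indicator S (l j))"

lemma diag_pvm_bounded: "onb e J \<Longrightarrow> bounded_op (diag_pvm e J l S)"
  unfolding diag_pvm_def by (rule diag_op_bounded[where C = 1]) (auto simp: indicator_def)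

lemma emeasure_diag_measure:
  assumes o: "onb e J" and x: "x \<in> hilb" and S: "S \<in> sets borel"
  shows "emeasure (diag_measure e J l x) S = ennreal (Re (ip x (op_apply (diag_pvm e J l S) x)))"
proof -
  have b: "bounded_op (diag_pvm e J l S)" by (rule diag_pvm_bounded[OF o])
  have "(x, op_apply (diag_pvm e J l S) x) \<in> diag_pvm e J l S"
    using b x by (intro op_apply_in) (auto simp: bounded_op_def)
  from diag_op_quadratic[OF o this[unfolded diag_pvm_def]]
  have hs: "((\<lambda>j. indicator S (l j) * (cmod (ip (e j) x))\<^sup>2) has_sum Re (ip x (op_apply (diag_pvm e J l S) x))) J"
    by (simp add: diag_pvm_def)
  have "emeasure (diag_measure e J l x) S
     = (\<integral>\<^sup>+j. ennreal ((cmod (ip (e j) x))\<^sup>2) * indicator (l -` S \<inter> J) j \<partial>count_space J)"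
    using S unfolding diag_measure_def by (simp add: emeasure_distr emeasure_density)
  also have "\<dots> = (\<integral>\<^sup>+j. ennreal (indicator S (l j) * (cmod (ip (e j) x))\<^sup>2) \<partial>count_space J)"
    by (intro nn_integral_cong) (auto simp: indicator_def)
  also have "\<dots> = ennreal (Re (ip x (op_apply (diag_pvm e J l S) x)))"
    by (rule nn_integral_count_space_has_sum[OF _ hs]) simp
  finally show ?thesis .
qed

lemma sigma_sets_borel_UNIV: "sigma_sets UNIV (sets (borel :: real measure)) = sets borel"
  using sets.sigma_sets_eq[of "borel :: real measure"] by simp

text \<open>Agreement is demanded on Borel sets only, since a projection-valued measure is
  unconstrained on other sets and two resolutions of an operator may differ there.\<close>

lemma scalar_measure_eq_diag_measure:
  assumes "onb e J" "x \<in> hilb" "\<And>S. S \<in> sets borel \<Longrightarrow> E S = diag_pvm e J l S"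
  shows "scalar_measure E x = diag_measure e J l x"
proof -
  have "scalar_measure E x = measure_of UNIV (sets borel) (emeasure (diag_measure e J l x))"
    unfolding scalar_measure_def
    by (rule measure_of_eq) (auto simp: sigma_sets_borel_UNIV emeasure_diag_measure assms)
  also have "\<dots> = diag_measure e J l x"
    using measure_of_of_measure[of "diag_measure e J l x"] by (simp add: diag_measure_def)
  finally show ?thesis .
qed

lemma pvm_diag_pvm:
  assumes o: "onb e J" shows "pvm (diag_pvm e J l)"
  unfolding pvm_def
proof (intro conjI ballI)
  fix S :: "real set"
  show "projection (diag_pvm e J l S)"
    unfolding projection_def
  proof (intro conjI)
    show "op_mult (diag_pvm e J l S) (diag_pvm e J l S) = diag_pvm e J l S"
      unfolding diag_pvm_def diag_op_square[OF o]
      by (rule diag_op_cong) (simp add: indicator_def)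
  qed (simp_all add: diag_pvm_bounded o, simp add: diag_pvm_def diag_op_selfadjoint o)
next
  have "x = y" if "(x, y) \<in> diag_pvm e J l UNIV" for x y
    using that diag_opD by (intro onb_eqI[OF o]) (fastforce simp: diag_pvm_def)+
  then show "diag_pvm e J l UNIV = op_id"
    unfolding op_id_def by (auto simp: diag_pvm_def diag_op_def)
next
  fix S T :: "real set"
  show "diag_pvm e J l (S \<inter> T) = op_mult (diag_pvm e J l S) (diag_pvm e J l T)"
  proof
    show "op_mult (diag_pvm e J l S) (diag_pvm e J l T) \<subseteq> diag_pvm e J l (S \<inter> T)"
      by (auto simp: op_mult_def diag_op_def diag_pvm_def indicator_def)
    show "diag_pvm e J l (S \<inter> T) \<subseteq> op_mult (diag_pvm e J l S) (diag_pvm e J l T)"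
    proof
      fix p assume p: "p \<in> diag_pvm e J l (S \<inter> T)"
      obtain x y where xy: "p = (x, y)" by (cases p)
      note p' = p[unfolded xy diag_pvm_def]
      have "x \<in> Domain (diag_pvm e J l T)"
        using diag_pvm_bounded[OF o, of l T] diag_opD(1)[OF p'] by (simp add: bounded_op_def)
      then obtain z where z: "(x, z) \<in> diag_pvm e J l T" by blast
      then have "(z, y) \<in> diag_pvm e J l S"
        using diag_opD[OF p'] diag_opD[OF z[unfolded diag_pvm_def]] unfolding diag_pvm_def
        by (intro diag_opI) (auto simp: indicator_def)
      with z show "p \<in> op_mult (diag_pvm e J l S) (diag_pvm e J l T)"
        unfolding op_mult_def xy by blast
    qed
  qed
next
  fix x assume x: "x \<in> hilb"
  have "measure_space UNIV (sets borel) (emeasure (diag_measure e J l x))"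
    using measure_space[of "diag_measure e J l x"] by (simp add: diag_measure_def)
  then show "measure_space UNIV (sets borel) (\<lambda>S. ennreal (Re (ip x (op_apply (diag_pvm e J l S) x))))"
    using measure_space_eq[of "sets borel" UNIV "emeasure (diag_measure e J l x)"
        "\<lambda>S. ennreal (Re (ip x (op_apply (diag_pvm e J l S) x)))"]
      emeasure_diag_measure[OF o x] by (simp add: sigma_sets_borel_UNIV)
qed

lemma nn_integral_diag_measure:
  assumes [measurable]: "f \<in> borel_measurable borel"
  shows "(\<integral>\<^sup>+r. ennreal ((f r)\<^sup>2) \<partial>diag_measure e J l x)
    = (\<integral>\<^sup>+j. ennreal ((f (l j))\<^sup>2 * (cmod (ip (e j) x))\<^sup>2) \<partial>count_space J)"
proof -
  have "(\<integral>\<^sup>+r. ennreal ((f r)\<^sup>2) \<partial>diag_measure e J l x)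
    = (\<integral>\<^sup>+j. ennreal ((cmod (ip (e j) x))\<^sup>2) * ennreal ((f (l j))\<^sup>2) \<partial>count_space J)"
    unfolding diag_measure_def by (simp add: nn_integral_distr nn_integral_density)
  then show ?thesis by (simp add: ennreal_mult mult.commute)
qed

lemma integral_diag_measure:
  assumes [measurable]: "f \<in> borel_measurable borel"
  shows "(\<integral>r. f r \<partial>diag_measure e J l x) = (\<integral>j. f (l j) * (cmod (ip (e j) x))\<^sup>2 \<partial>count_space J)"
  unfolding diag_measure_def by (simp add: integral_distr integral_density mult.commute)

text \<open>\<open>spectral_integral\<close> prescribes the domain and the quadratic form. Two
  linear operators sharing both are compared on the vectors e_j + c x, and polarisation makes the
  coefficients of the images agree.\<close>

lemma spectral_integral_iff:
  assumes o: "onb e J" and E: "\<And>S. S \<in> sets borel \<Longrightarrow> E S = diag_pvm e J l S"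
    and f: "f \<in> borel_measurable borel"
  shows "spectral_integral E f S \<longleftrightarrow> S = diag_op e J (\<lambda>j. f (l j))"
proof -
  let ?D = "diag_op e J (\<lambda>j. f (l j))"
  have m: "scalar_measure E x = diag_measure e J l x" if "x \<in> hilb" for x
    by (rule scalar_measure_eq_diag_measure[OF o that E])
  have "(\<integral>\<^sup>+r. ennreal ((f r)\<^sup>2) \<partial>scalar_measure E x) < \<infinity>
      \<longleftrightarrow> (\<lambda>j. (f (l j))\<^sup>2 * (cmod (ip (e j) x))\<^sup>2) summable_on J" if "x \<in> hilb" for x
    unfolding m[OF that] nn_integral_diag_measure[OF f] by (rule summable_on_iff_nn_integral[symmetric]) simp
  then have dom: "{x \<in> hilb. (\<integral>\<^sup>+r. ennreal ((f r)\<^sup>2) \<partial>scalar_measure E x) < \<infinity>} = Domain ?D"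
    by (auto simp: diag_op_Domain[OF o])
  have ip: "ip x y = complex_of_real (\<integral>r. f r \<partial>scalar_measure E x)" if "(x, y) \<in> ?D" for x y
  proof -
    have "(\<integral>r. f r \<partial>scalar_measure E x) = Re (ip x y)"
      unfolding m[OF diag_opD(1)[OF that]] integral_diag_measure[OF f]
      by (rule lebesgue_integral_count_space_has_sum[OF diag_op_quadratic[OF o that]])
    moreover have "cnj (ip x y) = ip x y" using diag_op_sym[OF o that that] by (simp add: cnj_ip)
    then have "Im (ip x y) = 0" by (simp add: complex_eq_iff)
    ultimately show ?thesis by (simp add: complex_eq_iff)
  qed
  show ?thesis
  proof
    assume "S = ?D"
    then show "spectral_integral E f S"
      unfolding spectral_integral_def dom using ip diag_op_linear[OF o] by auto
  next
    assume S: "spectral_integral E f S"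
    then have lin: "linear_op S" and domS: "Domain S = Domain ?D"
      and q: "\<And>x y. (x, y) \<in> S \<Longrightarrow> ip x y = complex_of_real (\<integral>r. f r \<partial>scalar_measure E x)"
      unfolding spectral_integral_def dom by auto
    note linD = diag_op_linear[OF o, of "\<lambda>j. f (l j)"]
    have eq: "y = y'" if xy: "(x, y) \<in> S" "(x, y') \<in> ?D" for x y y'
    proof (rule onb_eqI[OF o])
      show "y \<in> hilb" "y' \<in> hilb" using linear_op_hilb[OF lin xy(1)] linear_op_hilb[OF linD xy(2)] by auto
      fix j assume j: "j \<in> J"
      note ej = diag_op_basis[OF o j, of "\<lambda>j. f (l j)"]
      then obtain z where z: "(e j, z) \<in> S" using domS by blast
      let ?z' = "vscale (complex_of_real (f (l j))) (e j)"
      note h = linear_op_hilb[OF lin xy(1)] linear_op_hilb[OF linD xy(2)]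
        linear_op_hilb[OF lin z] linear_op_hilb[OF linD ej]
      \<comment> \<open>What remains of the two equal forms at e_j + c x; the choices 1 and \<i> for
        \<open>c\<close> separate the two terms.\<close>
      have c: "c * ip (e j) (y - y') + cnj c * ip x (z - ?z') = 0" for c
      proof -
        have "(e j + vscale c x, z + vscale c y) \<in> S"
          by (intro linear_op_add[OF lin] linear_op_scale[OF lin] z xy)
        moreover have "(e j + vscale c x, ?z' + vscale c y') \<in> ?D"
          by (intro linear_op_add[OF linD] linear_op_scale[OF linD] ej xy)
        ultimately have "ip (e j + vscale c x) (z + vscale c y) = ip (e j + vscale c x) (?z' + vscale c y')"
          using q ip by metis
        moreover have "ip (e j) z = ip (e j) ?z'" "ip x y = ip x y'" using q ip z ej xy by metis+
        ultimately show ?thesis using h by (simp add: ip_simps algebra_simps)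
      qed
      have "ip (e j) (y - y') = 0" using c[of 1] c[of \<i>] by (simp add: complex_eq_iff)
      then show "ip (e j) y = ip (e j) y'" using h by (simp add: ip_diff_right)
    qed
    show "S = ?D"
    proof
      show "S \<subseteq> ?D" using eq domS by fast
      show "?D \<subseteq> S" using eq domS by fast
    qed
  qed
qed

section \<open>Uniqueness of the spectral resolution\<close>

definition pvm_proj :: "(real set \<Rightarrow> oper) \<Rightarrow> real set \<Rightarrow> vec \<Rightarrow> vec" where
  "pvm_proj E S x = op_apply (E S) x"

context
  fixes E :: "real set \<Rightarrow> oper"
  assumes E: "pvm E"
begin

lemma pvm_bounded: "S \<in> sets borel \<Longrightarrow> bounded_op (E S)"
  and pvm_selfadjoint: "S \<in> sets borel \<Longrightarrow> selfadjoint (E S)"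
  using E unfolding pvm_def projection_def by blast+

lemma pvm_linear: "S \<in> sets borel \<Longrightarrow> linear_op (E S)"
  by (rule selfadjoint_linear[OF pvm_selfadjoint])

lemma pvm_proj_in:
  assumes "S \<in> sets borel" "x \<in> hilb" shows "(x, pvm_proj E S x) \<in> E S"
  unfolding pvm_proj_def
  by (rule op_apply_in) (use pvm_linear pvm_bounded assms in \<open>auto simp: bounded_op_def\<close>)

lemma pvm_projI: "S \<in> sets borel \<Longrightarrow> (x, y) \<in> E S \<Longrightarrow> pvm_proj E S x = y"
  unfolding pvm_proj_def by (rule op_apply_eq[OF pvm_linear])

lemma pvm_proj_hilb: "S \<in> sets borel \<Longrightarrow> x \<in> hilb \<Longrightarrow> pvm_proj E S x \<in> hilb"
  using linear_op_hilb[OF pvm_linear pvm_proj_in] by blast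

lemma pvm_proj_add:
  "S \<in> sets borel \<Longrightarrow> x \<in> hilb \<Longrightarrow> y \<in> hilb \<Longrightarrow> pvm_proj E S (x + y) = pvm_proj E S x + pvm_proj E S y"
  by (intro pvm_projI linear_op_add[OF pvm_linear] pvm_proj_in)

lemma pvm_proj_scale:
  "S \<in> sets borel \<Longrightarrow> x \<in> hilb \<Longrightarrow> pvm_proj E S (vscale c x) = vscale c (pvm_proj E S x)"
  by (intro pvm_projI linear_op_scale[OF pvm_linear] pvm_proj_in)

lemma pvm_proj_diff:
  "S \<in> sets borel \<Longrightarrow> x \<in> hilb \<Longrightarrow> y \<in> hilb \<Longrightarrow> pvm_proj E S (x - y) = pvm_proj E S x - pvm_proj E S y"
  by (intro pvm_projI linear_op_diff[OF pvm_linear] pvm_proj_in)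

lemma pvm_proj_sym:
  "S \<in> sets borel \<Longrightarrow> x \<in> hilb \<Longrightarrow> y \<in> hilb \<Longrightarrow> ip x (pvm_proj E S y) = ip (pvm_proj E S x) y"
  by (rule selfadjoint_sym[OF pvm_selfadjoint pvm_proj_in pvm_proj_in])

lemma pvm_proj_Int:
  assumes S: "S \<in> sets borel" and T: "T \<in> sets borel" and x: "x \<in> hilb"
  shows "pvm_proj E S (pvm_proj E T x) = pvm_proj E (S \<inter> T) x"
proof -
  have "(x, pvm_proj E S (pvm_proj E T x)) \<in> op_mult (E S) (E T)"
    unfolding op_mult_def
    by (rule relcompI[OF pvm_proj_in[OF T x] pvm_proj_in[OF S pvm_proj_hilb[OF T x]]])
  also have "op_mult (E S) (E T) = E (S \<inter> T)" using E S T unfolding pvm_def by simp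
  finally show ?thesis using pvm_projI[of "S \<inter> T"] S T by simp
qed

lemma pvm_proj_UNIV: "x \<in> hilb \<Longrightarrow> pvm_proj E UNIV x = x"
  using E by (intro pvm_projI) (auto simp: pvm_def op_id_def)

lemma ip_pvm_proj:
  assumes "S \<in> sets borel" "x \<in> hilb"
  shows "ip x (pvm_proj E S x) = complex_of_real ((vnorm (pvm_proj E S x))\<^sup>2)"
proof -
  have "ip x (pvm_proj E S x) = ip x (pvm_proj E S (pvm_proj E S x))"
    using assms by (simp add: pvm_proj_Int)
  also have "\<dots> = ip (pvm_proj E S x) (pvm_proj E S x)"
    using assms by (simp add: pvm_proj_sym pvm_proj_hilb)
  finally show ?thesis using ip_self pvm_proj_hilb assms by simp
qed

lemma sets_scalar_measure [simp]: "sets (scalar_measure E x) = sets borel"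
  and space_scalar_measure [simp]: "space (scalar_measure E x) = UNIV"
  by (simp_all add: scalar_measure_def sigma_sets_borel_UNIV)

lemma emeasure_scalar_measure:
  assumes "x \<in> hilb" "S \<in> sets borel"
  shows "emeasure (scalar_measure E x) S = ennreal ((vnorm (pvm_proj E S x))\<^sup>2)"
proof -
  have "measure_space UNIV (sets borel) (\<lambda>S. ennreal (Re (ip x (op_apply (E S) x))))"
    using E assms(1) unfolding pvm_def by blast
  then have "emeasure (scalar_measure E x) S = ennreal (Re (ip x (op_apply (E S) x)))"
    unfolding scalar_measure_def using assms(2)
    by (intro emeasure_measure_of_sigma) (auto simp: measure_space_def)
  also have "op_apply (E S) x = pvm_proj E S x" by (simp add: pvm_proj_def)
  finally show ?thesis using ip_pvm_proj assms by simp
qed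

lemma finite_scalar_measure:
  assumes "x \<in> hilb" shows "finite_measure (scalar_measure E x)"
  by (rule finite_measureI) (simp add: emeasure_scalar_measure[OF assms])

lemma scalar_measure_eqI:
  assumes "x \<in> hilb" "y \<in> hilb"
    "\<And>S. S \<in> sets borel \<Longrightarrow> vnorm (pvm_proj E S x) = vnorm (pvm_proj E S y)"
  shows "scalar_measure E x = scalar_measure E y"
  by (rule measure_eqI) (auto simp: emeasure_scalar_measure assms)

text \<open>For \<open>u\<close> in the range and \<open>v\<close> in the kernel of a spectral projection, the scalar measure
  of \<open>u + c v\<close> with \<open>\<bar>c\<bar> = 1\<close> does not depend on the phase \<open>c\<close>; by polarisation the
  form of a spectral integral has no cross terms.\<close>

lemma scalar_measure_phase:
  assumes B: "B \<in> sets borel" and u: "u \<in> hilb" "pvm_proj E B u = u"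
    and v: "v \<in> hilb" "pvm_proj E B v = 0" and c: "cmod c = 1"
  shows "scalar_measure E (u + vscale c v) = scalar_measure E (u + v)"
proof (rule scalar_measure_eqI)
  show "u + vscale c v \<in> hilb" "u + v \<in> hilb" using u v by auto
  fix S :: "real set" assume S: "S \<in> sets borel"
  let ?P = "pvm_proj E S"
  note h = pvm_proj_hilb[OF S u(1)] pvm_proj_hilb[OF S v(1)]
  have "ip (?P u) (?P v) = ip u (?P v)"
    using pvm_proj_sym[OF S u(1) h(2)] pvm_proj_Int[OF S S v(1)] by simp
  also have "\<dots> = ip u (pvm_proj E B (?P v))"
    using pvm_proj_sym[OF B u(1) h(2)] u(2) by simp
  also have "pvm_proj E B (?P v) = ?P (pvm_proj E B v)"
    by (simp add: pvm_proj_Int S B v(1) Int_commute)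
  also have "ip u (?P (pvm_proj E B v)) = 0"
    using pvm_proj_scale[OF S v(1), of 0] v(2) by simp
  finally have orth: "ip (?P u) (?P v) = 0" .
  have "(vnorm (?P (u + vscale d v)))\<^sup>2 = (vnorm (?P u))\<^sup>2 + (cmod d)\<^sup>2 * (vnorm (?P v))\<^sup>2" for d
    using h u v S by (simp add: pvm_proj_add pvm_proj_scale vnorm_power2_add ip_scale_right orth
        vnorm_scale power_mult_distrib)
  from this[of c] this[of 1] c have "(vnorm (?P (u + vscale c v)))\<^sup>2 = (vnorm (?P (u + v)))\<^sup>2"
    by simp
  then show "vnorm (?P (u + vscale c v)) = vnorm (?P (u + v))"
    by (rule power2_eq_imp_eq) simp_all
qed

lemma spectral_integral_orthogonal:
  assumes S: "spectral_integral E f S" and B: "B \<in> sets borel"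
    and u: "(u, u') \<in> S" "pvm_proj E B u = u" and v: "(v, v') \<in> S" "pvm_proj E B v = 0"
  shows "ip u v' = 0"
proof -
  have lin: "linear_op S" and q: "\<And>x y. (x, y) \<in> S \<Longrightarrow> ip x y = complex_of_real (\<integral>r. f r \<partial>scalar_measure E x)"
    using S unfolding spectral_integral_def by auto
  note h = linear_op_hilb[OF lin u(1)] linear_op_hilb[OF lin v(1)]
  have uh: "u \<in> hilb" and vh: "v \<in> hilb" using h by auto
  have "ip (u + vscale c v) (u' + vscale c v') = ip (u + v) (u' + v')" if "cmod c = 1" for c
  proof -
    have "(u + vscale c v, u' + vscale c v') \<in> S" "(u + v, u' + v') \<in> S"
      by (intro linear_op_add[OF lin] linear_op_scale[OF lin] u v)+
    then show ?thesis
      using scalar_measure_phase[OF B uh u(2) vh v(2) that] by (simp only: q)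
  qed
  then have c: "ip u u' + c * ip u v' + cnj c * ip v u' + cnj c * c * ip v v'
      = ip u u' + ip u v' + ip v u' + ip v v'" if "cmod c = 1" for c
    using that h by (simp add: ip_simps algebra_simps)
  \<comment> \<open>With \<open>c = - 1\<close> the two cross terms add up to 0; given this,
    \<open>c = \<i>\<close> shows that they are equal.\<close>
  show ?thesis using c[of "-1"] c[of \<i>] by (simp add: complex_eq_iff)
qed

lemma scalar_measure_proj:
  assumes B: "B \<in> sets borel" and x: "x \<in> hilb"
  shows "scalar_measure E (pvm_proj E B x) = density (scalar_measure E x) (indicator B)"
proof (rule measure_eqI)
  fix S assume "S \<in> sets (scalar_measure E (pvm_proj E B x))"
  then have S: "S \<in> sets borel" by simp
  have "emeasure (density (scalar_measure E x) (indicator B)) S = emeasure (scalar_measure E x) (B \<inter> S)"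
    using S B by (subst emeasure_density) (auto simp: indicator_inter_arith[symmetric] intro!: borel_measurable_indicator)
  then show "emeasure (scalar_measure E (pvm_proj E B x)) S
      = emeasure (density (scalar_measure E x) (indicator B)) S"
    using S B x by (simp add: emeasure_scalar_measure pvm_proj_hilb pvm_proj_Int Int_commute)
qed simp

text \<open>Projecting by \<open>E B\<close> restricts the scalar measure to \<open>B\<close>, which
  can only lower the second moment that defines the domain.\<close>

lemma spectral_integral_proj_domain:
  assumes S: "spectral_integral E f S" and f[measurable]: "f \<in> borel_measurable borel"
    and B: "B \<in> sets borel" and x: "x \<in> Domain S"
  shows "pvm_proj E B x \<in> Domain S"
proof -
  have dom: "Domain S = {x \<in> hilb. (\<integral>\<^sup>+r. ennreal ((f r)\<^sup>2) \<partial>scalar_measure E x) < \<infinity>}"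
    using S unfolding spectral_integral_def by blast
  have xh: "x \<in> hilb" using x dom by blast
  have "(\<integral>\<^sup>+r. ennreal ((f r)\<^sup>2) \<partial>scalar_measure E (pvm_proj E B x))
      = (\<integral>\<^sup>+r. indicator B r * ennreal ((f r)\<^sup>2) \<partial>scalar_measure E x)"
    unfolding scalar_measure_proj[OF B xh] using B
    by (subst nn_integral_density)
      (auto intro!: borel_measurable_indicator simp: measurable_cong_sets[OF sets_scalar_measure refl])
  also have "\<dots> \<le> (\<integral>\<^sup>+r. ennreal ((f r)\<^sup>2) \<partial>scalar_measure E x)"
    by (intro nn_integral_mono) (auto simp: indicator_def)
  also have "\<dots> < \<infinity>" using x dom by blast
  finally show ?thesis using dom pvm_proj_hilb[OF B xh] by blast
qed

text \<open>The sign of \<sigma> selects the side of \<open>k\<close> on which \<open>B\<close>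
  lies. For y = E(B) e the function \<sigma> (r - k) is positive on \<open>B\<close>, where the
  measure of \<open>y\<close> is concentrated, and yet has integral 0; so that measure
  vanishes.\<close>

lemma pvm_proj_eigenvector_null:
  assumes T: "spectral_integral E (\<lambda>r. r) T" and e: "(e, vscale (complex_of_real k) e) \<in> T"
    and B: "B \<in> sets borel" and sB: "\<And>r. r \<in> B \<Longrightarrow> 0 < \<sigma> * (r - k)"
  shows "pvm_proj E B e = 0"
proof -
  have lin: "linear_op T" and q: "\<And>x y. (x, y) \<in> T \<Longrightarrow> ip x y = complex_of_real (\<integral>r. r \<partial>scalar_measure E x)"
    and dom: "Domain T = {x \<in> hilb. (\<integral>\<^sup>+r. ennreal (r\<^sup>2) \<partial>scalar_measure E x) < \<infinity>}"
    using T unfolding spectral_integral_def by auto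
  have eh: "e \<in> hilb" using linear_op_hilb[OF lin e] by simp
  define y where "y = pvm_proj E B e"
  have yh: "y \<in> hilb" unfolding y_def by (rule pvm_proj_hilb[OF B eh])
  have Py: "pvm_proj E B y = y" unfolding y_def by (simp add: pvm_proj_Int B eh)
  have "y \<in> Domain T" unfolding y_def
    by (rule spectral_integral_proj_domain[OF T _ B]) (use e in auto)
  then obtain z where z: "(y, z) \<in> T" by blast
  have v: "(e - y, vscale (complex_of_real k) e - z) \<in> T"
    by (rule linear_op_diff[OF lin e z])
  have Pv: "pvm_proj E B (e - y) = 0"
    using B eh yh Py by (simp add: pvm_proj_diff) (simp add: y_def)
  note hz = linear_op_hilb[OF lin z]
  \<comment> \<open>There is no cross term of \<open>T\<close> between the range and the kernel of
    \<open>E B\<close>, and \<open>e - y\<close> lies in the kernel. Therefore <y, T y> = <y, T e> =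
    k ||y||^2.\<close>
  have "ip y (vscale (complex_of_real k) e - z) = 0"
    by (rule spectral_integral_orthogonal[OF T B z Py v Pv])
  then have "ip y z = complex_of_real k * ip y e"
    using hz eh by (simp add: ip_diff_right ip_scale_right)
  moreover have "ip y e = complex_of_real ((vnorm y)\<^sup>2)"
    using ip_pvm_proj[OF B eh] pvm_proj_sym[OF B eh eh] by (simp add: y_def)
  ultimately have "complex_of_real (\<integral>r. r \<partial>scalar_measure E y) = complex_of_real (k * (vnorm y)\<^sup>2)"
    using q[OF z] by simp
  then have int: "(\<integral>r. r \<partial>scalar_measure E y) = k * (vnorm y)\<^sup>2" by (simp only: of_real_eq_iff)
  interpret M: finite_measure "scalar_measure E y" by (rule finite_scalar_measure[OF yh])
  note [measurable_cong] = sets_scalar_measure[of y]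
  have mUNIV: "measure (scalar_measure E y) UNIV = (vnorm y)\<^sup>2"
    using emeasure_scalar_measure[OF yh, of UNIV] pvm_proj_UNIV[OF yh] by (simp add: measure_def)
  \<comment> \<open>The Bochner integral is 0 by default for a non-integrable function, so
    integrability has to come from the finite second moment, by |r| <= 1 + r^2.\<close>
  have integrable: "integrable (scalar_measure E y) (\<lambda>r. r)"
  proof (rule Bochner_Integration.integrable_bound)
    have "(\<integral>\<^sup>+r. ennreal (norm (r\<^sup>2)) \<partial>scalar_measure E y) < \<infinity>"
      using \<open>y \<in> Domain T\<close> dom by simp
    then have "integrable (scalar_measure E y) (\<lambda>r. r\<^sup>2)"
      by (intro integrableI_bounded) auto
    then show "integrable (scalar_measure E y) (\<lambda>r. 1 + r\<^sup>2)" by simp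
    show "AE r in scalar_measure E y. norm r \<le> norm (1 + r\<^sup>2)"
    proof (rule AE_I2)
      fix r :: real
      have "0 \<le> (\<bar>r\<bar> - 1/2)\<^sup>2" by simp
      then show "norm r \<le> norm (1 + r\<^sup>2)" by (simp add: power2_eq_square algebra_simps)
    qed
  qed simp
  have "(\<integral>r. \<sigma> * (r - k) \<partial>scalar_measure E y) = \<sigma> * ((\<integral>r. r \<partial>scalar_measure E y) - k * (vnorm y)\<^sup>2)"
    using integrable mUNIV by (simp add: algebra_simps)
  then have zero: "(\<integral>r. \<sigma> * (r - k) \<partial>scalar_measure E y) = 0" using int by simp
  have "emeasure (scalar_measure E y) (- B) = 0"
  proof -
    have "pvm_proj E (- B) y = pvm_proj E (- B \<inter> B) e"
      unfolding y_def using B eh by (intro pvm_proj_Int) auto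
    also have "\<dots> = pvm_proj E {} e" by (simp add: Int_commute)
    also have "\<dots> = 0"
    proof -
      have "emeasure (scalar_measure E e) {} = 0" by simp
      then have "vnorm (pvm_proj E {} e) = 0"
        using emeasure_scalar_measure[OF eh, of "{}"] by (simp add: ennreal_eq_0_iff)
      then show ?thesis using vnorm_eq_zero pvm_proj_hilb eh by blast
    qed
    finally show ?thesis using emeasure_scalar_measure[OF yh, of "- B"] B by simp
  qed
  then have AEB: "AE r in scalar_measure E y. r \<in> B"
    using B by (intro AE_I[where N = "- B"]) auto
  then have "AE r in scalar_measure E y. 0 \<le> \<sigma> * (r - k)"
    by eventually_elim (use sB in \<open>auto intro: less_imp_le\<close>)
  then have "AE r in scalar_measure E y. \<sigma> * (r - k) = 0"
    using integral_nonneg_eq_0_iff_AE[of "scalar_measure E y" "\<lambda>r. \<sigma> * (r - k)"] integrable zero by simp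
  with AEB have "AE r in scalar_measure E y. False"
    by eventually_elim (use sB in force)
  then have "emeasure (scalar_measure E y) UNIV = 0"
    using emeasure_eq_0_AE[of "\<lambda>_. True" "scalar_measure E y"] by simp
  then have "vnorm y = 0"
    using emeasure_scalar_measure[OF yh, of UNIV] pvm_proj_UNIV[OF yh] by (simp add: ennreal_eq_0_iff)
  then show ?thesis using vnorm_eq_zero[OF yh] by (simp add: y_def)
qed

text \<open>The two open half-lines beside \<open>k\<close> are null for the measure of
  \<open>e\<close>, which is thus an atom at \<open>k\<close>. If \<open>k\<close> lies in
  \<open>R\<close>, the projection preserves the norm of \<open>e\<close> and hence fixes
  \<open>e\<close>, by Pythagoras.\<close>

lemma pvm_proj_eigenvector:
  assumes T: "spectral_integral E (\<lambda>r. r) T" and e: "(e, vscale (complex_of_real k) e) \<in> T"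
    and R: "R \<in> sets borel"
  shows "pvm_proj E R e = vscale (complex_of_real (indicator R k)) e"
proof -
  have eh: "e \<in> hilb" using T e unfolding spectral_integral_def by (auto dest: linear_op_hilb)
  have "pvm_proj E {k<..} e = 0"
    by (rule pvm_proj_eigenvector_null[OF T e, where \<sigma> = 1]) auto
  then have 1: "emeasure (scalar_measure E e) {k<..} = 0"
    using emeasure_scalar_measure[OF eh, of "{k<..}"] by simp
  have "pvm_proj E {..<k} e = 0"
    by (rule pvm_proj_eigenvector_null[OF T e, where \<sigma> = "-1"]) auto
  then have 2: "emeasure (scalar_measure E e) {..<k} = 0"
    using emeasure_scalar_measure[OF eh, of "{..<k}"] by simp
  have "emeasure (scalar_measure E e) ({k<..} \<union> {..<k})
      \<le> emeasure (scalar_measure E e) {k<..} + emeasure (scalar_measure E e) {..<k}"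
    by (rule emeasure_subadditive) auto
  then have "emeasure (scalar_measure E e) ({k<..} \<union> {..<k}) = 0" using 1 2 by simp
  note z = this
  have null: "emeasure (scalar_measure E e) Q = 0" if "Q \<in> sets borel" "k \<notin> Q" for Q
  proof (rule emeasure_eq_0[OF _ z])
    show "Q \<subseteq> {k<..} \<union> {..<k}" using that(2) by (auto simp: not_less_iff_gr_or_eq)
  qed auto
  have proj0: "pvm_proj E Q e = 0" if "Q \<in> sets borel" "k \<notin> Q" for Q
  proof -
    have "vnorm (pvm_proj E Q e) = 0"
      using null[OF that] emeasure_scalar_measure[OF eh that(1)] by (simp add: ennreal_eq_0_iff)
    then show ?thesis using vnorm_eq_zero pvm_proj_hilb[OF that(1) eh] by blast
  qed
  show ?thesis
  proof (cases "k \<in> R")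
    case False
    then show ?thesis using proj0[OF R] by simp
  next
    case True
    have "emeasure (scalar_measure E e) R + emeasure (scalar_measure E e) (- R)
        = emeasure (scalar_measure E e) (R \<union> - R)"
      using R by (intro plus_emeasure) auto
    then have "emeasure (scalar_measure E e) R = emeasure (scalar_measure E e) UNIV"
      using null[of "- R"] R True by simp
    then have "(vnorm (pvm_proj E R e))\<^sup>2 = (vnorm e)\<^sup>2"
      using emeasure_scalar_measure[OF eh] R pvm_proj_UNIV[OF eh] by simp
    moreover have orth: "ip (pvm_proj E R e) (e - pvm_proj E R e) = 0"
    proof -
      have "ip (pvm_proj E R e) e = ip (pvm_proj E R e) (pvm_proj E R e)"
        using ip_pvm_proj[OF R eh] pvm_proj_sym[OF R eh eh] ip_self[OF pvm_proj_hilb[OF R eh]] by simp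
      then show ?thesis using pvm_proj_hilb[OF R eh] eh by (simp add: ip_diff_right)
    qed
    moreover have "(vnorm (pvm_proj E R e + (e - pvm_proj E R e)))\<^sup>2
        = (vnorm (pvm_proj E R e))\<^sup>2 + (vnorm (e - pvm_proj E R e))\<^sup>2"
      using vnorm_power2_add[of "pvm_proj E R e" "e - pvm_proj E R e"] pvm_proj_hilb[OF R eh] eh orth
      by simp
    ultimately have "vnorm (e - pvm_proj E R e) = 0" by simp
    then have "e - pvm_proj E R e = 0" using vnorm_eq_zero pvm_proj_hilb[OF R eh] eh by blast
    then show ?thesis using True by simp
  qed
qed

lemma pvm_eq_diag_pvm:
  assumes o: "onb e J" and T: "spectral_integral E (\<lambda>r. r) (diag_op e J l)" and S: "S \<in> sets borel"
  shows "E S = diag_pvm e J l S"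
  unfolding diag_pvm_def
proof (rule selfadjoint_eq_diag_op[OF o pvm_selfadjoint[OF S]])
  fix j assume j: "j \<in> J"
  show "(e j, vscale (complex_of_real (indicator S (l j))) (e j)) \<in> E S"
    using pvm_proj_in[OF S onb_hilb[OF o j]] pvm_proj_eigenvector[OF T diag_op_basis[OF o j] S] by simp
qed

end

text \<open>The description in \<open>fun_calc\<close> ranges over every resolution of the operator.
  All of them agree with the atomic one on Borel sets, so a single candidate for the spectral
  integral remains.\<close>

theorem fun_calc_diag_op:
  assumes o: "onb e J" and f: "f \<in> borel_measurable borel"
  shows "fun_calc f (diag_op e J l) = diag_op e J (\<lambda>j. f (l j))"
  unfolding fun_calc_def
proof (rule the_equality)
  show "\<exists>E. pvm E \<and> spectral_integral E (\<lambda>r. r) (diag_op e J l) \<and> spectral_integral E f (diag_op e J (\<lambda>j. f (l j)))"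
    using pvm_diag_pvm[OF o] spectral_integral_iff[OF o, of "diag_pvm e J l" l] f
    by (intro exI[of _ "diag_pvm e J l"]) auto
next
  fix S assume "\<exists>E. pvm E \<and> spectral_integral E (\<lambda>r. r) (diag_op e J l) \<and> spectral_integral E f S"
  then obtain E where E: "pvm E" "spectral_integral E (\<lambda>r. r) (diag_op e J l)" "spectral_integral E f S"
    by blast
  show "S = diag_op e J (\<lambda>j. f (l j))"
    using spectral_integral_iff[OF o pvm_eq_diag_pvm[OF E(1) o E(2)] f] E(3) by blast
qed

section \<open>Traces and Peierls' inequality\<close>

lemma nn_integral_count_space_eq_UNIV:
  "(\<integral>\<^sup>+i. h i \<partial>count_space A) = (\<integral>\<^sup>+i. h i * indicator A i \<partial>count_space UNIV)"
  by (cases "A = UNIV") (simp_all add: nn_integral_count_space_indicator)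

text \<open>The index sets are arbitrary, so Tonelli's theorem for sigma-finite measures does not
  apply. Indicators move both sums to the counting measures of the whole types.\<close>

lemma nn_integral_count_space_swap:
  fixes f :: "'a \<Rightarrow> 'b \<Rightarrow> ennreal"
  shows "(\<integral>\<^sup>+i. \<integral>\<^sup>+j. f i j \<partial>count_space J \<partial>count_space I)
    = (\<integral>\<^sup>+j. \<integral>\<^sup>+i. f i j \<partial>count_space I \<partial>count_space J)"
proof -
  let ?F = "\<lambda>(i, j). f i j * indicator J j * indicator I i"
  note conv = nn_integral_count_space_eq_UNIV
  have "(\<integral>\<^sup>+i. \<integral>\<^sup>+j. f i j \<partial>count_space J \<partial>count_space I)
      = (\<integral>\<^sup>+i. \<integral>\<^sup>+j. ?F (i, j) \<partial>count_space UNIV \<partial>count_space UNIV)"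
    unfolding conv[where A = I] conv[where A = J] by (simp add: nn_integral_multc)
  also have "\<dots> = (\<integral>\<^sup>+j. \<integral>\<^sup>+i. ?F (i, j) \<partial>count_space UNIV \<partial>count_space UNIV)"
    unfolding nn_integral_fst_count_space nn_integral_snd_count_space ..
  also have "\<dots> = (\<integral>\<^sup>+j. \<integral>\<^sup>+i. f i j \<partial>count_space I \<partial>count_space J)"
    unfolding conv[where A = I] conv[where A = J]
    by (simp add: nn_integral_multc[symmetric] mult.assoc mult.commute[of "indicator J _"])
  finally show ?thesis .
qed

text \<open>The default values match: a divergent sum of nonnegative terms is 0 as
  \<open>infsum\<close>, and \<open>enn2real\<close> sends infinity to 0.\<close>

lemma infsum_eq_enn2real_nn_integral:
  fixes g :: "'a \<Rightarrow> real" and h :: "'b \<Rightarrow> real"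
  assumes "\<And>j. j \<in> J \<Longrightarrow> 0 \<le> g j"
  shows "(\<integral>\<^sup>+j. ennreal (g j) \<partial>count_space J) = X \<Longrightarrow> infsum g J = enn2real X"
proof -
  assume X: "(\<integral>\<^sup>+j. ennreal (g j) \<partial>count_space J) = X"
  show ?thesis
  proof (cases "g summable_on J")
    case True
    then have "X = ennreal (infsum g J)"
      using nn_integral_count_space_has_sum[OF assms has_sum_infsum[OF True]] X by simp
    then show ?thesis using assms by (simp add: infsum_nonneg)
  next
    case False
    then have "\<not> X < \<infinity>" using summable_on_iff_nn_integral[of J g, OF assms] X by simp
    then have "X = \<infinity>" using less_top[of X] by auto
    then show ?thesis using False by (simp add: infsum_not_exists)
  qed
qed

lemma onb_nn_integral_one:
  assumes "onb e J" "x \<in> hilb" "vnorm x = 1"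
  shows "(\<integral>\<^sup>+j. ennreal ((cmod (ip (e j) x))\<^sup>2) \<partial>count_space J) = 1"
  using nn_integral_count_space_has_sum[OF _ onb_parseval[OF assms(1,2)]] assms(3) by simp

lemma cmod_ip_commute: "cmod (ip x y) = cmod (ip y x)"
  by (metis cnj_ip complex_mod_cnj)

text \<open>The weights \<open>\<bar>\<langle>e\<^sub>j, e'\<^sub>i\<rangle>\<bar>\<^sup>2\<close> of two orthonormal bases are doubly stochastic.\<close>

lemma nn_integral_double_stochastic:
  assumes o: "onb e J" and o': "onb e' I"
  shows "(\<integral>\<^sup>+i. \<integral>\<^sup>+j. g j * ennreal ((cmod (ip (e j) (e' i)))\<^sup>2) \<partial>count_space J \<partial>count_space I)
    = (\<integral>\<^sup>+j. g j \<partial>count_space J)"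
proof -
  have "(\<integral>\<^sup>+i. g j * ennreal ((cmod (ip (e j) (e' i)))\<^sup>2) \<partial>count_space I) = g j" if "j \<in> J" for j
  proof -
    have "(\<integral>\<^sup>+i. g j * ennreal ((cmod (ip (e j) (e' i)))\<^sup>2) \<partial>count_space I)
        = g j * (\<integral>\<^sup>+i. ennreal ((cmod (ip (e' i) (e j)))\<^sup>2) \<partial>count_space I)"
      by (subst nn_integral_cmult[symmetric]) (simp_all add: cmod_ip_commute)
    then show ?thesis
      using onb_nn_integral_one[OF o' onb_hilb[OF o that]] orthonormal_vnorm[OF onb_orthonormal[OF o] that]
      by simp
  qed
  then show ?thesis
    by (subst nn_integral_count_space_swap) (simp cong: nn_integral_cong_simp)
qed

text \<open>\<open>op_trace\<close> sums over the ket basis, in which the operator need not be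
  diagonal. Its diagonal entries there are averages of \<open>g\<close> with doubly stochastic
  weights, so their sum is the sum of \<open>g\<close>. The upper bound \<open>C\<close> makes the
  operator bounded and everywhere defined.\<close>

lemma trace_diag_op:
  assumes o: "onb e J" and g: "\<And>j. j \<in> J \<Longrightarrow> 0 \<le> g j" "\<And>j. j \<in> J \<Longrightarrow> g j \<le> C"
  shows "trace_class (diag_op e J g) \<longleftrightarrow> (\<integral>\<^sup>+j. ennreal (g j) \<partial>count_space J) < \<infinity>"
    and "op_trace (diag_op e J g) = complex_of_real (enn2real (\<integral>\<^sup>+j. ennreal (g j) \<partial>count_space J))"
proof -
  let ?T = "diag_op e J g"
  define d where "d i = Re (ip (ket i) (op_apply ?T (ket i)))" for i
  have b: "bounded_op ?T" by (rule diag_op_bounded[OF o, where C = C]) (use g in auto)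
  have in_T: "(ket i, op_apply ?T (ket i)) \<in> ?T" for i
    using b by (intro op_apply_in) (auto simp: bounded_op_def)
  have hs: "((\<lambda>j. g j * (cmod (ip (e j) (ket i)))\<^sup>2) has_sum d i) J" for i
    unfolding d_def by (rule diag_op_quadratic[OF o in_T])
  have d0: "0 \<le> d i" for i by (rule has_sum_nonneg[OF hs]) (use g in auto)
  have dc: "ip (ket i) (op_apply ?T (ket i)) = complex_of_real (d i)" for i
  proof -
    have "cnj (ip (ket i) (op_apply ?T (ket i))) = ip (ket i) (op_apply ?T (ket i))"
      using diag_op_sym[OF o in_T in_T] by (simp add: cnj_ip)
    then show ?thesis by (simp add: complex_eq_iff d_def)
  qed
  have "(\<integral>\<^sup>+i. ennreal (d i) \<partial>count_space labels)
      = (\<integral>\<^sup>+i. \<integral>\<^sup>+j. ennreal (g j) * ennreal ((cmod (ip (e j) (ket i)))\<^sup>2) \<partial>count_space J \<partial>count_space labels)"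
  proof (rule nn_integral_cong)
    fix i
    show "ennreal (d i) = (\<integral>\<^sup>+j. ennreal (g j) * ennreal ((cmod (ip (e j) (ket i)))\<^sup>2) \<partial>count_space J)"
      using nn_integral_count_space_has_sum[OF _ hs[of i]] g
      by (simp add: ennreal_mult cong: nn_integral_cong_simp)
  qed
  then have eq: "(\<integral>\<^sup>+i. ennreal (d i) \<partial>count_space labels) = (\<integral>\<^sup>+j. ennreal (g j) \<partial>count_space J)"
    by (simp only: nn_integral_double_stochastic[OF o onb_ket])
  have abs: "op_abs ?T = ?T"
    unfolding op_abs_diag_op[OF o] by (rule diag_op_cong) (use g in simp)
  have "(\<lambda>i. complex_of_real (d i)) summable_on labels \<longleftrightarrow> d summable_on labels"
    using summable_on_Re[of "\<lambda>i. complex_of_real (d i)" labels] summable_on_of_real[of d labels] by auto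
  then show "trace_class ?T \<longleftrightarrow> (\<integral>\<^sup>+j. ennreal (g j) \<partial>count_space J) < \<infinity>"
    unfolding trace_class_def abs dc using b d0 summable_on_iff_nn_integral[of labels d] eq by simp
  have "op_trace ?T = (\<Sum>\<^sub>\<infinity>i\<in>labels. complex_of_real (d i))"
    unfolding op_trace_def dc ..
  also have "\<dots> = complex_of_real (infsum d labels)"
  proof (cases "d summable_on labels")
    case True
    then show ?thesis by (intro infsumI has_sum_of_real has_sum_infsum)
  next
    case False
    then have "\<not> (\<lambda>i. complex_of_real (d i)) summable_on labels"
      using summable_on_Re[of "\<lambda>i. complex_of_real (d i)" labels] by auto
    with False show ?thesis by (simp add: infsum_not_exists)
  qed
  also have "infsum d labels = enn2real (\<integral>\<^sup>+j. ennreal (g j) \<partial>count_space J)"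
    by (rule infsum_eq_enn2real_nn_integral[OF d0 eq])
  finally show "op_trace ?T = complex_of_real (enn2real (\<integral>\<^sup>+j. ennreal (g j) \<partial>count_space J))" .
qed

text \<open>The left side is the tangent at c^2 of the convex function exp (- s sqrt v), evaluated
  at v = x^2. Being affine in x^2, it can be averaged knowing only the second moment.\<close>

lemma exp_ge_tangent_square:
  fixes s c x :: real
  assumes "0 \<le> s" "0 < c"
  shows "exp (- s * c) * (1 - s * (x\<^sup>2 - c\<^sup>2) / (2 * c)) \<le> exp (- s * \<bar>x\<bar>)"
proof -
  have "0 \<le> (\<bar>x\<bar> - c)\<^sup>2" by simp
  then have "(\<bar>x\<bar> - c) * (2 * c) \<le> x\<^sup>2 - c\<^sup>2" by (simp add: power2_diff power2_eq_square algebra_simps)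
  then have "\<bar>x\<bar> - c \<le> (x\<^sup>2 - c\<^sup>2) / (2 * c)" using assms by (simp add: pos_le_divide_eq)
  then have "s * (\<bar>x\<bar> - c) \<le> s * ((x\<^sup>2 - c\<^sup>2) / (2 * c))" using assms by (intro mult_left_mono)
  then have "1 - s * (x\<^sup>2 - c\<^sup>2) / (2 * c) \<le> 1 + (- s * (\<bar>x\<bar> - c))" by (simp add: algebra_simps)
  also have "\<dots> \<le> exp (- s * (\<bar>x\<bar> - c))" by (rule exp_ge_add_one_self)
  finally have "exp (- s * c) * (1 - s * (x\<^sup>2 - c\<^sup>2) / (2 * c)) \<le> exp (- s * c) * exp (- s * (\<bar>x\<bar> - c))"
    by (rule mult_left_mono) simp
  also have "\<dots> = exp (- s * \<bar>x\<bar>)" by (simp add: exp_add[symmetric] algebra_simps)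
  finally show ?thesis .
qed

text \<open>Jensen's inequality for \<open>x \<mapsto> exp (- s \<surd>x)\<close>, which is convex and decreasing (Peierls' inequality
  for the trace): the quadratic form of the square of the operator on a unit vector is at most \<open>c\<^sup>2\<close>.\<close>

lemma exp_le_expectation:
  assumes o: "onb e J" and xy: "(x, y) \<in> diag_op e J l" and x: "vnorm x = 1"
    and y: "vnorm y \<le> c" and c: "0 < c" and s: "0 \<le> s"
  shows "ennreal (exp (- s * c))
    \<le> (\<integral>\<^sup>+j. ennreal (exp (- s * \<bar>l j\<bar>)) * ennreal ((cmod (ip (e j) x))\<^sup>2) \<partial>count_space J)"
proof -
  note xh = diag_opD(1)[OF xy]
  let ?p = "\<lambda>j. (cmod (ip (e j) x))\<^sup>2"
  have p: "(?p has_sum 1) J" using onb_parseval[OF o xh] x by simp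
  have V: "((\<lambda>j. (l j)\<^sup>2 * ?p j) has_sum (vnorm y)\<^sup>2) J" by (rule diag_op_has_sum[OF o xy])
  have "(\<lambda>j. exp (- s * \<bar>l j\<bar>) * ?p j) summable_on J"
    by (rule summable_on_comparison_test[OF has_sum_imp_summable[OF p]])
      (use s in \<open>auto intro!: mult_left_le_one_le\<close>)
  then obtain S where S: "((\<lambda>j. exp (- s * \<bar>l j\<bar>) * ?p j) has_sum S) J"
    using summable_iff_has_sum_infsum by blast
  have "((\<lambda>j. exp (- s * c) * ((1 + s * c / 2) * ?p j + (- s / (2 * c)) * ((l j)\<^sup>2 * ?p j)))
      has_sum exp (- s * c) * ((1 + s * c / 2) * 1 + (- s / (2 * c)) * (vnorm y)\<^sup>2)) J"
    by (intro has_sum_cmult_right has_sum_add p V)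
  then have "exp (- s * c) * ((1 + s * c / 2) * 1 + (- s / (2 * c)) * (vnorm y)\<^sup>2) \<le> S"
  proof (rule has_sum_mono[OF _ S])
    fix j
    have "exp (- s * c) * (1 - s * ((l j)\<^sup>2 - c\<^sup>2) / (2 * c)) * ?p j \<le> exp (- s * \<bar>l j\<bar>) * ?p j"
      by (intro mult_right_mono exp_ge_tangent_square s c) simp
    moreover have "1 - s * ((l j)\<^sup>2 - c\<^sup>2) / (2 * c) = (1 + s * c / 2) + (- s / (2 * c)) * (l j)\<^sup>2"
      using c by (simp add: field_simps power2_eq_square)
    moreover have "E * (a * p + b * (L * p)) = E * (a + b * L) * p" for E a b L p :: real
      by (simp add: algebra_simps)
    ultimately show "exp (- s * c) * ((1 + s * c / 2) * ?p j + (- s / (2 * c)) * ((l j)\<^sup>2 * ?p j))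
        \<le> exp (- s * \<bar>l j\<bar>) * ?p j" by (simp only:)
  qed
  \<comment> \<open>The slope of the tangent is not positive, so ||y|| <= c makes its average at
    least the value at the point of contact.\<close>
  moreover have "exp (- s * c) * 1 \<le> exp (- s * c) * ((1 + s * c / 2) * 1 + (- s / (2 * c)) * (vnorm y)\<^sup>2)"
  proof (rule mult_left_mono)
    have "(vnorm y)\<^sup>2 \<le> c\<^sup>2" using y by (simp add: power_mono)
    then have "s / (2 * c) * (vnorm y)\<^sup>2 \<le> s / (2 * c) * c\<^sup>2" using s c by (intro mult_left_mono) auto
    also have "\<dots> = s * c / 2" using c by (simp add: power2_eq_square)
    finally show "1 \<le> (1 + s * c / 2) * 1 + (- s / (2 * c)) * (vnorm y)\<^sup>2" by simp
  qed simp
  ultimately have "exp (- s * c) * 1 \<le> S" by (rule order_trans[rotated])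
  moreover have "(\<integral>\<^sup>+j. ennreal (exp (- s * \<bar>l j\<bar>)) * ennreal (?p j) \<partial>count_space J) = ennreal S"
    using nn_integral_count_space_has_sum[OF _ S] by (simp add: ennreal_mult)
  ultimately show ?thesis by (simp only: mult_1_right ennreal_leI)
qed

text \<open>Jensen's bound is summed over the basis \<open>e'\<close>, whose vectors lie in the
  domain without being eigenvectors; the doubly stochastic weights reassemble the heat sum of the
  operator.\<close>

lemma heat_sum_le:
  assumes o: "onb e J" and o': "onb e' I" and s: "0 \<le> s"
    and c: "\<And>i. i \<in> I \<Longrightarrow> 0 < c i"
    and "\<And>i. i \<in> I \<Longrightarrow> \<exists>y. (e' i, y) \<in> diag_op e J l \<and> vnorm y \<le> c i"
  shows "(\<integral>\<^sup>+i. ennreal (exp (- s * c i)) \<partial>count_space I)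
    \<le> (\<integral>\<^sup>+j. ennreal (exp (- s * \<bar>l j\<bar>)) \<partial>count_space J)"
proof -
  have "(\<integral>\<^sup>+i. ennreal (exp (- s * c i)) \<partial>count_space I)
    \<le> (\<integral>\<^sup>+i. \<integral>\<^sup>+j. ennreal (exp (- s * \<bar>l j\<bar>)) * ennreal ((cmod (ip (e j) (e' i)))\<^sup>2) \<partial>count_space J \<partial>count_space I)"
    using exp_le_expectation[OF o _ orthonormal_vnorm[OF onb_orthonormal[OF o']] _ c s] assms(5)
    by (intro nn_integral_mono) (simp, blast)
  also have "\<dots> = (\<integral>\<^sup>+j. ennreal (exp (- s * \<bar>l j\<bar>)) \<partial>count_space J)"
    by (rule nn_integral_double_stochastic[OF o o'])
  finally show ?thesis .
qed

section \<open>Heat sums and Laplace transforms\<close>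

definition heat_sum :: "'j set \<Rightarrow> ('j \<Rightarrow> real) \<Rightarrow> real \<Rightarrow> ennreal" where
  "heat_sum J l s = (\<integral>\<^sup>+j. ennreal (exp (- s * l j)) \<partial>count_space J)"

lemma heat_sum_shift: "heat_sum J (\<lambda>j. l j + a) s = ennreal (exp (- s * a)) * heat_sum J l s"
  unfolding heat_sum_def
  by (subst nn_integral_cmult[symmetric])
    (simp_all add: ennreal_mult[symmetric] exp_add[symmetric] algebra_simps)

text \<open>Positive terms with a finite sum leave only countably many indices. Countability makes
  the heat kernel jointly measurable when it is integrated against \<phi>.\<close>

lemma heat_sum_countable:
  assumes "heat_sum J l s < \<infinity>" shows "countable J"
proof -
  have "(\<lambda>j. exp (- s * l j)) summable_on J"
    using assms summable_on_iff_nn_integral[of J "\<lambda>j. exp (- s * l j)"] by (simp add: heat_sum_def)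
  from summable_countable_real[OF this] show ?thesis by simp
qed

text \<open>Here \<open>exp (s a) - 1 \<le> s a exp (s a)\<close> beats the \<open>s\<^sup>-\<^sup>1\<^sup>/\<^sup>2\<close> growth of the heat sum.\<close>

lemma heat_sum_close:
  assumes a: "0 < a" and C: "0 \<le> C" and s: "0 < s"
    and 1: "heat_sum I (\<lambda>i. d i + a) s \<le> heat_sum J l s"
    and 2: "heat_sum J (\<lambda>j. l j + a) s \<le> heat_sum I d s"
    and small: "heat_sum I d s \<le> ennreal (C / sqrt s)"
  shows "heat_sum J l s \<le> heat_sum I d s + ennreal (a * C * sqrt s * exp (s * a))"
    and "heat_sum I d s \<le> heat_sum J l s + ennreal (a * C * sqrt s * exp (s * a))"
    and "heat_sum J l s < \<infinity>" "heat_sum I d s < \<infinity>"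
proof -
  let ?N = "heat_sum I d s" and ?N' = "heat_sum J l s"
  let ?G = "a * C * sqrt s * exp (s * a)"
  have e1: "exp (s * a) - 1 \<le> s * a * exp (s * a)"
  proof -
    have "(1 + (- (s * a))) * exp (s * a) \<le> exp (- (s * a)) * exp (s * a)"
      by (intro mult_right_mono exp_ge_add_one_self) simp
    also have "\<dots> = 1" by (simp add: exp_minus)
    finally show ?thesis by (simp add: algebra_simps)
  qed
  have e2: "1 - exp (- s * a) \<le> s * a * exp (s * a)"
  proof -
    have "1 - exp (- s * a) \<le> s * a * 1" using exp_ge_add_one_self[of "- s * a"] by simp
    also have "\<dots> \<le> s * a * exp (s * a)" using a s by (intro mult_left_mono) auto
    finally show ?thesis .
  qed
  have G: "ennreal x * ?N \<le> ennreal ?G" if x: "0 \<le> x" "x \<le> s * a * exp (s * a)" for x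
  proof -
    have "ennreal x * ?N \<le> ennreal (s * a * exp (s * a)) * ennreal (C / sqrt s)"
      using x by (intro mult_mono ennreal_leI small) auto
    also have "\<dots> = ennreal (s * a * exp (s * a) * (C / sqrt s))"
      using a s C by (intro ennreal_mult[symmetric]) auto
    also have "s * a * exp (s * a) * (C / sqrt s) = ?G"
      using s real_sqrt_mult_self[of s] by (simp add: field_simps)
    finally show ?thesis .
  qed
  \<comment> \<open>The shifted heat sum in \<open>2\<close> is exp (- s a) times
    \<open>?N'\<close>. Multiplying by exp (s a) avoids division of extended reals, and exp (s a) -
    1 is then split off additively.\<close>
  have "?N' = ennreal (exp (s * a)) * (ennreal (exp (- s * a)) * ?N')"
    by (simp add: mult.assoc[symmetric] ennreal_mult[symmetric] exp_add[symmetric])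
  also have "\<dots> \<le> ennreal (exp (s * a)) * ?N"
    using 2 unfolding heat_sum_shift by (rule mult_left_mono) simp
  finally have up: "?N' \<le> ennreal (exp (s * a)) * ?N" .
  also have "\<dots> = ennreal (1 + (exp (s * a) - 1)) * ?N" by simp
  also have "\<dots> = ?N + ennreal (exp (s * a) - 1) * ?N"
    using a s by (subst ennreal_plus) (auto simp: distrib_right)
  also have "\<dots> \<le> ?N + ennreal ?G"
    using a s e1 by (intro add_left_mono G) auto
  finally show "?N' \<le> ?N + ennreal ?G" .
  have "?N = ennreal (exp (- s * a) + (1 - exp (- s * a))) * ?N" by simp
  also have "\<dots> = ennreal (exp (- s * a)) * ?N + ennreal (1 - exp (- s * a)) * ?N"
    using a s by (subst ennreal_plus) (auto simp: distrib_right)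
  also have "\<dots> \<le> ?N' + ennreal ?G"
    using 1 a s e2 unfolding heat_sum_shift by (intro add_mono G) auto
  finally show "?N \<le> ?N' + ennreal ?G" .
  show N: "?N < \<infinity>" using small by (simp add: le_less_trans)
  then show "?N' < \<infinity>" using up by (simp add: le_less_trans ennreal_mult_less_top)
qed

text \<open>The two inequalities make both values finite or both infinite; in the latter case
  \<open>enn2real\<close> is 0 on both sides.\<close>

lemma enn2real_close:
  assumes "x \<le> y + ennreal k" "y \<le> x + ennreal k" "0 \<le> k"
  shows "\<bar>enn2real x - enn2real y\<bar> \<le> k" and "x < \<infinity> \<longleftrightarrow> y < \<infinity>"
proof -
  show fin: "x < \<infinity> \<longleftrightarrow> y < \<infinity>"
    using assms by (auto simp: less_top[symmetric] top_unique)
  show "\<bar>enn2real x - enn2real y\<bar> \<le> k"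
  proof (cases "y < \<infinity>")
    case False
    then show ?thesis using fin assms(3) by (simp add: less_top[symmetric])
  next
    case True
    then obtain x' y' where xy: "x = ennreal x'" "y = ennreal y'" "0 \<le> x'" "0 \<le> y'"
      using fin by (cases x; cases y) auto
    then have "x' \<le> y' + k" "y' \<le> x' + k"
      using assms by (simp_all add: ennreal_plus[symmetric] del: ennreal_plus)
    then show ?thesis using xy by simp
  qed
qed

section \<open>Integration of heat sums against a measure with exponential moments\<close>

context
  fixes \<phi> :: "real measure"
  assumes sets_phi: "sets \<phi> = sets (restrict_space borel {0<..})"
    and moment: "\<And>t. 0 \<le> t \<Longrightarrow> (\<integral>\<^sup>+s. ennreal (exp (s * t)) \<partial>\<phi>) < \<infinity>"
begin

lemma space_phi: "space \<phi> = {0<..}"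
  using sets_eq_imp_space_eq[OF sets_phi] by (simp add: space_restrict_space)

lemma measurable_phi: "f \<in> borel_measurable borel \<Longrightarrow> f \<in> borel_measurable \<phi>"
  using measurable_restrict_space1[of f borel borel "{0<..}"] measurable_cong_sets[OF sets_phi refl] by blast

lemma finite_phi: "finite_measure \<phi>"
  using moment[of 0] by (intro finite_measureI) (simp add: less_top)

lemma integrable_phi:
  assumes "0 \<le> x" shows "integrable \<phi> (\<lambda>s. exp (- s * x))"
proof -
  interpret finite_measure \<phi> by (rule finite_phi)
  show ?thesis
  proof (rule integrable_const_bound[where B = 1])
    show "AE s in \<phi>. norm (exp (- s * x)) \<le> 1"
      using assms by (intro AE_I2) (simp add: space_phi)
  qed (intro measurable_phi, measurable)
qed

lemma laplace_bounds:
  assumes "0 \<le> x" shows "0 \<le> laplace \<phi> x" "laplace \<phi> x \<le> measure \<phi> (space \<phi>)"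
proof -
  interpret finite_measure \<phi> by (rule finite_phi)
  show "0 \<le> laplace \<phi> x" unfolding laplace_def by (intro Bochner_Integration.integral_nonneg) simp
  have "laplace \<phi> x \<le> (\<integral>s. 1 \<partial>\<phi>)"
    unfolding laplace_def using assms
    by (intro integral_mono integrable_phi) (auto simp: space_phi)
  then show "laplace \<phi> x \<le> measure \<phi> (space \<phi>)" by simp
qed

text \<open>Off the half-line the extensional function has the constant value
  \<open>undefined\<close>, so it is Borel on the whole line and the functional calculus applies to
  it.\<close>

lemma laplace_measurable: "restrict (laplace \<phi>) {0<..} \<in> borel_measurable borel"
proof -
  interpret finite_measure \<phi> by (rule finite_phi)
  have id: "(\<lambda>s. s) \<in> measurable \<phi> borel" by (rule measurable_phi) simp
  have "(\<lambda>p. exp (- snd p * fst p)) \<in> borel_measurable (borel \<Otimes>\<^sub>M \<phi>)"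
    using measurable_compose[OF measurable_snd id, of "borel :: real measure"] by measurable
  then have "laplace \<phi> \<in> borel_measurable borel"
    unfolding laplace_def[abs_def]
    by (intro borel_measurable_lebesgue_integral) (simp add: case_prod_beta')
  then have "(\<lambda>x. if x \<in> {0<..} then laplace \<phi> x else undefined) \<in> borel_measurable borel"
    by (intro measurable_If_set) auto
  then show ?thesis by (simp add: restrict_def[abs_def])
qed

lemma measurable_heat_kernel:
  assumes "countable J"
  shows "(\<lambda>(j, s). ennreal (exp (- (s / \<Lambda>) * l j))) \<in> borel_measurable (count_space J \<Otimes>\<^sub>M \<phi>)"
  using assms
proof (rule measurable_pair_measure_countable1)
  fix j
  have "(\<lambda>s. ennreal (exp (- (s / \<Lambda>) * l j))) \<in> borel_measurable \<phi>"
    by (rule measurable_phi) measurable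
  then show "(\<lambda>s. case (j, s) of (j, s) \<Rightarrow> ennreal (exp (- (s / \<Lambda>) * l j))) \<in> borel_measurable \<phi>"
    by simp
qed

text \<open>Tonelli interchanges the sum over the eigenvalues with the Laplace integral: the trace
  of the test function is the integral over \<phi> of heat traces at the times s /
  \<Lambda>.\<close>

lemma nn_integral_laplace:
  assumes J: "countable J" and l: "\<And>j. j \<in> J \<Longrightarrow> 0 < l j" and \<Lambda>: "0 < \<Lambda>"
  shows "(\<integral>\<^sup>+j. ennreal (laplace \<phi> (l j / \<Lambda>)) \<partial>count_space J) = (\<integral>\<^sup>+s. heat_sum J l (s / \<Lambda>) \<partial>\<phi>)"
proof -
  interpret F: finite_measure \<phi> by (rule finite_phi)
  interpret S: sigma_finite_measure "count_space J" by (rule sigma_finite_measure_count_space_countable[OF J])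
  interpret pair_sigma_finite "count_space J" \<phi> ..
  note m = measurable_heat_kernel[OF J, of \<Lambda> l]
  have "ennreal (laplace \<phi> (l j / \<Lambda>)) = (\<integral>\<^sup>+s. ennreal (exp (- (s / \<Lambda>) * l j)) \<partial>\<phi>)" if "j \<in> J" for j
  proof -
    have "0 \<le> l j / \<Lambda>" using l[OF that] \<Lambda> by simp
    from nn_integral_eq_integral[OF integrable_phi[OF this]] show ?thesis
      unfolding laplace_def by simp
  qed
  then have "(\<integral>\<^sup>+j. ennreal (laplace \<phi> (l j / \<Lambda>)) \<partial>count_space J)
      = (\<integral>\<^sup>+j. \<integral>\<^sup>+s. ennreal (exp (- (s / \<Lambda>) * l j)) \<partial>\<phi> \<partial>count_space J)"
    by (intro nn_integral_cong) simp
  also have "\<dots> = (\<integral>\<^sup>+s. \<integral>\<^sup>+j. ennreal (exp (- (s / \<Lambda>) * l j)) \<partial>count_space J \<partial>\<phi>)"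
    using Fubini'[OF m] by simp
  finally show ?thesis by (simp add: heat_sum_def)
qed

lemma nn_integral_laplace_close:
  assumes a: "0 < a" and C: "0 \<le> C" and \<Lambda>: "0 < \<Lambda>"
    and J: "countable J" and I: "countable I"
    and l: "\<And>j. j \<in> J \<Longrightarrow> 0 < l j" and d: "\<And>i. i \<in> I \<Longrightarrow> 0 < d i"
    and close: "\<And>s. 0 < s \<Longrightarrow> heat_sum J l s \<le> heat_sum I d s + ennreal (a * C * sqrt s * exp (s * a))"
  shows "(\<integral>\<^sup>+j. ennreal (laplace \<phi> (l j / \<Lambda>)) \<partial>count_space J)
    \<le> (\<integral>\<^sup>+i. ennreal (laplace \<phi> (d i / \<Lambda>)) \<partial>count_space I)
      + ennreal (a * C / sqrt \<Lambda> * enn2real (\<integral>\<^sup>+s. ennreal (exp (s * (1 + a / \<Lambda>))) \<partial>\<phi>))"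
proof -
  interpret finite_measure \<phi> by (rule finite_phi)
  have ms: "(\<lambda>s. ennreal (a * C / sqrt \<Lambda>) * ennreal (exp (s * (1 + a / \<Lambda>)))) \<in> borel_measurable \<phi>"
    and me: "(\<lambda>s. ennreal (exp (s * (1 + a / \<Lambda>)))) \<in> borel_measurable \<phi>"
    by (rule measurable_phi, measurable)+
  have mh: "(\<lambda>s. heat_sum I d (s / \<Lambda>)) \<in> borel_measurable \<phi>"
  proof -
    have "(\<lambda>(s, i). ennreal (exp (- (s / \<Lambda>) * d i))) \<in> borel_measurable (\<phi> \<Otimes>\<^sub>M count_space I)"
      using measurable_pair_swap[OF measurable_heat_kernel[OF I, of \<Lambda> d]] by simp
    moreover have "sigma_finite_measure (count_space I)"
      by (rule sigma_finite_measure_count_space_countable[OF I])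
    ultimately show ?thesis unfolding heat_sum_def
      by (intro sigma_finite_measure.borel_measurable_nn_integral)
  qed
  have "(\<integral>\<^sup>+j. ennreal (laplace \<phi> (l j / \<Lambda>)) \<partial>count_space J) = (\<integral>\<^sup>+s. heat_sum J l (s / \<Lambda>) \<partial>\<phi>)"
    by (rule nn_integral_laplace[OF J l \<Lambda>])
  also have "\<dots> \<le> (\<integral>\<^sup>+s. heat_sum I d (s / \<Lambda>) + ennreal (a * C / sqrt \<Lambda>) * ennreal (exp (s * (1 + a / \<Lambda>))) \<partial>\<phi>)"
  proof (rule nn_integral_mono)
    fix s assume "s \<in> space \<phi>"
    then have s: "0 < s" by (simp add: space_phi)
    \<comment> \<open>Replacing sqrt s by exp s turns the error at time s / \<Lambda> into an
      exponential of rate 1 + a / \<Lambda>, which has a finite integral over \<phi>; the factor 1 /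
      sqrt \<Lambda> stays outside.\<close>
    have "sqrt s \<le> exp s"
    proof -
      have "sqrt s \<le> 1 + s" using s by (intro real_le_lsqrt) (auto simp: power2_eq_square algebra_simps)
      also have "\<dots> \<le> exp s" by (rule exp_ge_add_one_self)
      finally show ?thesis .
    qed
    then have "a * C / sqrt \<Lambda> * (sqrt s * exp (s / \<Lambda> * a)) \<le> a * C / sqrt \<Lambda> * (exp s * exp (s / \<Lambda> * a))"
      using a C \<Lambda> by (intro mult_left_mono mult_right_mono) auto
    moreover have "exp s * exp (s / \<Lambda> * a) = exp (s * (1 + a / \<Lambda>))"
      by (simp add: exp_add[symmetric] algebra_simps)
    moreover have "a * C * sqrt (s / \<Lambda>) * exp (s / \<Lambda> * a) = a * C / sqrt \<Lambda> * (sqrt s * exp (s / \<Lambda> * a))"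
      by (simp add: real_sqrt_divide)
    ultimately have "a * C * sqrt (s / \<Lambda>) * exp (s / \<Lambda> * a) \<le> a * C / sqrt \<Lambda> * exp (s * (1 + a / \<Lambda>))"
      by simp
    then have "ennreal (a * C * sqrt (s / \<Lambda>) * exp (s / \<Lambda> * a))
        \<le> ennreal (a * C / sqrt \<Lambda>) * ennreal (exp (s * (1 + a / \<Lambda>)))"
      using a C \<Lambda> by (subst ennreal_mult[symmetric]) (auto intro: ennreal_leI)
    then show "heat_sum J l (s / \<Lambda>)
        \<le> heat_sum I d (s / \<Lambda>) + ennreal (a * C / sqrt \<Lambda>) * ennreal (exp (s * (1 + a / \<Lambda>)))"
      using close[of "s / \<Lambda>"] s \<Lambda> by (meson add_left_mono divide_pos_pos order_trans)
  qed
  also have "\<dots> = (\<integral>\<^sup>+s. heat_sum I d (s / \<Lambda>) \<partial>\<phi>) + ennreal (a * C / sqrt \<Lambda>) * (\<integral>\<^sup>+s. ennreal (exp (s * (1 + a / \<Lambda>))) \<partial>\<phi>)"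
    using mh ms me by (simp add: nn_integral_add nn_integral_cmult)
  also have "(\<integral>\<^sup>+s. heat_sum I d (s / \<Lambda>) \<partial>\<phi>) = (\<integral>\<^sup>+i. ennreal (laplace \<phi> (d i / \<Lambda>)) \<partial>count_space I)"
    by (rule nn_integral_laplace[OF I d \<Lambda>, symmetric])
  also have "(\<integral>\<^sup>+s. ennreal (exp (s * (1 + a / \<Lambda>))) \<partial>\<phi>)
      = ennreal (enn2real (\<integral>\<^sup>+s. ennreal (exp (s * (1 + a / \<Lambda>))) \<partial>\<phi>))"
    using moment[of "1 + a / \<Lambda>"] a \<Lambda> by simp
  also have "ennreal (a * C / sqrt \<Lambda>) * ennreal (enn2real (\<integral>\<^sup>+s. ennreal (exp (s * (1 + a / \<Lambda>))) \<partial>\<phi>))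
      = ennreal (a * C / sqrt \<Lambda> * enn2real (\<integral>\<^sup>+s. ennreal (exp (s * (1 + a / \<Lambda>))) \<partial>\<phi>))"
    using a C \<Lambda> by (intro ennreal_mult[symmetric]) auto
  finally show ?thesis .
qed

lemma moment_mono:
  assumes "t \<le> t'" "0 \<le> t'"
  shows "enn2real (\<integral>\<^sup>+s. ennreal (exp (s * t)) \<partial>\<phi>) \<le> enn2real (\<integral>\<^sup>+s. ennreal (exp (s * t')) \<partial>\<phi>)"
proof (rule enn2real_mono)
  show "(\<integral>\<^sup>+s. ennreal (exp (s * t)) \<partial>\<phi>) \<le> (\<integral>\<^sup>+s. ennreal (exp (s * t')) \<partial>\<phi>)"
    using assms by (intro nn_integral_mono ennreal_leI) (auto simp: space_phi mult_left_mono)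
qed (use moment[OF assms(2)] in simp)

end

section \<open>The spectral theorem for operators with compact resolvent\<close>

lemma selfadjoint_closed:
  assumes T: "selfadjoint T" and XY: "\<And>n. (X n, Y n) \<in> T"
    and x: "x \<in> hilb" "(\<lambda>n. vnorm (X n - x)) \<longlonglongrightarrow> 0"
    and y: "y \<in> hilb" "(\<lambda>n. vnorm (Y n - y)) \<longlonglongrightarrow> 0"
  shows "(x, y) \<in> T"
proof (rule selfadjoint_memI[OF T x(1) y(1)])
  note lin = selfadjoint_linear[OF T]
  note h = linear_op_hilb[OF lin]
  fix u v assume uv: "(u, v) \<in> T"
  have "(\<lambda>n. ip u (Y n)) \<longlonglongrightarrow> ip u y"
    by (rule ip_tendsto_right) (use h[OF uv] h[OF XY] y in auto)
  moreover have "(\<lambda>n. ip v (X n)) \<longlonglongrightarrow> ip v x"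
    by (rule ip_tendsto_right) (use h[OF uv] h[OF XY] x in auto)
  moreover have "ip u (Y n) = ip v (X n)" for n by (rule selfadjoint_sym[OF T XY uv])
  ultimately show "ip u y = ip v x" using LIMSEQ_unique by simp
qed

lemma hilb_convergent_square:
  assumes X: "\<And>n. X n \<in> hilb" and t: "t \<longlonglongrightarrow> 0"
    and le: "\<And>m n. (vnorm (X m - X n))\<^sup>2 \<le> t m + t n"
  shows "\<exists>x\<in>hilb. (\<lambda>n::nat. vnorm (X n - x)) \<longlonglongrightarrow> 0"
proof (rule hilb_complete[OF X])
  fix e :: real assume e: "0 < e"
  then have "0 < e\<^sup>2 / 2" by simp
  from LIMSEQ_D[OF t this] obtain N where N: "\<And>n. n \<ge> N \<Longrightarrow> norm (t n - 0) < e\<^sup>2 / 2" by blast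
  have "vnorm (X m - X n) < e" if mn: "N \<le> m" "N \<le> n" for m n
  proof -
    have "t m < e\<^sup>2 / 2" "t n < e\<^sup>2 / 2" using N[OF mn(1)] N[OF mn(2)] by (simp_all only: diff_zero real_norm_def abs_less_iff)
    then have "(vnorm (X m - X n))\<^sup>2 < e\<^sup>2" using le[of m n] by linarith
    then show ?thesis by (rule power2_less_imp_less) (use e in simp)
  qed
  then show "\<exists>N. \<forall>m\<ge>N. \<forall>n\<ge>N. vnorm (X m - X n) < e" by blast
qed

lemma finite_coordinates_convergent_subseq:
  fixes X :: "nat \<Rightarrow> 'a \<Rightarrow> complex"
  assumes "finite F" "\<And>n i. cmod (X n i) \<le> B"
  shows "\<exists>r. strict_mono r \<and> (\<forall>i\<in>F. convergent (\<lambda>n. X (r n) i))"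
  using assms(1)
proof (induction F)
  case empty
  show ?case by (rule exI[of _ id]) (simp add: strict_mono_def)
next
  case (insert k F)
  then obtain r where r: "strict_mono r" "\<forall>i\<in>F. convergent (\<lambda>n. X (r n) i)" by blast
  have "bounded (range (\<lambda>n. X (r n) k))"
    using assms(2) by (auto simp: bounded_iff)
  then obtain c s where s: "strict_mono s" "((\<lambda>n. X (r n) k) \<circ> s) \<longlonglongrightarrow> c"
    using bounded_imp_convergent_subsequence by blast
  have "convergent (\<lambda>n. X ((r \<circ> s) n) i)" if "i \<in> F" for i
    using convergent_subseq_convergent[OF r(2)[rule_format, OF that] s(1)] by (simp add: comp_def)
  moreover have "convergent (\<lambda>n. X ((r \<circ> s) n) k)" using s(2) by (auto simp: convergent_def comp_def)
  ultimately show ?case using r(1) s(1) by (intro exI[of _ "r \<circ> s"]) (auto simp: strict_mono_def)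
qed

text \<open>Bounded sets for the graph norm of \<open>T\<close> are precompact, equivalently \<open>T\<close> has compact resolvent.\<close>

definition compact_resolvent :: "oper \<Rightarrow> bool" where
  "compact_resolvent T \<longleftrightarrow> (\<forall>K. \<exists>F k. finite F \<and> F \<subseteq> labels \<and> 0 \<le> k \<and>
     (\<forall>(x, y) \<in> T. K * (vnorm x)\<^sup>2 \<le> (vnorm y)\<^sup>2 + k * (\<Sum>i\<in>F. (cmod (x i))\<^sup>2)))"

text \<open>The direct method for ||T x||^2 on the unit vectors orthogonal to \<open>P\<close>. The
  parallelogram law controls differences of a minimising sequence up to finitely many coordinates,
  and these converge along a subsequence.\<close>

lemma minimising_vector:
  assumes T: "selfadjoint T" and cr: "compact_resolvent T"
    and W: "W = {(x, y) \<in> T. \<forall>p\<in>P. ip p x = 0}" and P: "P \<subseteq> hilb"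
    and ne: "\<exists>(x, y) \<in> W. x \<noteq> 0"
  obtains x y m where "(x, y) \<in> W" "vnorm x = 1" "0 \<le> m" "(vnorm y)\<^sup>2 = m"
    "\<And>u v. (u, v) \<in> W \<Longrightarrow> m * (vnorm u)\<^sup>2 \<le> (vnorm v)\<^sup>2"
proof -
  note lin = selfadjoint_linear[OF T]
  have WT: "(x, y) \<in> T" if "(x, y) \<in> W" for x y using that W by blast
  note h = linear_op_hilb[OF lin WT]
  have Wadd: "(x + vscale c x', y + vscale c y') \<in> W" if "(x, y) \<in> W" "(x', y') \<in> W" for x y x' y' c
    using that h[OF that(1)] h[OF that(2)] P unfolding W
    by (auto intro!: linear_op_add[OF lin] linear_op_scale[OF lin] simp: ip_add_right ip_scale_right subset_iff)
  have Wscale: "(vscale c x, vscale c y) \<in> W" if "(x, y) \<in> W" for x y c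
    using that unfolding W by (auto intro!: linear_op_scale[OF lin] simp: ip_scale_right)
  define Q where "Q = {(vnorm y)\<^sup>2 | x y. (x, y) \<in> W \<and> vnorm x = 1}"
  define m where "m = Inf Q"
  have normalise: "(vnorm y)\<^sup>2 / (vnorm x)\<^sup>2 \<in> Q" if xy: "(x, y) \<in> W" and x: "vnorm x \<noteq> 0" for x y
  proof -
    let ?c = "complex_of_real (1 / vnorm x)"
    have "vnorm (vscale ?c x) = 1" using x by (simp add: vnorm_scale norm_divide)
    moreover have "(vnorm (vscale ?c y))\<^sup>2 = (vnorm y)\<^sup>2 / (vnorm x)\<^sup>2"
      by (simp add: vnorm_scale norm_divide power_divide)
    ultimately show ?thesis using Wscale[OF xy, of ?c] unfolding Q_def by (metis (mono_tags, lifting) mem_Collect_eq)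
  qed
  have "Q \<noteq> {}"
  proof -
    obtain x y where xy: "(x, y) \<in> W" "x \<noteq> 0" using ne by blast
    then have "vnorm x \<noteq> 0" using vnorm_eq_zero[of x] h[OF xy(1)] by blast
    from normalise[OF xy(1) this] show ?thesis by blast
  qed
  have bdd: "bdd_below Q" unfolding Q_def by (rule bdd_belowI[of _ 0]) auto
  have "0 \<le> m" unfolding m_def using \<open>Q \<noteq> {}\<close> by (intro cInf_greatest) (auto simp: Q_def)
  have q: "m * (vnorm u)\<^sup>2 \<le> (vnorm v)\<^sup>2" if uv: "(u, v) \<in> W" for u v
  proof (cases "vnorm u = 0")
    case False
    then have "m \<le> (vnorm v)\<^sup>2 / (vnorm u)\<^sup>2"
      unfolding m_def by (intro cInf_lower normalise uv bdd)
    then show ?thesis using False by (simp add: pos_le_divide_eq)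
  qed simp
  define \<delta> where "\<delta> n = inverse (real (Suc n))" for n
  have \<delta>: "\<delta> \<longlonglongrightarrow> 0" "0 < \<delta> n" for n
    unfolding \<delta>_def using LIMSEQ_inverse_real_of_nat by simp_all
  have "\<exists>x y. (x, y) \<in> W \<and> vnorm x = 1 \<and> (vnorm y)\<^sup>2 < m + \<delta> n" for n
  proof -
    have "Inf Q < m + \<delta> n" using \<delta>(2) by (simp add: m_def)
    then obtain a where "a \<in> Q" "a < m + \<delta> n"
      using cInf_lessD[OF \<open>Q \<noteq> {}\<close>] by blast
    then show ?thesis unfolding Q_def by blast
  qed
  then obtain X Y where XY: "\<And>n. (X n, Y n) \<in> W" "\<And>n. vnorm (X n) = 1"
    "\<And>n. (vnorm (Y n))\<^sup>2 < m + \<delta> n" by metis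
  \<comment> \<open>The choice K = m + 1 leaves ||x||^2 on the left after m ||x||^2 has been moved
    to the right, where ||y||^2 - m ||x||^2 is small for differences of minimising vectors.\<close>
  from cr[unfolded compact_resolvent_def, rule_format, of "m + 1"] obtain F k where
    F: "finite F" "F \<subseteq> labels" "0 \<le> k"
    and "\<forall>(x, y) \<in> T. (m + 1) * (vnorm x)\<^sup>2 \<le> (vnorm y)\<^sup>2 + k * (\<Sum>i\<in>F. (cmod (x i))\<^sup>2)"
    by (elim exE conjE)
  then have Fk: "(m + 1) * (vnorm x)\<^sup>2 \<le> (vnorm y)\<^sup>2 + k * (\<Sum>i\<in>F. (cmod (x i))\<^sup>2)"
    if "(x, y) \<in> T" for x y using that by blast
  have "cmod (X n i) \<le> 1" for n i using coord_le_vnorm[of "X n" i] h[OF XY(1)] XY(2)[of n] by simp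
  from finite_coordinates_convergent_subseq[where X = X, OF F(1) this] obtain r where
    r: "strict_mono r" "\<And>i. i \<in> F \<Longrightarrow> convergent (\<lambda>n. X (r n) i)" by blast
  then obtain c where c: "\<And>i. i \<in> F \<Longrightarrow> (\<lambda>n. X (r n) i) \<longlonglongrightarrow> c i"
    unfolding convergent_def by metis
  define t where "t n = 2 * \<delta> n + k * (\<Sum>i\<in>F. 2 * (cmod (X (r n) i - c i))\<^sup>2)" for n
  have "t \<longlonglongrightarrow> 2 * 0 + k * (\<Sum>i\<in>F. 2 * (cmod (c i - c i))\<^sup>2)"
    unfolding t_def by (intro tendsto_intros c \<delta>(1))
  then have t: "t \<longlonglongrightarrow> 0" by simp
  have t2: "(\<lambda>n. (m + 1) * t n) \<longlonglongrightarrow> 0" by (rule tendsto_mult_right_zero[OF t])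
  have both: "(vnorm (X (r a) - X (r b)))\<^sup>2 \<le> t a + t b
      \<and> (vnorm (Y (r a) - Y (r b)))\<^sup>2 \<le> (m + 1) * t a + (m + 1) * t b" for a b
  proof -
    define x y where "x = X (r a) - X (r b)" and "y = Y (r a) - Y (r b)"
    have xy: "(x, y) \<in> W"
      using Wadd[OF XY(1)[of "r a"] XY(1)[of "r b"], of "-1"] by (simp add: x_def y_def diff_eq_add_vscale)
    have inv: "\<delta> (r a) \<le> \<delta> a" for a
      using seq_suble[OF r(1), of a] by (simp add: \<delta>_def le_imp_inverse_le)
    have par: "(vnorm (u - v))\<^sup>2 = 2 * (vnorm u)\<^sup>2 + 2 * (vnorm v)\<^sup>2 - (vnorm (u + v))\<^sup>2"
      if "u \<in> hilb" "v \<in> hilb" for u v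
      using vnorm_power2_add[of u "vscale (-1) v"] vnorm_power2_add[of u v] that
      by (simp add: diff_eq_add_vscale ip_scale_right vnorm_scale)
    have "(X (r a) + X (r b), Y (r a) + Y (r b)) \<in> W"
      using Wadd[OF XY(1)[of "r a"] XY(1)[of "r b"], of 1] by simp
    \<comment> \<open>The form ||y||^2 - m ||x||^2 is nonnegative on \<open>W\<close>, so by the
      parallelogram law its value at the difference is at most twice the sum of its values at the
      two vectors.\<close>
    from q[OF this] have "(vnorm y)\<^sup>2 - m * (vnorm x)\<^sup>2
        \<le> 2 * ((vnorm (Y (r a)))\<^sup>2 - m) + 2 * ((vnorm (Y (r b)))\<^sup>2 - m)"
      unfolding x_def y_def using h[OF XY(1)[of "r a"]] h[OF XY(1)[of "r b"]]
      by (simp add: par XY(2) algebra_simps)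
    then have qle: "(vnorm y)\<^sup>2 - m * (vnorm x)\<^sup>2 \<le> 2 * \<delta> a + 2 * \<delta> b"
    proof (rule order_trans)
      have "2 * ((vnorm (Y (r a)))\<^sup>2 - m) \<le> 2 * \<delta> a" for a
        using order_trans[OF less_imp_le[OF XY(3)[of "r a"]] add_left_mono[OF inv[of a], of m]] by simp
      then show "2 * ((vnorm (Y (r a)))\<^sup>2 - m) + 2 * ((vnorm (Y (r b)))\<^sup>2 - m) \<le> 2 * \<delta> a + 2 * \<delta> b"
        by (intro add_mono)
    qed
    have "(\<Sum>i\<in>F. (cmod (x i))\<^sup>2) \<le> (\<Sum>i\<in>F. 2 * (cmod (X (r a) i - c i))\<^sup>2 + 2 * (cmod (X (r b) i - c i))\<^sup>2)"
    proof (rule sum_mono)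
      fix i
      show "(cmod (x i))\<^sup>2 \<le> 2 * (cmod (X (r a) i - c i))\<^sup>2 + 2 * (cmod (X (r b) i - c i))\<^sup>2"
        using sq_add_le[of "X (r a) i - c i" "c i - X (r b) i"] by (simp add: x_def norm_minus_commute)
    qed
    from mult_left_mono[OF this F(3)] have "k * (\<Sum>i\<in>F. (cmod (x i))\<^sup>2)
        \<le> k * (\<Sum>i\<in>F. 2 * (cmod (X (r a) i - c i))\<^sup>2) + k * (\<Sum>i\<in>F. 2 * (cmod (X (r b) i - c i))\<^sup>2)"
      by (simp add: sum.distrib distrib_left)
    moreover have "(m + 1) * (vnorm x)\<^sup>2 \<le> (vnorm y)\<^sup>2 + k * (\<Sum>i\<in>F. (cmod (x i))\<^sup>2)"
      by (rule Fk[OF WT[OF xy]])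
    ultimately have 1: "(vnorm x)\<^sup>2 \<le> t a + t b"
      using qle unfolding t_def by (simp add: algebra_simps)
    have "0 \<le> k * (\<Sum>i\<in>F. 2 * (cmod (X (r n) i - c i))\<^sup>2)" for n
      using F(3) by (intro mult_nonneg_nonneg sum_nonneg) auto
    then have "2 * \<delta> n \<le> t n" for n unfolding t_def by simp
    then have "(vnorm y)\<^sup>2 \<le> m * (vnorm x)\<^sup>2 + (t a + t b)"
      using qle by (smt (verit))
    also have "\<dots> \<le> m * (t a + t b) + (t a + t b)"
      using 1 \<open>0 \<le> m\<close> by (intro add_right_mono mult_left_mono)
    finally show ?thesis using 1 unfolding x_def y_def by (simp add: algebra_simps)
  qed
  have Xh: "X (r n) \<in> hilb" and Yh: "Y (r n) \<in> hilb" for n using h[OF XY(1)] by auto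
  obtain x where x: "x \<in> hilb" "(\<lambda>n. vnorm (X (r n) - x)) \<longlonglongrightarrow> 0"
    using hilb_convergent_square[of "\<lambda>n. X (r n)" t] Xh t both by blast
  obtain y where y: "y \<in> hilb" "(\<lambda>n. vnorm (Y (r n) - y)) \<longlonglongrightarrow> 0"
    using hilb_convergent_square[of "\<lambda>n. Y (r n)" "\<lambda>n. (m + 1) * t n"] Yh t2 both by blast
  have "(x, y) \<in> T"
    by (rule selfadjoint_closed[OF T WT[OF XY(1)] x y])
  moreover have "ip p x = 0" if "p \<in> P" for p
  proof -
    have "(\<lambda>n. ip p (X (r n))) \<longlonglongrightarrow> ip p x"
      by (rule ip_tendsto_right) (use that P Xh x in auto)
    moreover have "ip p (X (r n)) = 0" for n using XY(1)[of "r n"] that unfolding W by blast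
    ultimately show ?thesis by (simp add: LIMSEQ_const_iff)
  qed
  ultimately have xyW: "(x, y) \<in> W" unfolding W by blast
  have "(\<lambda>n. vnorm (X (r n))) \<longlonglongrightarrow> vnorm x" by (rule vnorm_tendsto[OF Xh x])
  then have x1: "vnorm x = 1" by (simp add: XY(2) LIMSEQ_const_iff)
  have "(vnorm y)\<^sup>2 \<le> m"
  proof (rule LIMSEQ_le)
    show "(\<lambda>n. (vnorm (Y (r n)))\<^sup>2) \<longlonglongrightarrow> (vnorm y)\<^sup>2"
      by (intro tendsto_power vnorm_tendsto[OF Yh y])
    have "(\<lambda>n. \<delta> (r n)) \<longlonglongrightarrow> 0"
      using LIMSEQ_subseq_LIMSEQ[OF \<delta>(1) r(1)] by (simp add: comp_def)
    then show "(\<lambda>n. m + \<delta> (r n)) \<longlonglongrightarrow> m"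
      using tendsto_add[OF tendsto_const] by fastforce
    show "\<exists>N. \<forall>n\<ge>N. (vnorm (Y (r n)))\<^sup>2 \<le> m + \<delta> (r n)"
      using XY(3) less_imp_le by blast
  qed
  moreover have "m \<le> (vnorm y)\<^sup>2" using q[OF xyW] x1 by simp
  ultimately show ?thesis using that[OF xyW x1 \<open>0 \<le> m\<close> _ q] by simp
qed

text \<open>The first-order condition at a minimum. The direction c = - t cnj h makes the linear
  term - 2 t |h|^2, and t = 1 / (Q + 1) keeps the quadratic term at most half of that in
  size.\<close>

lemma nonneg_form_null_vector:
  fixes h :: complex
  assumes "\<And>c. 0 \<le> 2 * Re (c * h) + (cmod c)\<^sup>2 * Q" and "0 \<le> Q"
  shows "h = 0"
proof -
  define t where "t = 1 / (Q + 1)"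
  have t: "0 < t" "t * Q \<le> 1" using assms(2) by (auto simp: t_def field_simps)
  have "Re (- complex_of_real t * cnj h * h) = - t * (cmod h)\<^sup>2"
    unfolding cmod_power2 by (simp add: power2_eq_square algebra_simps)
  moreover have "cmod (- complex_of_real t * cnj h) = t * cmod h"
    using t by (simp add: norm_mult)
  ultimately have "0 \<le> t * (cmod h)\<^sup>2 * (t * Q - 2)"
    using assms(1)[of "- complex_of_real t * cnj h"] by (simp add: power_mult_distrib power2_eq_square algebra_simps)
  moreover have "t * Q - 2 \<le> -1" using t by simp
  then have "t * (cmod h)\<^sup>2 * (t * Q - 2) \<le> t * (cmod h)\<^sup>2 * (-1)" using t by (intro mult_left_mono) auto
  ultimately have "t * (cmod h)\<^sup>2 \<le> 0" by simp
  then show ?thesis using t by (simp add: mult_le_0_iff)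
qed

text \<open>The closed span of eigenvectors reduces \<open>T\<close>: the projections
  \<open>p\<close> of \<open>u\<close> and \<open>p'\<close> of \<open>u'\<close> form a pair of
  \<open>T\<close>, because by Parseval they satisfy the symmetry relation that characterises the
  graph of a selfadjoint operator.\<close>

lemma reduce_by_eigenvectors:
  assumes T: "selfadjoint T" and o: "orthonormal e J"
    and ev: "\<And>j. j \<in> J \<Longrightarrow> (e j, vscale (complex_of_real (l j)) (e j)) \<in> T"
    and uu': "(u, u') \<in> T"
  obtains p p' where "(p, p') \<in> T" "p \<in> closed_span e J" "p' \<in> closed_span e J"
    "\<And>j. j \<in> J \<Longrightarrow> ip (e j) (u - p) = 0"
proof -
  note lin = selfadjoint_linear[OF T]
  have uh: "u \<in> hilb" "u' \<in> hilb" using linear_op_hilb[OF lin uu'] by auto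
  have proj: "\<exists>p\<in>closed_span e J. \<forall>j\<in>J. ip (e j) p = ip (e j) x" if x: "x \<in> hilb" for x
  proof -
    obtain S where "((\<lambda>j. (cmod (ip (e j) x))\<^sup>2) has_sum S) J"
      using bessel_summable[OF o x] summable_iff_has_sum_infsum by blast
    from riesz_fischer[OF o this] show ?thesis by blast
  qed
  obtain p where p: "p \<in> closed_span e J" "\<And>j. j \<in> J \<Longrightarrow> ip (e j) p = ip (e j) u" using proj[OF uh(1)] by blast
  obtain p' where p': "p' \<in> closed_span e J" "\<And>j. j \<in> J \<Longrightarrow> ip (e j) p' = ip (e j) u'" using proj[OF uh(2)] by blast
  have coeff: "ip (e j) y = complex_of_real (l j) * ip (e j) x" if "j \<in> J" "(x, y) \<in> T" for j x y
    using selfadjoint_sym[OF T that(2) ev[OF that(1)]] by (simp add: ip_scale_left)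
  have "(p, p') \<in> T"
  proof (rule selfadjoint_memI[OF T closed_span_hilb[OF p(1)] closed_span_hilb[OF p'(1)]])
    fix z z' assume z: "(z, z') \<in> T"
    have zh: "z \<in> hilb" "z' \<in> hilb" using linear_op_hilb[OF lin z] by auto
    have "((\<lambda>j. cnj (ip (e j) z) * ip (e j) p') has_sum ip z p') J"
      by (rule parseval_ip[OF o zh(1) p'(1)])
    moreover have "((\<lambda>j. cnj (ip (e j) z') * ip (e j) p) has_sum ip z' p) J"
      by (rule parseval_ip[OF o zh(2) p(1)])
    moreover have "cnj (ip (e j) z') * ip (e j) p = cnj (ip (e j) z) * ip (e j) p'" if "j \<in> J" for j
      using coeff[OF that z] coeff[OF that uu'] p(2)[OF that] p'(2)[OF that] by simp
    ultimately show "ip z p' = ip z' p" by (metis (no_types, lifting) has_sum_cong has_sum_unique)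
  qed
  moreover have "ip (e j) (u - p) = 0" if "j \<in> J" for j
    using p(2)[OF that] orthonormal_hilb[OF o that] uh closed_span_hilb[OF p(1)] by (simp add: ip_diff_right)
  ultimately show ?thesis using that p(1) p'(1) by blast
qed

text \<open>A minimiser \<open>x\<close> of \<open>\<parallel>T x\<parallel>\<close> on the unit sphere of the reducing subspace satisfies
  \<open>T\<^sup>2 x = \<mu>\<^sup>2 x\<close>, and \<open>(T - \<mu>) (T + \<mu>) x = 0\<close> yields an eigenvector.\<close>

lemma eigenvector_orthogonal:
  assumes T: "selfadjoint T" and cr: "compact_resolvent T" and o: "orthonormal e J"
    and ev: "\<And>j. j \<in> J \<Longrightarrow> (e j, vscale (complex_of_real (l j)) (e j)) \<in> T"
    and x0: "x0 \<in> hilb" "x0 \<noteq> 0" "\<And>j. j \<in> J \<Longrightarrow> ip (e j) x0 = 0"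
  obtains z k where "vnorm z = 1" "(z, vscale (complex_of_real k) z) \<in> T" "\<And>j. j \<in> J \<Longrightarrow> ip (e j) z = 0"
proof -
  note lin = selfadjoint_linear[OF T]
  define W where "W = {(x, y) \<in> T. \<forall>p\<in>e ` J. ip p x = 0}"
  have split: "\<exists>p p'. (u - p, u' - p') \<in> W \<and> p \<in> closed_span e J \<and> p' \<in> closed_span e J"
    if uu': "(u, u') \<in> T" for u u'
  proof -
    from reduce_by_eigenvectors[OF T o ev uu'] obtain p p' where p: "(p, p') \<in> T" "p \<in> closed_span e J"
      "p' \<in> closed_span e J" "\<And>j. j \<in> J \<Longrightarrow> ip (e j) (u - p) = 0" by blast
    then have "(u - p, u' - p') \<in> W"
      unfolding W_def using linear_op_diff[OF lin uu' p(1)] by auto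
    with p show ?thesis by blast
  qed
  have "\<exists>(x, y) \<in> W. x \<noteq> 0"
  proof -
    \<comment> \<open>If \<open>x0\<close> were orthogonal to the domain, \<open>(0, x0)\<close>
      would belong to the adjoint, which is \<open>T\<close>, and \<open>T\<close> is
      single-valued.\<close>
    have "\<exists>(u, u') \<in> T. ip u x0 \<noteq> 0"
    proof (rule ccontr)
      assume "\<not> ?thesis"
      then have "(0, x0) \<in> T" by (intro selfadjoint_memI[OF T]) (use x0 in auto)
      then show False using linear_op_unique[OF lin linear_op_zero[OF lin]] x0(2) by metis
    qed
    then obtain u u' where u: "(u, u') \<in> T" "ip u x0 \<noteq> 0" by blast
    from split[OF u(1)] obtain p p' where p: "(u - p, u' - p') \<in> W" "p \<in> closed_span e J" by blast
    have "ip x0 p = 0" using p(2) x0 unfolding closed_span_def by blast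
    moreover have "ip x0 u \<noteq> 0" using u(2) cnj_ip[of x0 u] by auto
    ultimately have "u - p \<noteq> 0" by auto
    with p(1) show ?thesis by blast
  qed
  moreover have "e ` J \<subseteq> hilb" using orthonormal_hilb[OF o] by blast
  ultimately obtain x y m where x: "(x, y) \<in> W" "vnorm x = 1" "0 \<le> m" "(vnorm y)\<^sup>2 = m"
    and q: "\<And>u v. (u, v) \<in> W \<Longrightarrow> m * (vnorm u)\<^sup>2 \<le> (vnorm v)\<^sup>2"
    using minimising_vector[OF T cr W_def] by metis
  have xyT: "(x, y) \<in> T" using x(1) by (simp add: W_def)
  have h: "x \<in> hilb" "y \<in> hilb" using linear_op_hilb[OF lin xyT] by auto
  have xo: "ip (e j) x = 0" if "j \<in> J" for j using x(1) that by (auto simp: W_def)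
  have yo: "ip (e j) y = 0" if "j \<in> J" for j
    using selfadjoint_sym[OF T xyT ev[OF that]] xo[OF that] by (simp add: ip_scale_left)
  \<comment> \<open>The Euler-Lagrange equation of the minimiser, tested with directions in
    \<open>W\<close> only. By \<open>split\<close> it extends to the whole domain, where it states T
    y = m x.\<close>
  have W_eq: "ip y v = complex_of_real m * ip x u" if uv: "(u, v) \<in> W" for u v
  proof -
    have uvT: "(u, v) \<in> T" using uv by (simp add: W_def)
    have uvh: "u \<in> hilb" "v \<in> hilb" using linear_op_hilb[OF lin uvT] by auto
    have "ip y v - complex_of_real m * ip x u = 0"
    proof (rule nonneg_form_null_vector)
      show "0 \<le> (vnorm v)\<^sup>2 - m * (vnorm u)\<^sup>2" using q[OF uv] by simp
      fix c
      have "(x + vscale c u, y + vscale c v) \<in> W"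
        using x(1) uv h uvh orthonormal_hilb[OF o] unfolding W_def
        by (auto intro!: linear_op_add[OF lin] linear_op_scale[OF lin] simp: ip_add_right ip_scale_right)
      from q[OF this] show "0 \<le> 2 * Re (c * (ip y v - complex_of_real m * ip x u))
          + (cmod c)\<^sup>2 * ((vnorm v)\<^sup>2 - m * (vnorm u)\<^sup>2)"
        using h uvh x(2,4)
        by (simp add: vnorm_power2_add ip_scale_right vnorm_scale power_mult_distrib algebra_simps)
    qed
    then show ?thesis by simp
  qed
  have ymx: "(y, vscale (complex_of_real m) x) \<in> T"
  proof (rule selfadjoint_memI[OF T h(2) hilb_scale[OF h(1)]])
    fix u u' assume uu': "(u, u') \<in> T"
    have uh: "u \<in> hilb" "u' \<in> hilb" using linear_op_hilb[OF lin uu'] by auto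
    from split[OF uu'] obtain p p' where p: "(u - p, u' - p') \<in> W" "p \<in> closed_span e J" "p' \<in> closed_span e J"
      by blast
    have "ip x p = 0" "ip y p' = 0" using p(2,3) h xo yo unfolding closed_span_def by blast+
    then have "ip y u' = complex_of_real m * ip x u"
      using W_eq[OF p(1)] h uh closed_span_hilb[OF p(2)] closed_span_hilb[OF p(3)] by (simp add: ip_diff_right)
    from arg_cong[OF this, of cnj] show "ip u (vscale (complex_of_real m) x) = ip u' y"
      by (simp add: cnj_ip ip_scale_right)
  qed
  define \<mu> where "\<mu> = sqrt m"
  have mm: "complex_of_real m = complex_of_real \<mu> * complex_of_real \<mu>"
    using x(3) by (simp add: \<mu>_def of_real_mult[symmetric] del: of_real_mult)
  \<comment> \<open>The vector z = (T + \<mu>) x satisfies T z = \<mu> z since \<mu>^2 = m. If it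
    vanishes, \<open>x\<close> itself is an eigenvector for - \<mu>.\<close>
  define z where "z = y + vscale (complex_of_real \<mu>) x"
  have zh: "z \<in> hilb" using h by (auto simp: z_def)
  show ?thesis
  proof (cases "z = 0")
    case True
    then have "y = vscale (complex_of_real (- \<mu>)) x"
      unfolding z_def by (simp add: fun_eq_iff eq_neg_iff_add_eq_0)
    then show ?thesis using that[of x "- \<mu>"] x(2) xyT xo by simp
  next
    case False
    let ?c = "complex_of_real (1 / vnorm z)"
    have nz: "vnorm z \<noteq> 0" using False vnorm_eq_zero[OF zh] by blast
    have "(z, vscale (complex_of_real m) x + vscale (complex_of_real \<mu>) y) \<in> T"
      unfolding z_def by (intro linear_op_add[OF lin] linear_op_scale[OF lin] xyT ymx)
    moreover have "vscale (complex_of_real m) x + vscale (complex_of_real \<mu>) y = vscale (complex_of_real \<mu>) z"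
      unfolding z_def mm by (simp add: fun_eq_iff algebra_simps)
    ultimately have "(vscale ?c z, vscale ?c (vscale (complex_of_real \<mu>) z)) \<in> T"
      using linear_op_scale[OF lin] by metis
    then have "(vscale ?c z, vscale (complex_of_real \<mu>) (vscale ?c z)) \<in> T"
      by (simp add: mult.commute)
    moreover have "vnorm (vscale ?c z) = 1" using nz by (simp add: vnorm_scale norm_divide)
    moreover have "ip (e j) (vscale ?c z) = 0" if "j \<in> J" for j
      using xo[OF that] yo[OF that] h orthonormal_hilb[OF o that] by (simp add: z_def ip_scale_right ip_add_right)
    ultimately show ?thesis using that by blast
  qed
qed

text \<open>Zorn's lemma yields a maximal orthonormal set of eigenvectors; a nonzero vector
  orthogonal to it would produce one more eigenvector in the orthogonal complement. The set indexes
  itself, so the basis is the identity function.\<close>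

theorem spectral_theorem_compact_resolvent:
  assumes T: "selfadjoint T" and cr: "compact_resolvent T"
  obtains \<Psi> and l :: "vec \<Rightarrow> real" where "onb (\<lambda>x. x) \<Psi>" "T = diag_op (\<lambda>x. x) \<Psi> l"
proof -
  define A where "A = {\<Psi>. orthonormal (\<lambda>x. x) \<Psi> \<and> (\<forall>x\<in>\<Psi>. \<exists>k. (x, vscale (complex_of_real k) x) \<in> T)}"
  have "\<exists>M\<in>A. \<forall>X\<in>A. M \<subseteq> X \<longrightarrow> X = M"
  proof (rule subset_Zorn')
    fix C assume C: "subset.chain A C"
    have "\<exists>X\<in>C. x \<in> X \<and> y \<in> X" if "x \<in> \<Union>C" "y \<in> \<Union>C" for x y
      using C that unfolding subset.chain_def by blast
    then show "\<Union>C \<in> A"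
      using C unfolding subset.chain_def A_def orthonormal_def by (auto 0 4 simp: subset_iff)
  qed
  then obtain \<Psi> where \<Psi>: "\<Psi> \<in> A" "\<And>X. X \<in> A \<Longrightarrow> \<Psi> \<subseteq> X \<Longrightarrow> X = \<Psi>" by blast
  have o: "orthonormal (\<lambda>x. x) \<Psi>" using \<Psi>(1) by (simp add: A_def)
  obtain l where l: "\<And>x. x \<in> \<Psi> \<Longrightarrow> (x, vscale (complex_of_real (l x)) x) \<in> T"
    using \<Psi>(1) unfolding A_def by (simp add: Ball_def) metis
  have "x0 = 0" if x0: "x0 \<in> hilb" "\<And>x. x \<in> \<Psi> \<Longrightarrow> ip x x0 = 0" for x0
  proof (rule ccontr)
    assume "x0 \<noteq> 0"
    from eigenvector_orthogonal[OF T cr o l x0(1) this x0(2)] obtain z k where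
      z: "vnorm z = 1" "(z, vscale (complex_of_real k) z) \<in> T" "\<And>x. x \<in> \<Psi> \<Longrightarrow> ip x z = 0" by blast
    have zh: "z \<in> hilb" using linear_op_hilb[OF selfadjoint_linear[OF T] z(2)] by blast
    have zz: "ip z z = 1" using ip_self[OF zh] z(1) by simp
    have zx: "ip z x = 0" if "x \<in> \<Psi>" for x using z(3)[OF that] cnj_ip[of x z] by simp
    have "z \<notin> \<Psi>" using z(3) zz by force
    moreover have "insert z \<Psi> \<in> A"
      using \<Psi>(1) z zh zz zx \<open>z \<notin> \<Psi>\<close> unfolding A_def orthonormal_def by auto
    ultimately show False using \<Psi>(2)[of "insert z \<Psi>"] by blast
  qed
  then have onb: "onb (\<lambda>x. x) \<Psi>" using o by (simp add: onb_def)
  show ?thesis by (rule that[OF onb selfadjoint_eq_diag_op[OF onb T l]])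
qed

section \<open>Band matrices\<close>

text \<open>The Dirac operator is this exchange of the two summands followed by multiplication by
  scalar weights.\<close>

fun flip :: "label \<Rightarrow> label" where
  "flip (Plus, l, m) = (Minus, l, m)"
| "flip (Minus, l, m) = (Plus, l, m)"

lemma flip_flip [simp]: "flip (flip i) = i"
  by (cases i rule: flip.cases) auto

lemma flip_labels [simp]: "flip i \<in> labels \<longleftrightarrow> i \<in> labels"
  by (cases i rule: flip.cases) (auto simp: labels_def)

lemma bij_flip: "bij_betw flip labels labels"
  by (rule bij_betwI[where g = flip]) auto

definition nbr :: "label \<Rightarrow> label set" where
  "nbr i = {Plus, Minus} \<times> {fst (snd i) - 1, fst (snd i), fst (snd i) + 1}
     \<times> {snd (snd i) - 1, snd (snd i), snd (snd i) + 1}"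

lemma finite_nbr [simp]: "finite (nbr i)"
  by (simp add: nbr_def)

lemma card_nbr: "card (nbr i) \<le> 18"
proof -
  have c: "card {x - 1, x, x + 1 :: real} \<le> 3" for x
    by (rule order_trans[OF card_insert_le_m1]) (auto intro!: card_insert_le_m1)
  have "card (nbr i) \<le> 2 * (3 * 3)"
    unfolding nbr_def card_cartesian_product by (intro mult_mono c) auto
  then show ?thesis by simp
qed

lemma nbr_iff: "(s', l', m') \<in> nbr (s, l, m) \<longleftrightarrow> l' \<in> {l - 1, l, l + 1} \<and> m' \<in> {m - 1, m, m + 1}"
  by (cases s') (auto simp: nbr_def)

lemma nbr_sym: "i \<in> nbr j \<longleftrightarrow> j \<in> nbr i"
  by (cases i; cases j) (auto simp: nbr_iff)

lemma nbr_flip [simp]: "nbr (flip i) = nbr i" "flip j \<in> nbr i \<longleftrightarrow> j \<in> nbr i"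
  by (cases i rule: flip.cases; simp add: nbr_def)
    (cases j rule: flip.cases; auto simp: nbr_def)

lemma bij_flip_nbr: "bij_betw flip (nbr i) (nbr i)"
  by (rule bij_betwI[where g = flip]) auto

type_synonym matrix = "label \<Rightarrow> label \<Rightarrow> complex"

definition banded :: "matrix \<Rightarrow> real \<Rightarrow> bool" where
  "banded M C \<longleftrightarrow> 0 \<le> C \<and> (\<forall>i j. M i j \<noteq> 0 \<longrightarrow> i \<in> labels \<and> j \<in> labels \<and> j \<in> nbr i)
     \<and> (\<forall>i j. cmod (M i j) \<le> C)"

definition mat_apply :: "matrix \<Rightarrow> vec \<Rightarrow> vec" where
  "mat_apply M x = (\<lambda>i. \<Sum>j\<in>nbr i. M i j * x j)"

definition conj_transpose :: "matrix \<Rightarrow> matrix" where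
  "conj_transpose M i j = cnj (M j i)"

lemma bandedD:
  assumes "banded M C"
  shows "0 \<le> C" "M i j \<noteq> 0 \<Longrightarrow> i \<in> labels" "M i j \<noteq> 0 \<Longrightarrow> j \<in> labels" "M i j \<noteq> 0 \<Longrightarrow> j \<in> nbr i"
    "cmod (M i j) \<le> C"
  using assms unfolding banded_def by blast+

lemma banded_conj_transpose: "banded M C \<Longrightarrow> banded (conj_transpose M) C"
  unfolding banded_def conj_transpose_def complex_cnj_zero_iff complex_mod_cnj using nbr_sym by blast

text \<open>A Schur test: each row and each column has at most 18 nonzero entries of size at most
  \<open>C\<close>. Cauchy-Schwarz in the rows and the count of columns each contribute a factor 18
  to the squared norm.\<close>

lemma mat_apply_bounded:
  assumes M: "banded M C" and x: "x \<in> hilb"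
  shows "mat_apply M x \<in> hilb" "vnorm (mat_apply M x) \<le> 18 * C * vnorm x"
proof -
  note C = bandedD(1)[OF M]
  have out: "mat_apply M x i = 0" if "i \<notin> labels" for i
    unfolding mat_apply_def using bandedD(2)[OF M] that by (intro sum.neutral ballI) (metis mult_zero_left)
  have le: "(\<Sum>i\<in>F. (cmod (mat_apply M x i))\<^sup>2) \<le> (18 * C * vnorm x)\<^sup>2"
    if F: "finite F" for F
  proof -
    let ?G = "\<Union>i\<in>F. nbr i"
    have fG: "finite ?G" using F by simp
    have each: "(cmod (mat_apply M x i))\<^sup>2 \<le> 18 * C\<^sup>2 * (\<Sum>j\<in>nbr i. (cmod (x j))\<^sup>2)" for i
    proof -
      have "cmod (mat_apply M x i) \<le> (\<Sum>j\<in>nbr i. C * cmod (x j))"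
        unfolding mat_apply_def
        by (rule order_trans[OF norm_sum sum_mono])
          (auto simp: norm_mult intro!: mult_right_mono bandedD(5)[OF M])
      then have "(cmod (mat_apply M x i))\<^sup>2 \<le> (\<Sum>j\<in>nbr i. C * cmod (x j))\<^sup>2"
        by (intro power_mono) auto
      also have "\<dots> \<le> (\<Sum>j\<in>nbr i. (C * cmod (x j))\<^sup>2) * real (card (nbr i))"
        by (rule sum_squared_le_sum_of_squares)
      also have "\<dots> \<le> (\<Sum>j\<in>nbr i. (C * cmod (x j))\<^sup>2) * 18"
        using card_nbr[of i] by (intro mult_left_mono sum_nonneg) auto
      finally show ?thesis by (simp add: power_mult_distrib sum_distrib_left[symmetric] mult.assoc mult.left_commute mult.commute)
    qed
    have "(\<Sum>i\<in>F. \<Sum>j\<in>nbr i. (cmod (x j))\<^sup>2) = (\<Sum>i\<in>F. \<Sum>j\<in>?G. if j \<in> nbr i then (cmod (x j))\<^sup>2 else 0)"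
    proof (rule sum.cong[OF refl])
      fix i assume "i \<in> F"
      then have "?G \<inter> {j. j \<in> nbr i} = nbr i" by auto
      then show "(\<Sum>j\<in>nbr i. (cmod (x j))\<^sup>2) = (\<Sum>j\<in>?G. if j \<in> nbr i then (cmod (x j))\<^sup>2 else 0)"
        using sum.inter_restrict[OF fG, of "\<lambda>j. (cmod (x j))\<^sup>2" "nbr i"] by (simp add: Int_def)
    qed
    also have "\<dots> = (\<Sum>j\<in>?G. \<Sum>i\<in>F. if j \<in> nbr i then (cmod (x j))\<^sup>2 else 0)"
      by (rule sum.swap)
    also have "\<dots> \<le> (\<Sum>j\<in>?G. 18 * (cmod (x j))\<^sup>2)"
    proof (rule sum_mono)
      fix j
      have "(\<Sum>i\<in>F. if j \<in> nbr i then (cmod (x j))\<^sup>2 else 0) = (\<Sum>i\<in>F \<inter> nbr j. (cmod (x j))\<^sup>2)"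
        by (subst sum.inter_restrict[OF F]) (simp only: nbr_sym[of j])
      also have "\<dots> = real (card (F \<inter> nbr j)) * (cmod (x j))\<^sup>2" by simp
      also have "\<dots> \<le> 18 * (cmod (x j))\<^sup>2"
      proof (rule mult_right_mono)
        have "card (F \<inter> nbr j) \<le> card (nbr j)" by (intro card_mono) auto
        then show "real (card (F \<inter> nbr j)) \<le> 18" using card_nbr[of j] by linarith
      qed simp
      finally show "(\<Sum>i\<in>F. if j \<in> nbr i then (cmod (x j))\<^sup>2 else 0) \<le> 18 * (cmod (x j))\<^sup>2" .
    qed
    also have "\<dots> = 18 * (\<Sum>j\<in>?G \<inter> labels. (cmod (x j))\<^sup>2)"
      unfolding sum_distrib_left[symmetric]
      using fG hilb_outside[OF x] by (intro arg_cong[where f = "\<lambda>t. 18 * t"] sum.mono_neutral_right) auto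
    also have "\<dots> \<le> 18 * (vnorm x)\<^sup>2" using sum_le_vnorm[OF x, of "?G \<inter> labels"] fG by simp
    finally have "(\<Sum>i\<in>F. \<Sum>j\<in>nbr i. (cmod (x j))\<^sup>2) \<le> 18 * (vnorm x)\<^sup>2" .
    then have "18 * C\<^sup>2 * (\<Sum>i\<in>F. \<Sum>j\<in>nbr i. (cmod (x j))\<^sup>2) \<le> 18 * C\<^sup>2 * (18 * (vnorm x)\<^sup>2)"
      by (intro mult_left_mono) auto
    moreover have "(\<Sum>i\<in>F. (cmod (mat_apply M x i))\<^sup>2) \<le> 18 * C\<^sup>2 * (\<Sum>i\<in>F. \<Sum>j\<in>nbr i. (cmod (x j))\<^sup>2)"
      unfolding sum_distrib_left by (rule sum_mono) (use each in \<open>simp add: sum_distrib_left\<close>)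
    ultimately show ?thesis by (simp add: power_mult_distrib)
  qed
  show "mat_apply M x \<in> hilb" "vnorm (mat_apply M x) \<le> 18 * C * vnorm x"
    by (rule hilb_boundI[where C = "18 * C * vnorm x"], use out C le in auto)+
qed

lemma mat_apply_add: "mat_apply M (x + y) = mat_apply M x + mat_apply M y"
  and mat_apply_scale: "mat_apply M (vscale c x) = vscale c (mat_apply M x)"
  by (auto simp: mat_apply_def fun_eq_iff sum.distrib algebra_simps sum_distrib_left)

lemma finite_truncation:
  assumes x: "x \<in> hilb" and e: "0 < e"
  obtains F where "finite F" "F \<subseteq> labels" "vnorm (x - (\<Sum>j\<in>F. vscale (x j) (ket j))) < e"
proof -
  have "((\<lambda>j. (cmod (ip (ket j) x))\<^sup>2) has_sum (vnorm x)\<^sup>2) labels" by (rule onb_parseval[OF onb_ket x])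
  then have hs: "((\<lambda>j. (cmod (x j))\<^sup>2) has_sum (vnorm x)\<^sup>2) labels" by (simp add: ip_ket cong: has_sum_cong)
  have e2: "0 < e\<^sup>2 / 2" using e by simp
  from has_sum_finite_approximation[OF hs e2] obtain F where F: "finite F" "F \<subseteq> labels"
    "dist (\<Sum>j\<in>F. (cmod (x j))\<^sup>2) ((vnorm x)\<^sup>2) \<le> e\<^sup>2 / 2" by (elim exE conjE)
  define p where "p = (\<Sum>j\<in>F. vscale (x j) (ket j))"
  note p = orthonormal_finite_sum[OF onb_orthonormal[OF onb_ket] F(1,2), where c = x, folded p_def]
  have "ip p x = (\<Sum>j\<in>F. ip (vscale (x j) (ket j)) x)"
    unfolding p_def by (intro ip_sum_left x) auto
  also have "\<dots> = (\<Sum>j\<in>F. complex_of_real ((cmod (x j))\<^sup>2))"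
    unfolding complex_norm_square using F by (intro sum.cong) (auto simp: ip_scale_left ip_ket mult.commute)
  also have "\<dots> = ip p p" using p(3) ip_self[OF p(1)] by simp
  finally have "ip p (x - p) = 0" using p(1) x by (simp add: ip_diff_right)
  then have "(vnorm x)\<^sup>2 = (vnorm p)\<^sup>2 + (vnorm (x - p))\<^sup>2"
    using vnorm_power2_add[of p "x - p"] p(1) x by simp
  then have "(vnorm (x - p))\<^sup>2 \<le> e\<^sup>2 / 2" using F(3) unfolding p(3)[symmetric] dist_real_def by linarith
  also have "\<dots> < e\<^sup>2" using e2 by linarith
  finally have "vnorm (x - p) < e" by (rule power2_less_imp_less) (use e in simp)
  then show ?thesis using that F unfolding p_def by blast
qed

text \<open>A bounded conjugate-linear functional vanishing on the basis vanishes by density of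
  finite combinations. Conjugate linearity matches the first argument of \<open>ip\<close>.\<close>

lemma conj_linear_zero:
  fixes L :: "vec \<Rightarrow> complex"
  assumes add: "\<And>u v. u \<in> hilb \<Longrightarrow> v \<in> hilb \<Longrightarrow> L (u + v) = L u + L v"
    and scale: "\<And>c u. L (vscale c u) = cnj c * L u"
    and ket: "\<And>j. j \<in> labels \<Longrightarrow> L (ket j) = 0"
    and bound: "\<And>u. u \<in> hilb \<Longrightarrow> cmod (L u) \<le> K * vnorm u"
    and x: "x \<in> hilb"
  shows "L x = 0"
proof -
  have "cmod (L x) \<le> 0"
  proof (rule field_le_epsilon)
    fix e :: real assume e: "0 < e"
    obtain F where F: "finite F" "F \<subseteq> labels" "vnorm (x - (\<Sum>j\<in>F. vscale (x j) (ket j))) < e / (\<bar>K\<bar> + 1)"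
      using finite_truncation[OF x, of "e / (\<bar>K\<bar> + 1)"] e by auto
    define p where "p = (\<Sum>j\<in>F. vscale (x j) (ket j))"
    have ph: "p \<in> hilb" unfolding p_def by (intro hilb_sum) auto
    have "L p = 0"
      unfolding p_def using F(1,2)
    proof (induction F)
      case empty
      show ?case using scale[of 0 0] by (simp only: sum.empty vscale_simps complex_cnj_zero mult_zero_left)
    next
      case (insert j F)
      have h: "(\<Sum>j\<in>F. vscale (x j) (ket j)) \<in> hilb" by (intro hilb_sum) auto
      have "L (vscale (x j) (ket j)) = 0" using insert.prems ket[of j] scale[of "x j" "ket j"] by auto
      moreover have "L (\<Sum>j\<in>F. vscale (x j) (ket j)) = 0"
        by (rule insert.IH) (use insert.prems in blast)
      ultimately show ?case
        by (simp only: sum.insert[OF insert.hyps] add[OF hilb_scale[OF hilb_ket] h] add_0_left)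
    qed
    then have "L x = L (x - p)" using add[of "x - p" p] x ph by simp
    also have "cmod \<dots> \<le> K * vnorm (x - p)" using bound x ph by blast
    also have "\<dots> \<le> \<bar>K\<bar> * (e / (\<bar>K\<bar> + 1))"
      using F(3) unfolding p_def by (intro mult_mono) auto
    also have "\<dots> \<le> 0 + e" using e by (simp add: field_simps)
    finally show "cmod (L x) \<le> 0 + e" .
  qed
  then show ?thesis by simp
qed

lemma ip_mat_apply:
  assumes M: "banded M C" and x: "x \<in> hilb" and y: "y \<in> hilb"
  shows "ip (mat_apply M x) y = ip x (mat_apply (conj_transpose M) y)"
proof -
  note M' = banded_conj_transpose[OF M]
  have approx: "ip (mat_apply M (ket j)) y = ip (ket j) (mat_apply (conj_transpose M) y)" if j: "j \<in> labels" for j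
  proof -
    have col: "mat_apply M (ket j) i = (if j \<in> nbr i then M i j else 0)" for i
      unfolding mat_apply_def using j by (subst sum.mono_neutral_cong_right[of "nbr i" "nbr i \<inter> {j}"]) (auto simp: ket_def)
    have "ip (mat_apply M (ket j)) y = (\<Sum>\<^sub>\<infinity>i\<in>nbr j. cnj (M i j) * y i)"
      unfolding ip_def col
    proof (rule infsum_cong_neutral)
      show "cnj (M i j) * y i = 0" if "i \<in> nbr j - labels" for i
        using that hilb_outside[OF y] by simp
      show "cnj (if j \<in> nbr i then M i j else 0) * y i = 0" if "i \<in> labels - nbr j" for i
        using that nbr_sym by auto
      show "cnj (if j \<in> nbr i then M i j else 0) * y i = cnj (M i j) * y i" if "i \<in> labels \<inter> nbr j" for i
        using that nbr_sym by auto
    qed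
    then show ?thesis using j by (simp add: ip_ket mat_apply_def conj_transpose_def)
  qed
  let ?L = "\<lambda>x. ip (mat_apply M x) y - ip x (mat_apply (conj_transpose M) y)"
  note Mh = mat_apply_bounded(1)[OF M] and z = mat_apply_bounded[OF M' y]
  have "?L x = 0"
  proof (rule conj_linear_zero[OF _ _ _ _ x])
    show "?L (u + v) = ?L u + ?L v" if "u \<in> hilb" "v \<in> hilb" for u v
      using that y z(1) Mh[OF that(1)] Mh[OF that(2)] by (simp add: mat_apply_add ip_add_left)
    show "?L (vscale c u) = cnj c * ?L u" for c u
      by (simp add: mat_apply_scale ip_scale_left algebra_simps)
    show "?L (ket j) = 0" if "j \<in> labels" for j using approx[OF that] by simp
    fix u assume u: "u \<in> hilb"
    have "cmod (?L u) \<le> vnorm (mat_apply M u) * vnorm y + vnorm u * vnorm (mat_apply (conj_transpose M) y)"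
      by (rule order_trans[OF norm_triangle_ineq4 add_mono]) (intro cauchy_schwarz Mh u y z(1))+
    also have "\<dots> \<le> (18 * C * vnorm u) * vnorm y + vnorm u * (18 * C * vnorm y)"
      by (intro add_mono mult_left_mono mult_right_mono mat_apply_bounded(2)[OF M u] z(2)) simp_all
    also have "\<dots> = (36 * C * vnorm y) * vnorm u" by simp
    finally show "cmod (?L u) \<le> (36 * C * vnorm y) * vnorm u" .
  qed
  then show ?thesis by simp
qed

section \<open>The Dirac operator\<close>

lemma hilb_vnorm_cong:
  assumes "\<And>i. i \<in> labels \<Longrightarrow> cmod (x i) = cmod (y i)"
    and "\<And>i. i \<notin> labels \<Longrightarrow> x i = 0" "\<And>i. i \<notin> labels \<Longrightarrow> y i = 0"
  shows "x \<in> hilb \<longleftrightarrow> y \<in> hilb" "vnorm x = vnorm y"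
proof -
  have "(\<lambda>i. (cmod (x i))\<^sup>2) summable_on labels \<longleftrightarrow> (\<lambda>i. (cmod (y i))\<^sup>2) summable_on labels"
    using assms(1) by (intro summable_on_cong) simp
  then show "x \<in> hilb \<longleftrightarrow> y \<in> hilb" using assms(2,3) unfolding hilb_def by blast
  show "vnorm x = vnorm y" unfolding vnorm_def using assms(1) by (metis (mono_tags, lifting) infsum_cong)
qed

lemma hilb_flip:
  "(\<lambda>i. x (flip i)) \<in> hilb \<longleftrightarrow> x \<in> hilb" "vnorm (\<lambda>i. x (flip i)) = vnorm x"
proof -
  have "(\<lambda>i. (cmod (x (flip i)))\<^sup>2) summable_on labels \<longleftrightarrow> (\<lambda>i. (cmod (x i))\<^sup>2) summable_on labels"
    by (rule summable_on_reindex_bij_betw[OF bij_flip])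
  moreover have "(\<forall>i. i \<notin> labels \<longrightarrow> x (flip i) = 0) \<longleftrightarrow> (\<forall>i. i \<notin> labels \<longrightarrow> x i = 0)"
    by (metis flip_flip flip_labels)
  ultimately show "(\<lambda>i. x (flip i)) \<in> hilb \<longleftrightarrow> x \<in> hilb" unfolding hilb_def by blast
  show "vnorm (\<lambda>i. x (flip i)) = vnorm x"
    unfolding vnorm_def using infsum_reindex_bij_betw[OF bij_flip, of "\<lambda>i. (cmod (x i))\<^sup>2"] by simp
qed

definition bounded_fun :: "(vec \<Rightarrow> vec) \<Rightarrow> bool" where
  "bounded_fun B \<longleftrightarrow> (\<forall>x\<in>hilb. B x \<in> hilb) \<and> (\<forall>x\<in>hilb. \<forall>y\<in>hilb. B (x + y) = B x + B y)
     \<and> (\<forall>x\<in>hilb. \<forall>c. B (vscale c x) = vscale c (B x)) \<and> (\<exists>K. \<forall>x\<in>hilb. vnorm (B x) \<le> K * vnorm x)"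

definition graph_op :: "(vec \<Rightarrow> vec) \<Rightarrow> oper" where
  "graph_op B = {(x, B x) | x. x \<in> hilb}"

lemma bounded_funD:
  assumes "bounded_fun B"
  shows "x \<in> hilb \<Longrightarrow> B x \<in> hilb" "x \<in> hilb \<Longrightarrow> y \<in> hilb \<Longrightarrow> B (x + y) = B x + B y"
    "x \<in> hilb \<Longrightarrow> B (vscale c x) = vscale c (B x)"
    "x \<in> hilb \<Longrightarrow> y \<in> hilb \<Longrightarrow> B (x - y) = B x - B y"
proof -
  show 1: "B x \<in> hilb" if "x \<in> hilb" for x using assms that unfolding bounded_fun_def by blast
  show 2: "B (x + y) = B x + B y" if "x \<in> hilb" "y \<in> hilb" for x y
    using assms that unfolding bounded_fun_def by blast
  show 3: "B (vscale c x) = vscale c (B x)" if "x \<in> hilb" for x c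
    using assms that unfolding bounded_fun_def by blast
  show "B (x - y) = B x - B y" if "x \<in> hilb" "y \<in> hilb" for x y
    unfolding diff_eq_add_vscale using that by (simp only: 2 3 hilb_scale)
qed

lemma bounded_fun_bound:
  assumes "bounded_fun B"
  obtains K where "0 < K" "\<And>x. x \<in> hilb \<Longrightarrow> vnorm (B x) \<le> K * vnorm x"
proof -
  obtain K where K: "\<And>x. x \<in> hilb \<Longrightarrow> vnorm (B x) \<le> K * vnorm x"
    using assms unfolding bounded_fun_def by blast
  have "vnorm (B x) \<le> (\<bar>K\<bar> + 1) * vnorm x" if "x \<in> hilb" for x
    by (rule order_trans[OF K[OF that] mult_right_mono]) auto
  then show ?thesis using that[of "\<bar>K\<bar> + 1"] by simp
qed

lemma bounded_funI:
  assumes "\<And>x. x \<in> hilb \<Longrightarrow> B x \<in> hilb" "\<And>x y. x \<in> hilb \<Longrightarrow> y \<in> hilb \<Longrightarrow> B (x + y) = B x + B y"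
    "\<And>x c. x \<in> hilb \<Longrightarrow> B (vscale c x) = vscale c (B x)" "\<And>x. x \<in> hilb \<Longrightarrow> vnorm (B x) \<le> K * vnorm x"
  shows "bounded_fun B"
  using assms unfolding bounded_fun_def by blast

lemma bounded_fun_add:
  assumes "bounded_fun B" "bounded_fun B'" shows "bounded_fun (\<lambda>x. B x + B' x)"
proof -
  obtain K where K: "0 < K" "\<And>x. x \<in> hilb \<Longrightarrow> vnorm (B x) \<le> K * vnorm x" using bounded_fun_bound[OF assms(1)] by blast
  obtain K' where K': "0 < K'" "\<And>x. x \<in> hilb \<Longrightarrow> vnorm (B' x) \<le> K' * vnorm x" using bounded_fun_bound[OF assms(2)] by blast
  note B = bounded_funD[OF assms(1)] and B' = bounded_funD[OF assms(2)]
  show ?thesis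
  proof (rule bounded_funI[where K = "K + K'"])
    fix x assume x: "x \<in> hilb"
    show "B x + B' x \<in> hilb" using B(1)[OF x] B'(1)[OF x] by blast
    show "vnorm (B x + B' x) \<le> (K + K') * vnorm x"
      using vnorm_triangle[OF B(1)[OF x] B'(1)[OF x]] K(2)[OF x] K'(2)[OF x] by (simp add: distrib_right)
    show "B (vscale c x) + B' (vscale c x) = vscale c (B x + B' x)" for c
      by (simp only: B(3)[OF x] B'(3)[OF x] vscale_add)
  qed (simp only: B(2) B'(2) ac_simps)
qed

lemma bounded_fun_scale:
  assumes "bounded_fun B" shows "bounded_fun (\<lambda>x. vscale c (B x))"
proof -
  obtain K where K: "0 < K" "\<And>x. x \<in> hilb \<Longrightarrow> vnorm (B x) \<le> K * vnorm x" using bounded_fun_bound[OF assms] by blast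
  note B = bounded_funD[OF assms]
  show ?thesis
  proof (rule bounded_funI[where K = "cmod c * K"])
    fix x assume x: "x \<in> hilb"
    show "vscale c (B x) \<in> hilb" using B(1)[OF x] by blast
    show "vnorm (vscale c (B x)) \<le> cmod c * K * vnorm x"
      using K(2)[OF x] by (simp add: vnorm_scale mult_left_mono mult.assoc)
    show "vscale c (B (vscale d x)) = vscale d (vscale c (B x))" for d
      by (simp only: B(3)[OF x] vscale_simps mult.commute)
  qed (simp only: B(2) vscale_add)
qed

lemma bounded_fun_comp:
  assumes "bounded_fun B" "bounded_fun B'" shows "bounded_fun (\<lambda>x. B (B' x))"
proof -
  obtain K where K: "0 < K" "\<And>x. x \<in> hilb \<Longrightarrow> vnorm (B x) \<le> K * vnorm x" using bounded_fun_bound[OF assms(1)] by blast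
  obtain K' where K': "0 < K'" "\<And>x. x \<in> hilb \<Longrightarrow> vnorm (B' x) \<le> K' * vnorm x" using bounded_fun_bound[OF assms(2)] by blast
  note B = bounded_funD[OF assms(1)] and B' = bounded_funD[OF assms(2)]
  show ?thesis
  proof (rule bounded_funI[where K = "K * K'"])
    fix x assume x: "x \<in> hilb"
    show "B (B' x) \<in> hilb" by (rule B(1)[OF B'(1)[OF x]])
    have "K * vnorm (B' x) \<le> K * (K' * vnorm x)" using K(1) K'(2)[OF x] by (intro mult_left_mono) auto
    then show "vnorm (B (B' x)) \<le> K * K' * vnorm x"
      using K(2)[OF B'(1)[OF x]] by (simp add: mult.assoc)
    show "B (B' (vscale c x)) = vscale c (B (B' x))" for c
      by (simp only: B'(3)[OF x] B(3)[OF B'(1)[OF x]])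
  qed (simp only: B'(2) B(2) B'(1))
qed

lemma bounded_fun_zero: "bounded_fun (\<lambda>x. 0)"
  by (rule bounded_funI[where K = 0]) (simp_all only: hilb_zero vscale_simps vnorm_zero mult_zero_left add_0_left order_refl)

lemma bounded_fun_id: "bounded_fun (\<lambda>x. x)"
  by (rule bounded_funI[where K = 1]) simp_all

lemma bounded_fun_mat: "banded M C \<Longrightarrow> bounded_fun (mat_apply M)"
  by (rule bounded_funI[where K = "18 * C"])
    (simp_all add: mat_apply_bounded mat_apply_add mat_apply_scale)

lemma graph_op_add: "op_add (graph_op B) (graph_op B') = graph_op (\<lambda>x. B x + B' x)"
  unfolding op_add_def graph_op_def by blast

lemma graph_op_scale: "op_scale c (graph_op B) = graph_op (\<lambda>x. vscale c (B x))"
  unfolding op_scale_def graph_op_def by blast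

lemma graph_op_mult: "bounded_fun B' \<Longrightarrow> op_mult (graph_op B) (graph_op B') = graph_op (\<lambda>x. B (B' x))"
  unfolding op_mult_def graph_op_def using bounded_funD(1) by blast

lemma graph_op_id: "op_id = graph_op (\<lambda>x. x)"
  unfolding op_id_def graph_op_def by blast

locale podles =
  fixes q :: real and w :: complex
  assumes q: "0 < q" "q < 1" and w: "w \<noteq> 0"
begin

definition qc :: real where "qc = 1 / (inverse q - q)"

lemma inverse_gt: "q < inverse q"
  using q by (metis inverse_le_1_iff inverse_positive_iff_positive less_imp_le less_le_trans linorder_not_le one_le_inverse order_less_le_trans)

lemma qc_pos: "0 < qc"
  using inverse_gt by (simp add: qc_def)

lemma qnum_le: "qnum q x \<le> qc * q powr (- x)"
  unfolding qnum_def qc_def using inverse_gt q by (simp add: divide_right_mono)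

text \<open>Since x >= 1 gives q^x <= q^(2 - x), the numerator is at least q^(1 - x) (q^(-1) - q).
  With \<open>qnum_le\<close> this shows that the q-number grows like q^(-x).\<close>

lemma qnum_ge:
  assumes "1 \<le> x" shows "q powr (1 - x) \<le> qnum q x"
proof -
  have "q powr x \<le> q powr (2 - x)" using assms q by (intro powr_mono') auto
  also have "q powr (2 - x) = q * q powr (1 - x)" using q by (simp add: powr_diff power2_eq_square powr_realpow)
  finally have "q powr (1 - x) * (inverse q - q) \<le> inverse q * q powr (1 - x) - q powr x"
    by (simp add: algebra_simps)
  also have "inverse q * q powr (1 - x) = q powr (- x)" using q by (simp add: powr_diff powr_minus field_simps)
  finally show ?thesis unfolding qnum_def using inverse_gt by (simp add: pos_le_divide_eq)
qed

lemma qnum_ge_one: "1 \<le> x \<Longrightarrow> 1 \<le> qnum q x"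
  using qnum_ge[of x] powr_mono'[of "1 - x" 0 q] q by simp

lemma qnum_nonneg: "0 \<le> x \<Longrightarrow> 0 \<le> qnum q x"
  unfolding qnum_def using inverse_gt q by (intro divide_nonneg_pos) (auto intro!: powr_mono')

lemma labels_bounds:
  assumes "(s, l, m) \<in> labels" shows "1/2 \<le> l" "- l \<le> m" "m \<le> l"
  using assms by (auto simp: labels_def)

fun dcoeff :: "label \<Rightarrow> complex" where
  "dcoeff (Plus, l, m) = cnj w * complex_of_real (qnum q (l + 1/2))"
| "dcoeff (Minus, l, m) = w * complex_of_real (qnum q (l + 1/2))"

text \<open>The eigenvalue of the modulus of the Dirac operator at the given basis vector.\<close>

definition wt :: "label \<Rightarrow> real" where
  "wt i = cmod w * qnum q (fst (snd i) + 1/2)"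

lemma dirac_coeffs_eq: "dirac_coeffs q w x i = dcoeff i * x (flip i)"
  by (cases i rule: flip.cases) auto

lemma cnj_dcoeff_flip: "cnj (dcoeff (flip i)) = dcoeff i"
  by (cases i rule: flip.cases) auto

lemma wt_flip [simp]: "wt (flip i) = wt i"
  by (cases i rule: flip.cases) (auto simp: wt_def)

lemma dcoeff_mult: "dcoeff i * dcoeff (flip i) = complex_of_real ((wt i)\<^sup>2)"
proof -
  have "w * cnj w = complex_of_real ((cmod w)\<^sup>2)" by (simp only: complex_norm_square)
  then have "complex_of_real ((wt i)\<^sup>2) = w * cnj w * complex_of_real ((qnum q (fst (snd i) + 1/2))\<^sup>2)"
    by (simp only: wt_def power_mult_distrib of_real_mult)
  then show ?thesis by (cases i rule: flip.cases) (simp_all add: power2_eq_square algebra_simps)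
qed

lemma wt_pos: "i \<in> labels \<Longrightarrow> 0 < wt i"
proof (cases i)
  fix s l m assume *: "i \<in> labels" "i = (s, l, m)"
  then have "1 \<le> qnum q (l + 1/2)" using labels_bounds(1)[of s l m] by (intro qnum_ge_one) simp
  then show "0 < wt i" using w *(2) by (simp add: wt_def)
qed

lemma cmod_dcoeff: "i \<in> labels \<Longrightarrow> cmod (dcoeff i) = wt i"
proof (cases i rule: flip.cases)
  case (1 l m)
  moreover assume "i \<in> labels"
  ultimately have "0 \<le> qnum q (l + 1/2)" using labels_bounds(1)[of Plus l m] by (intro qnum_nonneg) simp
  then show ?thesis using 1 by (simp add: wt_def norm_mult)
next
  case (2 l m)
  moreover assume "i \<in> labels"
  ultimately have "0 \<le> qnum q (l + 1/2)" using labels_bounds(1)[of Minus l m] by (intro qnum_nonneg) simp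
  then show ?thesis using 2 by (simp add: wt_def norm_mult)
qed

definition wmul :: "vec \<Rightarrow> vec" where
  "wmul x = (\<lambda>i. complex_of_real (wt i) * x i)"

definition domD :: "vec set" where
  "domD = {x \<in> hilb. wmul x \<in> hilb}"

lemma dirac_coeffs_hilb:
  assumes "x \<in> hilb"
  shows "dirac_coeffs q w x \<in> hilb \<longleftrightarrow> wmul x \<in> hilb" "vnorm (dirac_coeffs q w x) = vnorm (wmul x)"
proof -
  note x0 = hilb_outside[OF assms]
  have *: "cmod (dirac_coeffs q w x i) = cmod (wmul x (flip i))" if "i \<in> labels" for i
    using that by (simp add: dirac_coeffs_eq norm_mult cmod_dcoeff wmul_def wt_pos less_imp_le)
  have 0: "dirac_coeffs q w x i = 0" "wmul x (flip i) = 0" if "i \<notin> labels" for i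
    using that x0[of "flip i"] by (simp_all add: dirac_coeffs_eq wmul_def)
  show "dirac_coeffs q w x \<in> hilb \<longleftrightarrow> wmul x \<in> hilb" "vnorm (dirac_coeffs q w x) = vnorm (wmul x)"
    using hilb_vnorm_cong[OF * 0] hilb_flip[of "wmul x"] by simp_all
qed

lemma dirac_iff: "(x, y) \<in> dirac q w \<longleftrightarrow> x \<in> domD \<and> y = dirac_coeffs q w x"
  unfolding dirac_def domD_def using dirac_coeffs_hilb(1) by auto

lemma domD_hilb: "x \<in> domD \<Longrightarrow> x \<in> hilb" and domD_wmul: "x \<in> domD \<Longrightarrow> wmul x \<in> hilb"
  by (simp_all add: domD_def)

lemma dirac_coeffs_domD: "x \<in> domD \<Longrightarrow> dirac_coeffs q w x \<in> hilb"
  using dirac_coeffs_hilb(1)[OF domD_hilb] domD_wmul by blast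

lemma domD_add: "x \<in> domD \<Longrightarrow> y \<in> domD \<Longrightarrow> x + y \<in> domD"
  and domD_scale: "x \<in> domD \<Longrightarrow> vscale c x \<in> domD"
proof -
  have "wmul (x + y) = wmul x + wmul y" "wmul (vscale c x) = vscale c (wmul x)"
    by (auto simp: wmul_def fun_eq_iff algebra_simps)
  then show "x \<in> domD \<Longrightarrow> y \<in> domD \<Longrightarrow> x + y \<in> domD" "x \<in> domD \<Longrightarrow> vscale c x \<in> domD"
    unfolding domD_def by auto
qed

lemma domD_zero: "0 \<in> domD"
proof -
  have "wmul 0 = 0" by (simp add: wmul_def fun_eq_iff)
  then show ?thesis by (simp add: domD_def)
qed

lemma domD_ket: "ket i \<in> domD"
proof -
  have "wmul (ket i) = vscale (complex_of_real (wt i)) (ket i)"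
    by (auto simp: wmul_def ket_def fun_eq_iff)
  then show ?thesis by (auto simp: domD_def)
qed

lemma domD_sum: "(\<And>i. i \<in> I \<Longrightarrow> f i \<in> domD) \<Longrightarrow> sum f I \<in> domD"
proof (induction I rule: infinite_finite_induct)
  case (insert i I)
  then show ?case by (simp only: sum.insert[OF insert.hyps]) (intro domD_add insert.IH insert.prems insertI1 insertI2)
next
  case (infinite I)
  show ?case by (simp only: sum.infinite[OF infinite(1)] domD_zero)
qed (simp only: sum.empty domD_zero)

lemma domD_dense:
  assumes "x \<in> hilb" "0 < e" obtains u where "u \<in> domD" "vnorm (x - u) < e"
proof -
  obtain F where "vnorm (x - (\<Sum>j\<in>F. vscale (x j) (ket j))) < e" using finite_truncation[OF assms] by blast
  then show ?thesis by (rule that[rotated]) (intro domD_sum domD_scale domD_ket)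
qed

lemma dirac_coeffs_add: "dirac_coeffs q w (x + y) = dirac_coeffs q w x + dirac_coeffs q w y"
  and dirac_coeffs_scale: "dirac_coeffs q w (vscale c x) = vscale c (dirac_coeffs q w x)"
  and dirac_coeffs_zero: "dirac_coeffs q w 0 = 0"
  by (rule ext, simp add: dirac_coeffs_eq algebra_simps)+

text \<open>Reindexing by \<open>flip\<close> is an identity between infinite sums whether or not
  they converge. It is therefore available for vectors outside the domain, as the computation of the
  adjoint requires.\<close>

lemma ip_dirac_coeffs: "ip u (dirac_coeffs q w x) = ip (dirac_coeffs q w u) x"
proof -
  have "ip u (dirac_coeffs q w x) = (\<Sum>\<^sub>\<infinity>i\<in>labels. cnj (dirac_coeffs q w u (flip i)) * x (flip i))"
    unfolding ip_def dirac_coeffs_eq by (rule infsum_cong) (simp add: cnj_dcoeff_flip)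
  also have "\<dots> = ip (dirac_coeffs q w u) x"
    unfolding ip_def by (rule infsum_reindex_bij_betw[OF bij_flip])
  finally show ?thesis .
qed

lemma dirac_selfadjoint: "selfadjoint (dirac q w)"
proof -
  have "linear_op (dirac q w)"
    unfolding linear_op_def single_valued_def
    using domD_hilb domD_add domD_scale domD_zero dirac_coeffs_hilb(1) domD_wmul
    by (auto simp: dirac_iff dirac_coeffs_add dirac_coeffs_scale dirac_coeffs_zero)
  moreover have "adjoint (dirac q w) = dirac q w"
  proof
    show "dirac q w \<subseteq> adjoint (dirac q w)"
    proof
      fix p assume p: "p \<in> dirac q w"
      then obtain x where x: "p = (x, dirac_coeffs q w x)" "x \<in> domD" by (cases p) (auto simp: dirac_iff)
      have "ip u (dirac_coeffs q w x) = ip v x" if "(u, v) \<in> dirac q w" for u v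
        using that unfolding dirac_iff by (simp only: ip_dirac_coeffs)
      then show "p \<in> adjoint (dirac q w)"
        unfolding x(1) adjoint_def using domD_hilb[OF x(2)] dirac_coeffs_domD[OF x(2)] by blast
    qed
    show "adjoint (dirac q w) \<subseteq> dirac q w"
    proof
      fix p assume p: "p \<in> adjoint (dirac q w)"
      obtain x y where xy: "p = (x, y)" by (cases p)
      have h: "x \<in> hilb" "y \<in> hilb" and a: "\<And>u v. (u, v) \<in> dirac q w \<Longrightarrow> ip u y = ip v x"
        using p unfolding xy adjoint_def by auto
      have "y i = dirac_coeffs q w x i" for i
      proof (cases "i \<in> labels")
        case True
        have "y i = ip (dirac_coeffs q w (ket i)) x"
          using a[of "ket i"] domD_ket by (simp add: dirac_iff ip_ket[OF True, symmetric])
        also have "\<dots> = ip (ket i) (dirac_coeffs q w x)" by (rule ip_dirac_coeffs[symmetric])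
        finally show ?thesis by (simp add: ip_ket[OF True])
      next
        case False
        then show ?thesis using hilb_outside[OF h(1), of "flip i"] hilb_outside[OF h(2), of i]
          by (simp add: dirac_coeffs_eq)
      qed
      then have "y = dirac_coeffs q w x" by (rule ext)
      then show "p \<in> dirac q w" unfolding xy using h by (simp add: dirac_def)
    qed
  qed
  ultimately show ?thesis by (simp add: selfadjoint_def)
qed

lemma dirac_square: "op_mult (dirac q w) (dirac q w) = diag_op ket labels (\<lambda>i. (wt i)\<^sup>2)"
proof -
  have sq: "dirac_coeffs q w (dirac_coeffs q w x) i = complex_of_real ((wt i)\<^sup>2) * x i" for x i
    using dcoeff_mult[of i] by (simp add: dirac_coeffs_eq mult.assoc[symmetric] del: of_real_power)
  show ?thesis
  proof
    show "op_mult (dirac q w) (dirac q w) \<subseteq> diag_op ket labels (\<lambda>i. (wt i)\<^sup>2)"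
    proof
      fix p assume "p \<in> op_mult (dirac q w) (dirac q w)"
      then obtain x where x: "p = (x, dirac_coeffs q w (dirac_coeffs q w x))" "x \<in> domD" "dirac_coeffs q w x \<in> domD"
        unfolding op_mult_def by (cases p) (auto simp: dirac_iff)
      show "p \<in> diag_op ket labels (\<lambda>i. (wt i)\<^sup>2)"
        unfolding x(1) using x(2,3) domD_hilb domD_wmul dirac_coeffs_hilb(1)
        by (intro diag_opI) (auto simp: ip_ket sq)
    qed
    show "diag_op ket labels (\<lambda>i. (wt i)\<^sup>2) \<subseteq> op_mult (dirac q w) (dirac q w)"
    proof
      fix p assume p: "p \<in> diag_op ket labels (\<lambda>i. (wt i)\<^sup>2)"
      obtain x y where xy: "p = (x, y)" by (cases p)
      note D = diag_opD[OF p[unfolded xy]]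
      have "p \<in> op_mult (diag_op ket labels wt) (diag_op ket labels wt)"
        unfolding diag_op_square[OF onb_ket] by (rule p)
      then obtain z where z: "(x, z) \<in> diag_op ket labels wt" "(z, y) \<in> diag_op ket labels wt"
        unfolding op_mult_def xy by blast
      have wmul: "wmul u = v" if uv: "(u, v) \<in> diag_op ket labels wt" for u v
      proof
        fix i show "wmul u i = v i"
          using diag_opD[OF uv] hilb_outside[of u i] hilb_outside[of v i]
          by (cases "i \<in> labels") (auto simp: wmul_def ip_ket)
      qed
      have xD: "x \<in> domD" and zD: "z \<in> domD"
        using wmul z diag_opD(1,2)[OF z(1)] diag_opD(1,2)[OF z(2)] by (auto simp: domD_def)
      have Dx: "dirac_coeffs q w x \<in> hilb" using xD dirac_coeffs_hilb(1)[of x] by (simp add: domD_def)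
      have "cmod (wmul (dirac_coeffs q w x) i) = cmod (wmul z (flip i))" if "i \<in> labels" for i
        using that wt_pos[OF that]
        by (simp add: wmul_def dirac_coeffs_eq norm_mult cmod_dcoeff wmul[OF z(1), symmetric])
      moreover have "wmul (dirac_coeffs q w x) i = 0" "wmul z (flip i) = 0" if "i \<notin> labels" for i
        using that hilb_outside[OF Dx] hilb_outside[OF domD_hilb[OF zD]] by (simp_all add: wmul_def)
      ultimately have "wmul (dirac_coeffs q w x) \<in> hilb"
        using hilb_vnorm_cong(1)[of "wmul (dirac_coeffs q w x)" "\<lambda>i. wmul z (flip i)"]
          hilb_flip(1)[of "wmul z"] domD_wmul[OF zD] by blast
      then have DxD: "dirac_coeffs q w x \<in> domD" using Dx by (simp add: domD_def)
      have "y = dirac_coeffs q w (dirac_coeffs q w x)"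
      proof
        fix i show "y i = dirac_coeffs q w (dirac_coeffs q w x) i"
          using D hilb_outside[of x i] hilb_outside[of y i] unfolding sq
          by (cases "i \<in> labels") (auto simp: ip_ket)
      qed
      with xD DxD show "p \<in> op_mult (dirac q w) (dirac q w)"
        unfolding op_mult_def xy by (auto simp: dirac_iff)
    qed
  qed
qed

end

section \<open>Bounded commutators\<close>

context podles
begin

text \<open>Neighbouring labels differ by at most 1 in \<open>l\<close>. The upper bound at
  \<open>l\<close> and the lower bound at \<open>l'\<close> match through q^(-(l' + 3/2)) = q^(-2)
  q^(1 - (l' + 1/2)).\<close>

lemma wt_nbr:
  assumes "i \<in> labels" "j \<in> labels" "j \<in> nbr i"
  shows "wt i \<le> qc * q powr (- 2) * wt j"
proof -
  obtain s l m s' l' m' where ij: "i = (s, l, m)" "j = (s', l', m')" by (cases i; cases j)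
  have l: "l \<le> l' + 1" "1/2 \<le> l'" using assms ij labels_bounds(1) by (auto simp: nbr_iff)
  have "qnum q (l + 1/2) \<le> qc * q powr (- (l + 1/2))" by (rule qnum_le)
  also have "\<dots> \<le> qc * q powr (- (l' + 3/2))"
    using l q qc_pos by (intro mult_left_mono powr_mono') auto
  also have "q powr (- (l' + 3/2)) = q powr (- 2) * q powr (1 - (l' + 1/2))"
  proof -
    have "- (l' + 3/2) = (- 2) + (1 - (l' + 1/2))" by simp
    then show ?thesis by (simp only: powr_add)
  qed
  also have "qc * (q powr (- 2) * q powr (1 - (l' + 1/2))) \<le> qc * (q powr (- 2) * qnum q (l' + 1/2))"
    using l qc_pos by (intro mult_left_mono qnum_ge) auto
  finally have "qnum q (l + 1/2) \<le> qc * (q powr (- 2) * qnum q (l' + 1/2))" .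
  from mult_left_mono[OF this norm_ge_zero[of w]] show ?thesis by (simp add: ij wt_def algebra_simps)
qed

text \<open>Conjugation by the weights: |D| M = M' |D| with
  \<open>M' i j = wt i / wt j * M i j\<close>, and the ratios are bounded along the band.\<close>

lemma mat_apply_domD:
  assumes M: "banded M C" and x: "x \<in> domD" shows "mat_apply M x \<in> domD"
proof -
  define M' where "M' = (\<lambda>i j. complex_of_real (wt i / wt j) * M i j)"
  let ?R = "qc * q powr (- 2)"
  have "0 \<le> ?R" using qc_pos by simp
  have M': "banded M' (?R * C)"
    unfolding banded_def
  proof (intro conjI allI impI)
    show "0 \<le> ?R * C" using \<open>0 \<le> ?R\<close> bandedD(1)[OF M] by simp
    fix i j
    show "i \<in> labels" "j \<in> labels" "j \<in> nbr i" if "M' i j \<noteq> 0"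
      using that bandedD(2-4)[OF M, of i j] unfolding M'_def by (metis mult_zero_right)+
    show "cmod (M' i j) \<le> ?R * C"
    proof (cases "M i j = 0")
      case True
      then show ?thesis using \<open>0 \<le> ?R * C\<close> by (simp add: M'_def)
    next
      case False
      note ij = bandedD(2-4)[OF M False]
      have "wt i / wt j \<le> ?R" using wt_nbr[OF ij] wt_pos[OF ij(2)] by (simp add: pos_divide_le_eq)
      moreover have "0 \<le> wt i / wt j" using wt_pos[OF ij(1)] wt_pos[OF ij(2)] by simp
      ultimately have "\<bar>wt i / wt j\<bar> * cmod (M i j) \<le> ?R * C"
        using bandedD(5)[OF M, of i j] by (intro mult_mono) auto
      then show ?thesis by (simp only: M'_def norm_mult norm_of_real)
    qed
  qed
  have "wmul (mat_apply M x) = mat_apply M' (wmul x)"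
  proof
    fix i
    have "complex_of_real (wt i) * (M i j * x j) = M' i j * wmul x j" for j
    proof (cases "M i j = 0")
      case False
      then show ?thesis using wt_pos[OF bandedD(3)[OF M False]] by (simp add: M'_def wmul_def)
    qed (simp add: M'_def)
    note eq = this
    have "wmul (mat_apply M x) i = (\<Sum>j\<in>nbr i. complex_of_real (wt i) * (M i j * x j))"
      by (simp only: wmul_def mat_apply_def sum_distrib_left)
    then show "wmul (mat_apply M x) i = mat_apply M' (wmul x) i"
      by (simp only: mat_apply_def eq)
  qed
  then show ?thesis
    using mat_apply_bounded(1)[OF M domD_hilb[OF x]] mat_apply_bounded(1)[OF M' domD_wmul[OF x]]
    by (simp add: domD_def)
qed

text \<open>The matrix of the commutator of the Dirac operator with \<open>M\<close>: multiplication
  by the Dirac operator from the left flips the row label, from the right the column label.\<close>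

definition mat_comm :: "matrix \<Rightarrow> matrix" where
  "mat_comm M i j = dcoeff i * M (flip i) j - M i (flip j) * dcoeff (flip j)"

lemma dirac_mat_comm:
  "dirac_coeffs q w (mat_apply M x) - mat_apply M (dirac_coeffs q w x) = mat_apply (mat_comm M) x"
proof
  fix i
  have "mat_apply M (dirac_coeffs q w x) i = (\<Sum>j\<in>nbr i. M i (flip j) * (dcoeff (flip j) * x (flip (flip j))))"
    unfolding mat_apply_def dirac_coeffs_eq
    by (rule sum.reindex_bij_betw[OF bij_flip_nbr, symmetric])
  then show "(dirac_coeffs q w (mat_apply M x) - mat_apply M (dirac_coeffs q w x)) i = mat_apply (mat_comm M) x i"
    by (simp add: dirac_coeffs_eq mat_apply_def mat_comm_def sum_distrib_left sum_subtractf algebra_simps)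
qed

text \<open>By symmetry of the Dirac operator the commutator with the adjoint is minus the adjoint
  of the commutator. This transfers the bound from \<open>pi_B\<close> to its adjoint.\<close>

lemma mat_comm_conj_transpose: "mat_comm (conj_transpose M) i j = - cnj (mat_comm M j i)"
  using cnj_dcoeff_flip[of i] cnj_dcoeff_flip[of "flip j"] by (simp add: mat_comm_def conj_transpose_def)

lemma banded_mat_comm_conj_transpose:
  assumes "banded (mat_comm M) C" shows "banded (mat_comm (conj_transpose M)) C"
  using banded_conj_transpose[OF assms] unfolding banded_def
  by (simp add: mat_comm_conj_transpose conj_transpose_def)

definition dom_preserving :: "(vec \<Rightarrow> vec) \<Rightarrow> bool" where
  "dom_preserving B \<longleftrightarrow> bounded_fun B \<and> (\<forall>x\<in>domD. B x \<in> domD)"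

text \<open>The extension \<open>C\<close> of the commutator has to preserve the domain as well:
  then a one-form maps \<open>domD\<close> to itself, which puts the kernel of the perturbed
  operator into the domain of D^2.\<close>

definition has_bounded_commutator :: "(vec \<Rightarrow> vec) \<Rightarrow> bool" where
  "has_bounded_commutator B \<longleftrightarrow> dom_preserving B \<and> (\<exists>C. dom_preserving C
     \<and> (\<forall>x\<in>domD. dirac_coeffs q w (B x) - B (dirac_coeffs q w x) = C x))"

lemma dom_preservingD:
  assumes "dom_preserving B" shows "bounded_fun B" "x \<in> domD \<Longrightarrow> B x \<in> domD"
  using assms by (auto simp: dom_preserving_def)

lemma dom_preserving_add: "dom_preserving B \<Longrightarrow> dom_preserving B' \<Longrightarrow> dom_preserving (\<lambda>x. B x + B' x)"
  unfolding dom_preserving_def by (intro conjI ballI bounded_fun_add domD_add; elim conjE; (assumption | erule (1) bspec))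

lemma dom_preserving_scale: "dom_preserving B \<Longrightarrow> dom_preserving (\<lambda>x. vscale c (B x))"
  unfolding dom_preserving_def by (intro conjI ballI bounded_fun_scale domD_scale; elim conjE; (assumption | erule (1) bspec))

lemma dom_preserving_comp: "dom_preserving B \<Longrightarrow> dom_preserving B' \<Longrightarrow> dom_preserving (\<lambda>x. B (B' x))"
  unfolding dom_preserving_def using bounded_fun_comp[of B B'] by blast

lemma dom_preserving_zero: "dom_preserving (\<lambda>x. 0)"
  and dom_preserving_id: "dom_preserving (\<lambda>x. x)"
  unfolding dom_preserving_def by (intro conjI ballI bounded_fun_zero bounded_fun_id domD_zero; assumption)+

lemma dom_preserving_sum:
  fixes n :: nat
  assumes "\<And>i. i < n \<Longrightarrow> dom_preserving (G i)" shows "dom_preserving (\<lambda>x. \<Sum>i<n. G i x)"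
  using assms
proof (induction n)
  case 0
  show ?case by (simp only: lessThan_0 sum.empty dom_preserving_zero)
next
  case (Suc n)
  then show ?case by (simp only: sum.lessThan_Suc) (intro dom_preserving_add Suc.IH Suc.prems; simp)
qed

lemma has_bounded_commutatorI:
  assumes "dom_preserving B" "dom_preserving C"
    and "\<And>x. x \<in> domD \<Longrightarrow> dirac_coeffs q w (B x) - B (dirac_coeffs q w x) = C x"
  shows "has_bounded_commutator B"
  using assms unfolding has_bounded_commutator_def by blast

lemma has_bounded_commutatorE:
  assumes "has_bounded_commutator B"
  obtains C where "dom_preserving B" "dom_preserving C"
    "\<And>x. x \<in> domD \<Longrightarrow> dirac_coeffs q w (B x) = B (dirac_coeffs q w x) + C x"
proof -
  obtain C where C: "dom_preserving B" "dom_preserving C"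
    "\<And>x. x \<in> domD \<Longrightarrow> dirac_coeffs q w (B x) - B (dirac_coeffs q w x) = C x"
    using assms unfolding has_bounded_commutator_def by blast
  have "dirac_coeffs q w (B x) = B (dirac_coeffs q w x) + C x" if "x \<in> domD" for x
    unfolding C(3)[OF that, symmetric] by (rule ext) simp
  then show ?thesis using that C(1,2) by blast
qed

lemma bounded_commutator_mat:
  assumes "banded M C" "banded (mat_comm M) C'" shows "has_bounded_commutator (mat_apply M)"
proof (rule has_bounded_commutatorI)
  show "dom_preserving (mat_apply M)" "dom_preserving (mat_apply (mat_comm M))"
    using bounded_fun_mat[OF assms(1)] bounded_fun_mat[OF assms(2)] mat_apply_domD[OF assms(1)]
      mat_apply_domD[OF assms(2)] unfolding dom_preserving_def by blast+
qed (rule dirac_mat_comm)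

lemma bounded_commutator_id: "has_bounded_commutator (\<lambda>x. x)"
  by (rule has_bounded_commutatorI[OF dom_preserving_id dom_preserving_zero]) (simp only: diff_self)

lemma bounded_commutator_add:
  assumes "has_bounded_commutator B" "has_bounded_commutator B'"
  shows "has_bounded_commutator (\<lambda>x. B x + B' x)"
proof -
  obtain C where C: "dom_preserving B" "dom_preserving C"
    "\<And>x. x \<in> domD \<Longrightarrow> dirac_coeffs q w (B x) = B (dirac_coeffs q w x) + C x"
    using has_bounded_commutatorE[OF assms(1)] by blast
  obtain C' where C': "dom_preserving B'" "dom_preserving C'"
    "\<And>x. x \<in> domD \<Longrightarrow> dirac_coeffs q w (B' x) = B' (dirac_coeffs q w x) + C' x"
    using has_bounded_commutatorE[OF assms(2)] by blast
  show ?thesis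
    by (rule has_bounded_commutatorI[OF dom_preserving_add[OF C(1) C'(1)] dom_preserving_add[OF C(2) C'(2)]])
      (simp only: dirac_coeffs_add C(3) C'(3) add_diff_add add_diff_cancel_left')
qed

lemma bounded_commutator_scale:
  assumes "has_bounded_commutator B" shows "has_bounded_commutator (\<lambda>x. vscale c (B x))"
proof -
  obtain C where C: "dom_preserving B" "dom_preserving C"
    "\<And>x. x \<in> domD \<Longrightarrow> dirac_coeffs q w (B x) = B (dirac_coeffs q w x) + C x"
    using has_bounded_commutatorE[OF assms(1)] by blast
  show ?thesis
    by (rule has_bounded_commutatorI[OF dom_preserving_scale[OF C(1)] dom_preserving_scale[OF C(2)]])
      (simp only: dirac_coeffs_scale C(3) vscale_add add_diff_cancel_left')
qed

text \<open>The Leibniz rule: [D, B B'] = B [D, B'] + [D, B] B' on \<open>domD\<close>.\<close>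

lemma bounded_commutator_comp:
  assumes "has_bounded_commutator B" "has_bounded_commutator B'"
  shows "has_bounded_commutator (\<lambda>x. B (B' x))"
proof -
  obtain C where C: "dom_preserving B" "dom_preserving C"
    "\<And>x. x \<in> domD \<Longrightarrow> dirac_coeffs q w (B x) = B (dirac_coeffs q w x) + C x"
    using has_bounded_commutatorE[OF assms(1)] by blast
  obtain C' where C': "dom_preserving B'" "dom_preserving C'"
    "\<And>x. x \<in> domD \<Longrightarrow> dirac_coeffs q w (B' x) = B' (dirac_coeffs q w x) + C' x"
    using has_bounded_commutatorE[OF assms(2)] by blast
  have "dirac_coeffs q w (B (B' x)) - B (B' (dirac_coeffs q w x)) = B (C' x) + C (B' x)" if x: "x \<in> domD" for x
  proof -
    have "B' (dirac_coeffs q w x) \<in> hilb" "C' x \<in> hilb"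
      using bounded_funD(1)[OF dom_preservingD(1)] C'(1,2) dirac_coeffs_domD[OF x] domD_hilb[OF x] by blast+
    then have "B (B' (dirac_coeffs q w x) + C' x) = B (B' (dirac_coeffs q w x)) + B (C' x)"
      by (rule bounded_funD(2)[OF dom_preservingD(1)[OF C(1)]])
    then show ?thesis
      by (simp only: C(3)[OF dom_preservingD(2)[OF C'(1) x]] C'(3)[OF x] add.assoc add_diff_cancel_left')
  qed
  then show ?thesis
    by (rule has_bounded_commutatorI[OF dom_preserving_comp[OF C(1) C'(1)]
          dom_preserving_add[OF dom_preserving_comp[OF C(1) C'(2)] dom_preserving_comp[OF C(2) C'(1)]]])
qed

text \<open>Because \<open>B\<close> preserves \<open>domD\<close>, the commutator is exactly
  \<open>C\<close> restricted to \<open>domD\<close>. This domain is dense and \<open>C\<close> is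
  continuous, so the closure of the graph is the graph of \<open>C\<close>.\<close>

lemma closure_commutator:
  assumes B: "dom_preserving B" and C: "dom_preserving C"
    and BC: "\<And>x. x \<in> domD \<Longrightarrow> dirac_coeffs q w (B x) = B (dirac_coeffs q w x) + C x"
  shows "op_closure (commutator (dirac q w) (graph_op B)) = graph_op C"
proof -
  have comm: "commutator (dirac q w) (graph_op B) = {(x, C x) | x. x \<in> domD}" (is "?L = ?R")
  proof
    show "?L \<subseteq> ?R"
      unfolding commutator_def op_diff_def op_mult_def graph_op_def
      by (auto simp: dirac_iff BC)
    show "?R \<subseteq> ?L"
    proof
      fix p assume "p \<in> ?R"
      then obtain x where x: "p = (x, C x)" "x \<in> domD" by blast
      have "(x, dirac_coeffs q w (B x)) \<in> op_mult (dirac q w) (graph_op B)"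
        unfolding op_mult_def graph_op_def using dom_preservingD(2)[OF B x(2)] domD_hilb[OF x(2)]
        by (auto simp: dirac_iff)
      moreover have "(x, B (dirac_coeffs q w x)) \<in> op_mult (graph_op B) (dirac q w)"
        unfolding op_mult_def graph_op_def using x(2) dirac_coeffs_domD[OF x(2)] by (auto simp: dirac_iff)
      moreover have "C x = dirac_coeffs q w (B x) - B (dirac_coeffs q w x)"
        by (simp only: BC[OF x(2)] add_diff_cancel_left')
      ultimately show "p \<in> ?L" unfolding commutator_def op_diff_def x(1) by blast
    qed
  qed
  obtain K where K: "0 < K" "\<And>x. x \<in> hilb \<Longrightarrow> vnorm (C x) \<le> K * vnorm x"
    using bounded_fun_bound[OF dom_preservingD(1)[OF C]] by blast
  note Cf = bounded_funD[OF dom_preservingD(1)[OF C]]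
  show ?thesis unfolding comm
  proof
    show "op_closure {(x, C x) | x. x \<in> domD} \<subseteq> graph_op C"
    proof
      fix p assume p: "p \<in> op_closure {(x, C x) | x. x \<in> domD}"
      obtain x y where xy: "p = (x, y)" by (cases p)
      have h: "x \<in> hilb" "y \<in> hilb"
        and cl: "\<And>e. 0 < e \<Longrightarrow> \<exists>u. u \<in> domD \<and> vnorm (x - u) < e \<and> vnorm (y - C u) < e"
        using p unfolding xy op_closure_def by auto
      have "vnorm (y - C x) \<le> 0"
      proof (rule field_le_epsilon)
        fix e :: real assume e: "0 < e"
        then have "0 < e / (K + 1)" using K(1) by simp
        from cl[OF this] obtain u where u: "u \<in> domD" "vnorm (x - u) < e / (K + 1)" "vnorm (y - C u) < e / (K + 1)"
          by blast
        have uh: "u \<in> hilb" by (rule domD_hilb[OF u(1)])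
        have eq: "y - C x = (y - C u) - C (x - u)" by (rule ext) (simp add: Cf(4)[OF h(1) uh])
        have "vnorm (y - C x) \<le> vnorm (y - C u) + vnorm (C (x - u))"
          unfolding eq by (intro vnorm_triangle_diff2 hilb_diff h Cf(1) uh)
        also have "\<dots> \<le> e / (K + 1) + K * (e / (K + 1))"
        proof (rule add_mono)
          have "vnorm (C (x - u)) \<le> K * vnorm (x - u)" using h uh by (intro K(2)) blast
          also have "\<dots> \<le> K * (e / (K + 1))" using K(1) u(2) by (intro mult_left_mono) auto
          finally show "vnorm (C (x - u)) \<le> K * (e / (K + 1))" .
        qed (use u(3) in simp)
        also have "\<dots> = (K + 1) * (e / (K + 1))" by (simp only: distrib_right mult_1 add.commute)
        also have "\<dots> = 0 + e" using K(1) by simp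
        finally show "vnorm (y - C x) \<le> 0 + e" .
      qed
      then have "vnorm (y - C x) = 0" using vnorm_nonneg[of "y - C x"] by linarith
      then have "y - C x = 0" using vnorm_eq_zero h Cf(1)[OF h(1)] by blast
      then show "p \<in> graph_op C" unfolding xy graph_op_def using h by simp
    qed
    show "graph_op C \<subseteq> op_closure {(x, C x) | x. x \<in> domD}"
    proof
      fix p assume "p \<in> graph_op C"
      then obtain x where x: "p = (x, C x)" "x \<in> hilb" unfolding graph_op_def by blast
      have "\<exists>u. u \<in> domD \<and> vnorm (x - u) < e \<and> vnorm (C x - C u) < e" if e: "0 < e" for e
      proof -
        have "0 < e / (K + 1)" using K(1) e by simp
        from domD_dense[OF x(2) this] obtain u where u: "u \<in> domD" "vnorm (x - u) < e / (K + 1)" by blast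
        have uh: "u \<in> hilb" by (rule domD_hilb[OF u(1)])
        have "vnorm (C x - C u) \<le> K * vnorm (x - u)"
          unfolding Cf(4)[OF x(2) uh, symmetric] using x(2) uh by (intro K(2)) blast
        also have "\<dots> \<le> K * (e / (K + 1))" using K(1) u(2) by (intro mult_left_mono) auto
        also have "\<dots> < e" using K(1) e by (simp add: field_simps)
        finally have "vnorm (C x - C u) < e" .
        moreover have "e / (K + 1) \<le> e" using K(1) e by (simp add: field_simps)
        ultimately show ?thesis using u by force
      qed
      then show "p \<in> op_closure {(x, C x) | x. x \<in> domD}"
        unfolding x(1) op_closure_def using x(2) Cf(1)[OF x(2)] by auto
    qed
  qed
qed

lemma one_form_graph:
  assumes "\<And>i. i < n \<Longrightarrow> \<exists>B. has_bounded_commutator B \<and> a i = graph_op B"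
    and "\<And>i. i < n \<Longrightarrow> \<exists>B. has_bounded_commutator B \<and> b i = graph_op B"
  obtains A where "dom_preserving A" "one_form q w n a b = graph_op A"
proof -
  have "\<exists>G. dom_preserving G \<and> op_mult (a i) (op_closure (commutator (dirac q w) (b i))) = graph_op G"
    if i: "i < n" for i
  proof -
    obtain B where B: "has_bounded_commutator B" "a i = graph_op B" using assms(1)[OF i] by blast
    obtain B' where B': "has_bounded_commutator B'" "b i = graph_op B'" using assms(2)[OF i] by blast
    from has_bounded_commutatorE[OF B'(1)] obtain C where C: "dom_preserving B'" "dom_preserving C"
      "\<And>x. x \<in> domD \<Longrightarrow> dirac_coeffs q w (B' x) = B' (dirac_coeffs q w x) + C x" by blast
    have "dom_preserving B" using B(1) by (simp add: has_bounded_commutator_def)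
    then have "dom_preserving (\<lambda>x. B (C x))" by (rule dom_preserving_comp[OF _ C(2)])
    moreover have "op_mult (a i) (op_closure (commutator (dirac q w) (b i))) = graph_op (\<lambda>x. B (C x))"
      by (simp only: B(2) B'(2) closure_commutator[OF C] graph_op_mult[OF dom_preservingD(1)[OF C(2)]])
    ultimately show ?thesis by blast
  qed
  then obtain G where G: "\<And>i. i < n \<Longrightarrow> dom_preserving (G i)"
    "\<And>i. i < n \<Longrightarrow> op_mult (a i) (op_closure (commutator (dirac q w) (b i))) = graph_op (G i)" by metis
  have "one_form q w n a b = graph_op (\<lambda>x. \<Sum>i<n. G i x)"
    unfolding one_form_def op_sum_def
  proof (intro set_eqI iffI)
    fix p assume "p \<in> {(x, \<Sum>i<n. y i) | x y. x \<in> hilb \<and>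
      (\<forall>i<n. (x, y i) \<in> op_mult (a i) (op_closure (commutator (dirac q w) (b i))))}"
    then obtain x y where xy: "p = (x, \<Sum>i<n. y i)" "x \<in> hilb" "\<forall>i<n. (x, y i) \<in> graph_op (G i)"
      using G(2) by auto
    have "y i = G i x" if "i < n" for i using xy(3) that unfolding graph_op_def by blast
    then have "(\<Sum>i<n. y i) = (\<Sum>i<n. G i x)" by (intro sum.cong) auto
    then show "p \<in> graph_op (\<lambda>x. \<Sum>i<n. G i x)" unfolding graph_op_def xy(1) using xy(2) by blast
  next
    fix p assume "p \<in> graph_op (\<lambda>x. \<Sum>i<n. G i x)"
    then obtain x where x: "p = (x, \<Sum>i<n. G i x)" "x \<in> hilb" unfolding graph_op_def by blast
    have "\<forall>i<n. (x, G i x) \<in> op_mult (a i) (op_closure (commutator (dirac q w) (b i)))"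
      using G(2) x(2) by (simp add: graph_op_def)
    then show "p \<in> {(x, \<Sum>i<n. y i) | x y. x \<in> hilb \<and>
      (\<forall>i<n. (x, y i) \<in> op_mult (a i) (op_closure (commutator (dirac q w) (b i))))}"
      unfolding x(1) using x(2) by blast
  qed
  then show ?thesis using that dom_preserving_sum[of n G] G(1) by blast
qed

end

section \<open>The generators of the Podles sphere\<close>

text \<open>The common shape of both generators: \<open>u\<close>, \<open>z\<close> and
  \<open>v\<close> raise, keep and lower \<open>l\<close>, while \<open>m\<close> moves by
  \<open>d\<close>, which is 0 for A and 1 for B.\<close>

fun band_ket :: "(summand \<Rightarrow> real \<Rightarrow> real \<Rightarrow> real) \<Rightarrow> (summand \<Rightarrow> real \<Rightarrow> real \<Rightarrow> real)
    \<Rightarrow> (summand \<Rightarrow> real \<Rightarrow> real \<Rightarrow> real) \<Rightarrow> real \<Rightarrow> label \<Rightarrow> vec" where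
  "band_ket u z v d (s, l, m) =
     vscale (complex_of_real (u s l m)) (ket (s, l + 1, m + d))
     + vscale (complex_of_real (z s l m)) (ket (s, l, m + d))
     + vscale (complex_of_real (v s l m)) (ket (s, l - 1, m + d))"

definition band_mat :: "(label \<Rightarrow> vec) \<Rightarrow> matrix" where
  "band_mat F i j = (if j \<in> labels then F j i else 0)"

lemma extend_from_basis_graph:
  assumes M: "banded (band_mat F) C"
  shows "extend_from_basis F = graph_op (mat_apply (band_mat F))"
proof -
  have eq: "(\<lambda>i. \<Sum>\<^sub>\<infinity>j\<in>labels. x j * F j i) = mat_apply (band_mat F) x" if x: "x \<in> hilb" for x
  proof
    fix i
    have "(\<Sum>\<^sub>\<infinity>j\<in>labels. x j * F j i) = (\<Sum>\<^sub>\<infinity>j\<in>nbr i. band_mat F i j * x j)"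
    proof (rule infsum_cong_neutral)
      fix j
      show "band_mat F i j * x j = 0" if "j \<in> nbr i - labels" using that by (simp add: band_mat_def)
      show "x j * F j i = 0" if "j \<in> labels - nbr i"
        using bandedD(4)[OF M, of i j] that by (auto simp: band_mat_def)
      show "x j * F j i = band_mat F i j * x j" if "j \<in> labels \<inter> nbr i" using that by (simp add: band_mat_def)
    qed
    then show "(\<Sum>\<^sub>\<infinity>j\<in>labels. x j * F j i) = mat_apply (band_mat F) x i" by (simp add: mat_apply_def)
  qed
  show ?thesis
  proof
    show "extend_from_basis F \<subseteq> graph_op (mat_apply (band_mat F))"
      unfolding extend_from_basis_def graph_op_def using eq by blast
    show "graph_op (mat_apply (band_mat F)) \<subseteq> extend_from_basis F"
      unfolding extend_from_basis_def graph_op_def using eq mat_apply_bounded(1)[OF M] by auto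
  qed
qed

lemma band_mat_entry:
  assumes "j = (s, l, m)" "j \<in> labels" "i \<in> labels"
  shows "band_mat (band_ket u z v d) i j = complex_of_real
    (if i = (s, l + 1, m + d) then u s l m else if i = (s, l, m + d) then z s l m
     else if i = (s, l - 1, m + d) then v s l m else 0)"
  using assms by (auto simp: band_mat_def ket_def)

lemma band_mat_outside: "i \<notin> labels \<or> j \<notin> labels \<Longrightarrow> band_mat (band_ket u z v d) i j = 0"
  by (cases j) (auto simp: band_mat_def ket_def)

lemma adjoint_graph_mat:
  assumes M: "banded M C" shows "adjoint (graph_op (mat_apply M)) = graph_op (mat_apply (conj_transpose M))"
proof
  show "graph_op (mat_apply (conj_transpose M)) \<subseteq> adjoint (graph_op (mat_apply M))"
    unfolding graph_op_def adjoint_def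
    using ip_mat_apply[OF M] mat_apply_bounded(1)[OF banded_conj_transpose[OF M]] by auto
  show "adjoint (graph_op (mat_apply M)) \<subseteq> graph_op (mat_apply (conj_transpose M))"
  proof
    fix p assume p: "p \<in> adjoint (graph_op (mat_apply M))"
    obtain x y where xy: "p = (x, y)" by (cases p)
    have h: "x \<in> hilb" "y \<in> hilb" and a: "\<And>u. u \<in> hilb \<Longrightarrow> ip u y = ip (mat_apply M u) x"
      using p unfolding xy adjoint_def graph_op_def by auto
    have "y = mat_apply (conj_transpose M) x"
      by (rule onb_eqI[OF onb_ket h(2) mat_apply_bounded(1)[OF banded_conj_transpose[OF M] h(1)]])
        (simp add: a ip_mat_apply[OF M _ h(1)])
    then show "p \<in> graph_op (mat_apply (conj_transpose M))" unfolding xy graph_op_def using h by blast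
  qed
qed

context podles
begin

lemma q_powr_le: "x \<le> y \<Longrightarrow> q powr y \<le> q powr x"
  using q by (intro powr_mono') auto

lemma cmod_dcoeff_le:
  assumes "(s, l, m) \<in> labels" shows "cmod (dcoeff (s, l, m)) \<le> cmod w * qc * q powr (- l - 1/2)"
proof -
  have "cmod (dcoeff (s, l, m)) = cmod w * qnum q (l + 1/2)"
    using cmod_dcoeff[OF assms] by (simp add: wt_def)
  also have "\<dots> \<le> cmod w * (qc * q powr (- (l + 1/2)))" by (intro mult_left_mono qnum_le) simp
  also have "- (l + 1/2) = - l - 1/2" by simp
  finally show ?thesis by (simp only: mult.assoc)
qed

text \<open>Dirac coefficients grow like q^(-l), so the entries changing \<open>l\<close> must decay
  like q^l. For the entries keeping \<open>l\<close> a bound suffices: there the two Dirac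
  coefficients in the commutator coincide, and only the difference of the two summands has to
  decay.\<close>

lemma band_mat_banded:
  assumes K: "0 \<le> K" and d: "d \<in> {0, 1}"
    and u: "\<And>s l m. (s, l, m) \<in> labels \<Longrightarrow> (s, l + 1, m + d) \<in> labels \<Longrightarrow> \<bar>u s l m\<bar> \<le> K * q powr l"
    and z: "\<And>s l m. (s, l, m) \<in> labels \<Longrightarrow> (s, l, m + d) \<in> labels \<Longrightarrow> \<bar>z s l m\<bar> \<le> K"
    and v: "\<And>s l m. (s, l, m) \<in> labels \<Longrightarrow> (s, l - 1, m + d) \<in> labels \<Longrightarrow> \<bar>v s l m\<bar> \<le> K * q powr l"
    and zz: "\<And>s l m. (s, l, m) \<in> labels \<Longrightarrow> (s, l, m + d) \<in> labels \<Longrightarrow> \<bar>z Plus l m - z Minus l m\<bar> \<le> K * q powr l"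
  shows "banded (band_mat (band_ket u z v d)) K"
    and "banded (mat_comm (band_mat (band_ket u z v d))) (2 * (K * (cmod w * qc * q powr (- 3/2))))"
proof -
  let ?M = "band_mat (band_ket u z v d)"
  let ?R = "K * (cmod w * qc * q powr (- 3/2))"
  have R: "0 \<le> ?R" using K qc_pos by simp
  have small: "K * q powr l \<le> K" if "(s, l, m) \<in> labels" for s l m
    using q_powr_le[of 0 l] labels_bounds(1)[OF that] K q by (simp add: mult_left_le)
  have near: "i \<in> labels" "j \<in> labels" "j \<in> nbr i" if ne: "?M i j \<noteq> 0" for i j
  proof -
    show *: "i \<in> labels" "j \<in> labels" using ne band_mat_outside by blast+
    obtain s l m where j: "j = (s, l, m)" by (cases j)
    have "i = (s, l + 1, m + d) \<or> i = (s, l, m + d) \<or> i = (s, l - 1, m + d)"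
      using ne band_mat_entry[OF j *(2,1), of u z v d] by (auto split: if_splits)
    then show "j \<in> nbr i" using d by (auto simp: j nbr_iff)
  qed
  show M: "banded ?M K"
    unfolding banded_def
  proof (intro conjI allI impI)
    show "0 \<le> K" by (rule K)
    fix i j
    show "i \<in> labels" "j \<in> labels" "j \<in> nbr i" if "?M i j \<noteq> 0" using near[OF that] by blast+
    show "cmod (?M i j) \<le> K"
    proof (cases "?M i j = 0")
      case False
      note ij = near[OF False]
      obtain s l m where j: "j = (s, l, m)" by (cases j)
      show ?thesis
        unfolding band_mat_entry[OF j ij(2,1)]
        using u[of s l m] z[of s l m] v[of s l m] small[of s l m] ij(1,2) K j
        by (auto simp del: of_real_add)
    qed (use K in simp)
  qed
  \<comment> \<open>Since l' <= l + 1, the exponent - l' - 1/2 + l is at least - 3/2, the origin of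
    the constant \<open>?R\<close>.\<close>
  have coeff_le: "cmod (dcoeff (s', l', m')) * \<bar>x\<bar> \<le> ?R"
    if "(s', l', m') \<in> labels" "\<bar>x\<bar> \<le> K * q powr l" "l' \<le> l + 1" for s' l' m' l x
  proof -
    have "cmod (dcoeff (s', l', m')) * \<bar>x\<bar> \<le> (cmod w * qc * q powr (- l' - 1/2)) * (K * q powr l)"
      using that qc_pos by (intro mult_mono cmod_dcoeff_le) auto
    also have "\<dots> = K * (cmod w * qc * (q powr (- l' - 1/2) * q powr l))" by simp
    also have "q powr (- l' - 1/2) * q powr l = q powr (- l' - 1/2 + l)" by (simp only: powr_add)
    also have "K * (cmod w * qc * q powr (- l' - 1/2 + l)) \<le> ?R"
      using that(3) K qc_pos by (intro mult_left_mono q_powr_le) auto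
    finally show ?thesis .
  qed
  show "banded (mat_comm ?M) (2 * ?R)"
    unfolding banded_def
  proof (intro conjI allI impI)
    show "0 \<le> 2 * ?R" using R by simp
    fix i j
    have ne: "?M (flip i) j \<noteq> 0 \<or> ?M i (flip j) \<noteq> 0" if "mat_comm ?M i j \<noteq> 0"
      using that unfolding mat_comm_def by auto
    show "i \<in> labels" "j \<in> labels" "j \<in> nbr i" if "mat_comm ?M i j \<noteq> 0"
      using ne[OF that] near[of "flip i" j] near[of i "flip j"] by auto
    show "cmod (mat_comm ?M i j) \<le> 2 * ?R"
    proof (cases "i \<in> labels \<and> j \<in> labels")
      case False
      then have "mat_comm ?M i j = 0" by (auto simp: mat_comm_def band_mat_outside)
      then show ?thesis using R by simp
    next
      case ij: True
      obtain s' l' m' where i: "i = (s', l', m')" by (cases i)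
      obtain s l m where j: "j = (s, l, m)" by (cases j)
      obtain t where fj: "flip j = (t, l, m)" "t \<noteq> s" by (cases j rule: flip.cases) (auto simp: j)
      obtain t' where fi: "flip i = (t', l', m')" "t' \<noteq> s'" by (cases i rule: flip.cases) (auto simp: i)
      have fl: "(t, l, m) \<in> labels" "(t', l', m') \<in> labels" "(s, l, m) \<in> labels" "(s', l', m') \<in> labels"
        using ij fj(1) fi(1) flip_labels[of i] flip_labels[of j] i j by auto
      show ?thesis
      \<comment> \<open>The Dirac operator exchanges the summands and \<open>?M\<close> preserves
        them, so the commutator has no entries within one summand.\<close>
      proof (cases "s' = s")
        case True
        have "?M (flip i) j = 0"
          using fi True band_mat_entry[OF j, of "flip i" u z v d] ij fl by auto
        moreover have "?M i (flip j) = 0"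
          using fj True i band_mat_entry[OF fj(1), of i u z v d] ij fl by auto
        ultimately show ?thesis using R by (simp add: mat_comm_def)
      next
        case False
        then have st: "t = s'" "t' = s" using fi(2) fj(2) by (cases s; cases s'; cases t; cases t'; simp)+
        have e1: "?M (flip i) j = complex_of_real (if l' = l + 1 \<and> m' = m + d then u s l m
            else if l' = l \<and> m' = m + d then z s l m else if l' = l - 1 \<and> m' = m + d then v s l m else 0)"
          using band_mat_entry[OF j, of "flip i" u z v d] ij fi(1) st fl by simp
        have e2: "?M i (flip j) = complex_of_real (if l' = l + 1 \<and> m' = m + d then u s' l m
            else if l' = l \<and> m' = m + d then z s' l m else if l' = l - 1 \<and> m' = m + d then v s' l m else 0)"
          using band_mat_entry[OF fj(1), of i u z v d] ij i st fl by simp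
        have two: "cmod (dcoeff i * complex_of_real x - complex_of_real y * dcoeff (flip j)) \<le> 2 * ?R"
          if "\<bar>x\<bar> \<le> K * q powr l" "\<bar>y\<bar> \<le> K * q powr l" "l' \<le> l + 1" for x y
        proof -
          have "cmod (dcoeff i * complex_of_real x - complex_of_real y * dcoeff (flip j))
              \<le> cmod (dcoeff i) * \<bar>x\<bar> + cmod (dcoeff (flip j)) * \<bar>y\<bar>"
            by (rule order_trans[OF norm_triangle_ineq4]) (simp add: norm_mult mult.commute)
          also have "\<dots> \<le> ?R + ?R"
            unfolding i fj(1) using that fl by (intro add_mono coeff_le) auto
          finally show ?thesis by (simp only: mult_2)
        qed
        consider (up) "l' = l + 1" "m' = m + d" | (zero) "l' = l" "m' = m + d" | (down) "l' = l - 1" "m' = m + d"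
          | (none) "?M (flip i) j = 0" "?M i (flip j) = 0" unfolding e1 e2 by force
        then show ?thesis
        proof cases
          case up
          then show ?thesis unfolding mat_comm_def e1 e2
            using two[of "u s l m" "u s' l m"] u[of s l m] u[of s' l m] fl st by simp
        next
          case down
          then show ?thesis unfolding mat_comm_def e1 e2
            using two[of "v s l m" "v s' l m"] v[of s l m] v[of s' l m] fl st by simp
        next
          case zero
          \<comment> \<open>A Dirac coefficient depends only on the summand and on \<open>l\<close>,
            so it factors out of the commutator entry.\<close>
          have "dcoeff (flip j) = dcoeff i"
            unfolding fj(1) i st(1) zero(1) by (cases s') auto
          then have "mat_comm ?M i j = dcoeff i * complex_of_real (z s l m - z s' l m)"
            unfolding mat_comm_def e1 e2 using zero by (simp add: algebra_simps)
          then have "cmod (mat_comm ?M i j) = cmod (dcoeff i) * \<bar>z s l m - z s' l m\<bar>"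
            by (simp only: norm_mult norm_of_real)
          also have "\<dots> \<le> ?R"
          proof -
            have "\<bar>z Plus l m - z Minus l m\<bar> \<le> K * q powr l" using zz[of s l m] fl zero st by simp
            then have "\<bar>z s l m - z s' l m\<bar> \<le> K * q powr l"
              using False by (cases s; cases s') (auto simp: abs_minus_commute)
            then show ?thesis unfolding i using fl zero by (intro coeff_le) auto
          qed
          finally show ?thesis using R by simp
        next
          case none
          then show ?thesis using R by (simp add: mat_comm_def)
        qed
      qed
    qed
  qed
qed

end

section \<open>Size of the structure constants in powers of q\<close>

context podles
begin

lemma qnum_mult_le:
  assumes "0 \<le> x" "0 \<le> y"
  shows "qnum q x * qnum q y \<le> qc\<^sup>2 * q powr (- x - y)" "0 \<le> qnum q x * qnum q y"
proof -
  have "qnum q x * qnum q y \<le> (qc * q powr (- x)) * (qc * q powr (- y))"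
    using assms qc_pos by (intro mult_mono qnum_le qnum_nonneg) auto
  also have "\<dots> = qc\<^sup>2 * (q powr (- x) * q powr (- y))" by (simp add: power2_eq_square)
  also have "q powr (- x) * q powr (- y) = q powr (- x - y)" by (simp add: powr_add[symmetric])
  finally show "qnum q x * qnum q y \<le> qc\<^sup>2 * q powr (- x - y)" .
  show "0 \<le> qnum q x * qnum q y" using assms qnum_nonneg by simp
qed

lemma sqrt_qnum_mult_le:
  assumes "0 \<le> x" "0 \<le> y" "r = - (x + y) / 2"
  shows "\<bar>sqrt (qnum q x * qnum q y)\<bar> \<le> qc * q powr r"
proof -
  have "(qc * q powr r)\<^sup>2 = qc\<^sup>2 * q powr (r + r)"
    unfolding powr_add by (simp add: power2_eq_square)
  also have "r + r = - x - y" using assms(3) by simp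
  finally have "qnum q x * qnum q y \<le> (qc * q powr r)\<^sup>2"
    using qnum_mult_le(1)[OF assms(1,2)] by simp
  then have "sqrt (qnum q x * qnum q y) \<le> qc * q powr r"
    using qc_pos by (intro real_le_lsqrt) auto
  then show ?thesis using qnum_mult_le(2)[OF assms(1,2)] by simp
qed

lemma inverse_one_plus_square_le: "0 \<le> 1 / (1 + q\<^sup>2)" "1 / (1 + q\<^sup>2) \<le> 1"
proof -
  have "0 < 1 + q\<^sup>2" by (simp add: add_pos_nonneg)
  then show "0 \<le> 1 / (1 + q\<^sup>2)" "1 / (1 + q\<^sup>2) \<le> 1" by (simp_all add: pos_divide_le_eq)
qed

text \<open>The radicand is at least \<open>qnum q (2*l + 2) * qnum q (4*l + 4)\<close>, so the root
  is at least q^(-3l - 2), while the numerator is at most q^(-l - 2). The range of \<open>l\<close>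
  starts at - 1/2 because \<open>alpha_down\<close> evaluates at \<open>l - 1\<close>.\<close>

lemma alpha_up_bounds:
  assumes l: "- 1/2 \<le> l" shows "0 \<le> alpha_up q s l" "alpha_up q s l \<le> q powr (2 * l)"
proof -
  define X where "X = qnum q (2*l + 2) * (qnum q (4*l + 4) + qnum q 2 * qnum q (2*l + 2))"
  have "q powr (1 - (2*l + 2)) * q powr (1 - (4*l + 4)) \<le> qnum q (2*l + 2) * qnum q (4*l + 4)"
    using l by (intro mult_mono qnum_ge) (auto intro!: qnum_nonneg)
  also have "\<dots> \<le> X" unfolding X_def using l qnum_nonneg[of "2*l + 2"] qnum_nonneg[of 2]
    by (intro mult_left_mono) auto
  finally have "q powr (1 - (2*l + 2)) * q powr (1 - (4*l + 4)) \<le> X" .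
  moreover have "q powr (1 - (2*l + 2)) * q powr (1 - (4*l + 4)) = (q powr (- 3*l - 2))\<^sup>2"
    unfolding power2_eq_square powr_add[symmetric] by (rule arg_cong[where f = "(powr) q"]) simp
  ultimately have sq: "q powr (- 3*l - 2) \<le> sqrt X" by (simp add: real_le_rsqrt)
  have pos: "0 < q powr (- 3*l - 2)" using q by simp
  have num: "alpha_up q s l = (case s of Plus \<Rightarrow> q powr (- l - 2) | Minus \<Rightarrow> q powr (- l - 1)) / sqrt X"
    by (cases s) (simp_all add: X_def)
  have n: "(case s of Plus \<Rightarrow> q powr (- l - 2) | Minus \<Rightarrow> q powr (- l - 1)) \<le> q powr (- l - 2)"
    by (cases s) (auto intro: q_powr_le)
  show "0 \<le> alpha_up q s l" unfolding num using less_le_trans[OF pos sq] by (cases s) auto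
  have "alpha_up q s l \<le> q powr (- l - 2) / q powr (- 3*l - 2)"
    unfolding num using n sq pos by (intro frac_le) auto
  also have "\<dots> = q powr (2 * l)" by (simp add: powr_diff[symmetric])
  finally show "alpha_up q s l \<le> q powr (2 * l)" .
qed

lemma alpha_down_bound:
  assumes l: "1/2 \<le> l" shows "\<bar>alpha_down q s l\<bar> \<le> q powr (4 * l - 2)"
proof -
  have a: "- 1/2 \<le> l - 1" using l by simp
  have "\<bar>alpha_down q s l\<bar> = q powr (2 * l) * alpha_up q s (l - 1)"
    using alpha_up_bounds(1)[OF a, of s] by (simp add: alpha_down_def abs_mult)
  also have "\<dots> \<le> q powr (2 * l) * q powr (2 * (l - 1))"
    using alpha_up_bounds(2)[OF a, of s] by (intro mult_left_mono) auto
  also have "\<dots> = q powr (4 * l - 2)" by (simp add: powr_add[symmetric])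
  finally show ?thesis .
qed

lemma alpha0_denominator:
  assumes l: "1/2 \<le> l" shows "q powr (- 4 * l) \<le> qnum q (2*l) * qnum q (2*l + 2)"
proof -
  have "q powr (1 - 2*l) * q powr (1 - (2*l + 2)) \<le> qnum q (2*l) * qnum q (2*l + 2)"
    using l by (intro mult_mono qnum_ge) (auto intro!: qnum_nonneg)
  moreover have "q powr (1 - 2*l) * q powr (1 - (2*l + 2)) = q powr (- 4 * l)"
    by (simp add: powr_add[symmetric])
  ultimately show ?thesis by simp
qed

text \<open>The numerator is of order q^(-2l) and the denominator at least q^(-4l).\<close>

lemma alpha0_bound:
  assumes l: "1/2 \<le> l" shows "\<bar>alpha0 q s l\<bar> \<le> (qc + 1) * q powr (- 3/2) * q powr (2 * l)"
proof -
  define E where "E = (case s of Plus \<Rightarrow> q | Minus \<Rightarrow> - inverse q)"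
  define N where "N = (q - inverse q) * qnum q (l - 1/2) * qnum q (l + 3/2) + E"
  define Y where "Y = qnum q (2*l) * qnum q (2*l + 2)"
  have Y: "q powr (- 4 * l) \<le> Y" unfolding Y_def by (rule alpha0_denominator[OF l])
  have pos: "0 < q powr (- 4 * l)" using q by simp
  have Yp: "0 < Y" using Y pos by linarith
  have iq: "q powr (- 1) = inverse q" using q by (simp add: powr_minus)
  have E: "\<bar>E\<bar> \<le> q powr (- 2*l - 1)"
  proof -
    have "\<bar>E\<bar> \<le> inverse q" unfolding E_def using q inverse_gt by (cases s) auto
    also have "\<dots> \<le> q powr (- 2*l - 1)" unfolding iq[symmetric] using l by (intro q_powr_le) auto
    finally show ?thesis .
  qed
  have "\<bar>(q - inverse q) * qnum q (l - 1/2) * qnum q (l + 3/2)\<bar> = (1 / qc) * (qnum q (l - 1/2) * qnum q (l + 3/2))"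
    using l inverse_gt qnum_nonneg[of "l - 1/2"] qnum_nonneg[of "l + 3/2"] by (simp add: qc_def abs_mult)
  also have "\<dots> \<le> (1 / qc) * (qc\<^sup>2 * q powr (- (l - 1/2) - (l + 3/2)))"
    using l qc_pos by (intro mult_left_mono qnum_mult_le(1)) auto
  also have "\<dots> = qc * q powr (- 2*l - 1)" using qc_pos by (simp add: power2_eq_square)
  finally have "\<bar>N\<bar> \<le> qc * q powr (- 2*l - 1) + q powr (- 2*l - 1)"
    unfolding N_def using E by (intro order_trans[OF abs_triangle_ineq] add_mono) auto
  then have N: "\<bar>N\<bar> \<le> (qc + 1) * q powr (- 2*l - 1)" by (simp add: algebra_simps)
  have "alpha0 q s l = q powr (- 1/2) * N / Y"
    by (cases s) (simp_all add: N_def E_def Y_def)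
  then have "\<bar>alpha0 q s l\<bar> = q powr (- 1/2) * \<bar>N\<bar> / Y"
    using Yp by (simp add: abs_mult del: alpha0.simps)
  also have "\<dots> \<le> q powr (- 1/2) * ((qc + 1) * q powr (- 2*l - 1)) / q powr (- 4 * l)"
    using Y pos N qc_pos by (intro frac_le mult_left_mono) auto
  also have "\<dots> = (qc + 1) * (q powr (- 1/2) * q powr (- 2*l - 1) / q powr (- 4 * l))" by simp
  also have "q powr (- 1/2) * q powr (- 2*l - 1) / q powr (- 4 * l) = q powr (- 3/2) * q powr (2 * l)"
    by (simp add: powr_add[symmetric] powr_diff[symmetric])
  finally show ?thesis by simp
qed

text \<open>The leading terms of the two numerators cancel and leave q + q^(-1). The difference is
  thus of order q^(4l), a gain of q^(2l) over the bound for each coefficient.\<close>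

lemma alpha0_diff_bound:
  assumes l: "1/2 \<le> l"
  shows "\<bar>alpha0 q Plus l - alpha0 q Minus l\<bar> \<le> q powr (- 1/2) * (q + inverse q) * q powr (4 * l)"
proof -
  define Y where "Y = qnum q (2*l) * qnum q (2*l + 2)"
  have Y: "q powr (- 4 * l) \<le> Y" unfolding Y_def by (rule alpha0_denominator[OF l])
  have pos: "0 < q powr (- 4 * l)" using q by simp
  have Yp: "0 < Y" using Y pos by linarith
  have "alpha0 q Plus l - alpha0 q Minus l = q powr (- 1/2) * (q + inverse q) / Y"
    by (simp add: Y_def diff_divide_distrib[symmetric] algebra_simps)
  then have "\<bar>alpha0 q Plus l - alpha0 q Minus l\<bar> = q powr (- 1/2) * (q + inverse q) / Y"
    using Yp q by (simp add: abs_mult del: alpha0.simps)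
  also have "\<dots> \<le> q powr (- 1/2) * (q + inverse q) / q powr (- 4 * l)"
    using Y pos q by (intro frac_le) auto
  also have "\<dots> = q powr (- 1/2) * (q + inverse q) * q powr (4 * l)"
    by (simp add: powr_minus field_simps)
  finally show ?thesis .
qed

lemma monomial_bound:
  assumes x: "\<bar>x\<bar> \<le> a * q powr r" and y: "\<bar>y\<bar> \<le> b * q powr r'" and c: "0 \<le> a" "0 \<le> b"
    and e: "e \<le> p + r + r'"
  shows "\<bar>q powr p * x * y\<bar> \<le> a * b * q powr e"
proof -
  have "\<bar>q powr p * x * y\<bar> = q powr p * \<bar>x\<bar> * \<bar>y\<bar>" by (simp add: abs_mult)
  also have "\<dots> \<le> q powr p * (a * q powr r) * (b * q powr r')"
    using x y c by (intro mult_mono) auto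
  also have "\<dots> = a * b * q powr (p + r + r')" by (simp add: powr_add)
  also have "\<dots> \<le> a * b * q powr e" using c e by (intro mult_left_mono q_powr_le) auto
  finally show ?thesis .
qed

text \<open>All four estimates for entries changing \<open>l\<close> use the common exponent
  \<open>l - 5/2\<close>. It is dictated by \<open>A_down\<close>, where the exponents add up to m +
  2l - 5/2 and m >= - l.\<close>

lemma A_up_bound:
  assumes "(s, l, m) \<in> labels" shows "\<bar>A_up q s l m\<bar> \<le> qc * 1 * q powr (l - 5/2)"
proof -
  note lm = labels_bounds[OF assms]
  have "\<bar>q powr (m + l + 1/2) * sqrt (qnum q (l - m + 1) * qnum q (l + m + 1)) * alpha_up q s l\<bar> \<le> qc * 1 * q powr (l - 5/2)"
  proof (rule monomial_bound[where r = "- l - 1" and r' = "2 * l"])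
    show "\<bar>sqrt (qnum q (l - m + 1) * qnum q (l + m + 1))\<bar> \<le> qc * q powr (- l - 1)"
      by (rule sqrt_qnum_mult_le) (use lm in \<open>auto simp: field_simps\<close>)
  qed (use lm qc_pos alpha_up_bounds[of l s] in auto)
  then show ?thesis by (simp add: A_up_def)
qed

lemma A_down_bound:
  assumes "(s, l, m) \<in> labels" shows "\<bar>A_down q s l m\<bar> \<le> qc * 1 * q powr (l - 5/2)"
proof -
  note lm = labels_bounds[OF assms]
  show ?thesis unfolding A_down_def
  proof (rule monomial_bound[where r = "- l" and r' = "4 * l - 2"])
    show "\<bar>sqrt (qnum q (l - m) * qnum q (l + m))\<bar> \<le> qc * q powr (- l)"
      by (rule sqrt_qnum_mult_le) (use lm in \<open>auto simp: field_simps\<close>)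
  qed (use lm qc_pos alpha_down_bound[of l s] in auto)
qed

lemma B_up_bound:
  assumes "(s, l, m) \<in> labels" shows "\<bar>B_up q s l m\<bar> \<le> qc * 1 * q powr (l - 5/2)"
proof -
  note lm = labels_bounds[OF assms]
  show ?thesis unfolding B_up_def
  proof (rule monomial_bound[where r = "- l - m - 3/2" and r' = "2 * l"])
    show "\<bar>sqrt (qnum q (l + m + 1) * qnum q (l + m + 2))\<bar> \<le> qc * q powr (- l - m - 3/2)"
      by (rule sqrt_qnum_mult_le) (use lm in \<open>auto simp: field_simps\<close>)
  qed (use lm qc_pos alpha_up_bounds[of l s] in auto)
qed

text \<open>That the target is a label gives m + 2 <= l, so both q-numbers under the root have
  nonnegative arguments.\<close>

lemma B_down_bound:
  assumes "(s, l, m) \<in> labels" "(s, l - 1, m + 1) \<in> labels"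
  shows "\<bar>B_down q s l m\<bar> \<le> qc * 1 * q powr (l - 5/2)"
proof -
  note lm = labels_bounds[OF assms(1)] labels_bounds[OF assms(2)]
  show ?thesis unfolding B_down_def
  proof (rule monomial_bound[where r = "- l + m + 1/2" and r' = "4 * l - 2"])
    show "\<bar>sqrt (qnum q (l - m) * qnum q (l - m - 1))\<bar> \<le> qc * q powr (- l + m + 1/2)"
      by (rule sqrt_qnum_mult_le) (use lm in \<open>auto simp: field_simps\<close>)
  qed (use lm qc_pos alpha_down_bound[of l s] in auto)
qed

text \<open>The part of \<open>A_zero\<close> that does not depend on the summand, so that
  differences between the summands reduce to those of \<open>alpha0\<close>.\<close>

definition A_zero_factor :: "real \<Rightarrow> real \<Rightarrow> real" where
  "A_zero_factor l m = 1 / (1 + q\<^sup>2) * (qnum q (l - m + 1) * qnum q (l + m) - q\<^sup>2 * qnum q (l - m) * qnum q (l + m + 1))"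

lemma A_zero_eq: "A_zero q s l m = q powr (- 1/2) * A_zero_factor l m * alpha0 q s l + 1 / (1 + q\<^sup>2)"
  by (simp add: A_zero_def A_zero_factor_def)

lemma A_zero_factor_bound:
  assumes "(s, l, m) \<in> labels" shows "\<bar>A_zero_factor l m\<bar> \<le> 2 * qc\<^sup>2 * q powr (- 2 * l - 1)"
proof -
  note lm = labels_bounds[OF assms]
  let ?B = "qc\<^sup>2 * q powr (- 2 * l - 1)"
  have 1: "0 \<le> qnum q (l - m + 1) * qnum q (l + m)" "qnum q (l - m + 1) * qnum q (l + m) \<le> ?B"
    using qnum_mult_le[of "l - m + 1" "l + m"] lm by simp_all
  have 2: "0 \<le> qnum q (l - m) * qnum q (l + m + 1)" "qnum q (l - m) * qnum q (l + m + 1) \<le> ?B"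
    using qnum_mult_le[of "l - m" "l + m + 1"] lm by simp_all
  have q2: "0 \<le> q\<^sup>2" "q\<^sup>2 \<le> 1" using q by (simp_all add: power_le_one)
  have 3: "0 \<le> q\<^sup>2 * (qnum q (l - m) * qnum q (l + m + 1))" "q\<^sup>2 * (qnum q (l - m) * qnum q (l + m + 1)) \<le> ?B"
    using 2 q2 mult_left_le_one_le[of "qnum q (l - m) * qnum q (l + m + 1)" "q\<^sup>2"] by simp_all
  have "\<bar>A_zero_factor l m\<bar> = 1 / (1 + q\<^sup>2) * \<bar>qnum q (l - m + 1) * qnum q (l + m) - q\<^sup>2 * (qnum q (l - m) * qnum q (l + m + 1))\<bar>"
    using q2 by (simp add: A_zero_factor_def abs_mult mult.assoc)
  also have "\<dots> \<le> 1 * (?B + ?B)"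
  proof (rule mult_mono)
    show "1 / (1 + q\<^sup>2) \<le> 1" by (rule inverse_one_plus_square_le)
    show "\<bar>qnum q (l - m + 1) * qnum q (l + m) - q\<^sup>2 * (qnum q (l - m) * qnum q (l + m + 1))\<bar> \<le> ?B + ?B"
      using 1 3 by (simp only: abs_le_iff) linarith
  qed auto
  finally show ?thesis by simp
qed

text \<open>The exponents - 1/2, - 2l - 1 and 2l cancel in \<open>l\<close>, so this bound does not
  decay; hence the separate estimate for the difference of the summands.\<close>

lemma A_zero_bound:
  assumes "(s, l, m) \<in> labels"
  shows "\<bar>A_zero q s l m\<bar> \<le> 2 * qc\<^sup>2 * ((qc + 1) * q powr (- 3/2)) * q powr (- 3/2) + 1"
proof -
  note lm = labels_bounds[OF assms]
  have "\<bar>q powr (- 1/2) * A_zero_factor l m * alpha0 q s l\<bar> \<le> 2 * qc\<^sup>2 * ((qc + 1) * q powr (- 3/2)) * q powr (- 3/2)"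
    by (rule monomial_bound[OF A_zero_factor_bound[OF assms] alpha0_bound[OF lm(1)]]) (use qc_pos in auto)
  moreover have "\<bar>1 / (1 + q\<^sup>2)\<bar> \<le> 1" using inverse_one_plus_square_le by simp
  ultimately show ?thesis unfolding A_zero_eq by (intro order_trans[OF abs_triangle_ineq] add_mono)
qed

lemma A_zero_diff_bound:
  assumes "(s, l, m) \<in> labels"
  shows "\<bar>A_zero q Plus l m - A_zero q Minus l m\<bar>
    \<le> 2 * qc\<^sup>2 * (q powr (- 1/2) * (q + inverse q)) * q powr (l - 5/2)"
proof -
  note lm = labels_bounds[OF assms]
  have "A_zero q Plus l m - A_zero q Minus l m = q powr (- 1/2) * A_zero_factor l m * (alpha0 q Plus l - alpha0 q Minus l)"
    by (simp add: A_zero_eq right_diff_distrib del: alpha0.simps)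
  then show ?thesis
    using monomial_bound[OF A_zero_factor_bound[OF assms] alpha0_diff_bound[OF lm(1)], of "l - 5/2" "- 1/2"] lm qc_pos q
    by simp
qed

lemma B_zero_root_bound:
  assumes "(s, l, m) \<in> labels"
  shows "\<bar>sqrt (qnum q (l + m + 1) * qnum q (l - m))\<bar> \<le> qc * q powr (- l - 1/2)"
proof -
  note lm = labels_bounds[OF assms]
  show ?thesis
    by (rule sqrt_qnum_mult_le) (use lm in \<open>auto simp: field_simps\<close>)
qed

lemma B_zero_bound:
  assumes "(s, l, m) \<in> labels"
  shows "\<bar>B_zero q s l m\<bar> \<le> qc * ((qc + 1) * q powr (- 3/2)) * q powr (- 3/2)"
  unfolding B_zero_def
  by (rule monomial_bound[OF B_zero_root_bound[OF assms] alpha0_bound])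
    (use labels_bounds[OF assms] qc_pos in auto)

lemma B_zero_diff_bound:
  assumes "(s, l, m) \<in> labels"
  shows "\<bar>B_zero q Plus l m - B_zero q Minus l m\<bar> \<le> qc * (q powr (- 1/2) * (q + inverse q)) * q powr (l - 5/2)"
proof -
  note lm = labels_bounds[OF assms]
  have "B_zero q Plus l m - B_zero q Minus l m
      = q powr m * sqrt (qnum q (l + m + 1) * qnum q (l - m)) * (alpha0 q Plus l - alpha0 q Minus l)"
    by (simp add: B_zero_def right_diff_distrib del: alpha0.simps)
  then show ?thesis
    using monomial_bound[OF B_zero_root_bound[OF assms] alpha0_diff_bound[OF lm(1)], of "l - 5/2" m] lm qc_pos q
    by simp
qed

text \<open>The sum of the constants of all entry estimates, so that one \<open>K\<close> serves
  every hypothesis of \<open>band_mat_banded\<close> for both generators.\<close>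

definition gen_bound :: real where
  "gen_bound = qc * q powr (- 5/2)
     + (2 * qc\<^sup>2 * ((qc + 1) * q powr (- 3/2)) * q powr (- 3/2) + 1)
     + 2 * qc\<^sup>2 * (q powr (- 1/2) * (q + inverse q)) * q powr (- 5/2)
     + qc * ((qc + 1) * q powr (- 3/2)) * q powr (- 3/2)
     + qc * (q powr (- 1/2) * (q + inverse q)) * q powr (- 5/2)"

lemma gen_bound:
  "0 \<le> gen_bound"
  "qc * 1 * q powr (l - 5/2) \<le> gen_bound * q powr l"
  "2 * qc\<^sup>2 * ((qc + 1) * q powr (- 3/2)) * q powr (- 3/2) + 1 \<le> gen_bound"
  "2 * qc\<^sup>2 * (q powr (- 1/2) * (q + inverse q)) * q powr (l - 5/2) \<le> gen_bound * q powr l"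
  "qc * ((qc + 1) * q powr (- 3/2)) * q powr (- 3/2) \<le> gen_bound"
  "qc * (q powr (- 1/2) * (q + inverse q)) * q powr (l - 5/2) \<le> gen_bound * q powr l"
proof -
  define t1 t2 t3 t4 t5 where "t1 = qc * q powr (- 5/2)"
    and "t2 = 2 * qc\<^sup>2 * ((qc + 1) * q powr (- 3/2)) * q powr (- 3/2) + 1"
    and "t3 = 2 * qc\<^sup>2 * (q powr (- 1/2) * (q + inverse q)) * q powr (- 5/2)"
    and "t4 = qc * ((qc + 1) * q powr (- 3/2)) * q powr (- 3/2)"
    and "t5 = qc * (q powr (- 1/2) * (q + inverse q)) * q powr (- 5/2)"
  note t_def = t1_def t2_def t3_def t4_def t5_def
  have g: "gen_bound = t1 + t2 + t3 + t4 + t5" by (simp only: gen_bound_def t_def)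
  have t: "0 \<le> t1" "0 \<le> t2" "0 \<le> t3" "0 \<le> t4" "0 \<le> t5"
    unfolding t_def using q qc_pos by simp_all
  show "0 \<le> gen_bound" unfolding g using t by simp
  have split: "q powr (l - 5/2) = q powr (- 5/2) * q powr l" by (simp add: powr_add[symmetric])
  have e1: "qc * 1 * q powr (l - 5/2) = t1 * q powr l" unfolding split t_def by (simp only: mult_1_right mult.assoc)
  have e3: "2 * qc\<^sup>2 * (q powr (- 1/2) * (q + inverse q)) * q powr (l - 5/2) = t3 * q powr l"
    unfolding split t_def by (simp only: mult.assoc)
  have e5: "qc * (q powr (- 1/2) * (q + inverse q)) * q powr (l - 5/2) = t5 * q powr l"
    unfolding split t_def by (simp only: mult.assoc)
  show "qc * 1 * q powr (l - 5/2) \<le> gen_bound * q powr l"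
    unfolding e1 g using t by (intro mult_right_mono) auto
  show "2 * qc\<^sup>2 * (q powr (- 1/2) * (q + inverse q)) * q powr (l - 5/2) \<le> gen_bound * q powr l"
    unfolding e3 g using t by (intro mult_right_mono) auto
  show "qc * (q powr (- 1/2) * (q + inverse q)) * q powr (l - 5/2) \<le> gen_bound * q powr l"
    unfolding e5 g using t by (intro mult_right_mono) auto
  show "2 * qc\<^sup>2 * ((qc + 1) * q powr (- 3/2)) * q powr (- 3/2) + 1 \<le> gen_bound"
    unfolding t_def(2)[symmetric] g using t by simp
  show "qc * ((qc + 1) * q powr (- 3/2)) * q powr (- 3/2) \<le> gen_bound"
    unfolding t_def(4)[symmetric] g using t by simp
qed

lemma A_ket_band: "A_ket q = band_ket (A_up q) (A_zero q) (A_down q) 0"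
  by (rule ext, case_tac x) simp

lemma B_ket_band: "B_ket q = band_ket (B_up q) (B_zero q) (B_down q) 1"
  by (rule ext, case_tac x) simp

lemma generator_matrices:
  obtains MA MB CA CB CA' CB' where
    "banded MA CA" "banded (mat_comm MA) CA'" "pi_A q = graph_op (mat_apply MA)"
    "banded MB CB" "banded (mat_comm MB) CB'" "pi_B q = graph_op (mat_apply MB)"
proof -
  note g = gen_bound
  have a: "banded (band_mat (A_ket q)) gen_bound"
    "banded (mat_comm (band_mat (A_ket q))) (2 * (gen_bound * (cmod w * qc * q powr (- 3/2))))"
    unfolding A_ket_band
    by (rule band_mat_banded[OF g(1)];
        (blast intro: order_trans[OF A_up_bound g(2)] order_trans[OF A_zero_bound g(3)]
          order_trans[OF A_down_bound g(2)] order_trans[OF A_zero_diff_bound g(4)] | simp))+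
  have b: "banded (band_mat (B_ket q)) gen_bound"
    "banded (mat_comm (band_mat (B_ket q))) (2 * (gen_bound * (cmod w * qc * q powr (- 3/2))))"
    unfolding B_ket_band
    by (rule band_mat_banded[OF g(1)];
        (blast intro: order_trans[OF B_up_bound g(2)] order_trans[OF B_zero_bound g(5)]
          order_trans[OF B_down_bound g(2)] order_trans[OF B_zero_diff_bound g(6)] | simp))+
  show ?thesis
    by (rule that[OF a _ b]) (simp_all only: pi_A_def pi_B_def extend_from_basis_graph[OF a(1)] extend_from_basis_graph[OF b(1)])
qed

theorem podles_algebra_bounded_commutator:
  assumes "a \<in> podles_algebra q"
  shows "\<exists>B. has_bounded_commutator B \<and> a = graph_op B"
  using assms
proof (induction rule: podles_algebra.induct)
  case gen_A
  obtain MA MB CA CB CA' CB' where "banded MA CA" "banded (mat_comm MA) CA'" "pi_A q = graph_op (mat_apply MA)"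
    "banded MB CB" "banded (mat_comm MB) CB'" "pi_B q = graph_op (mat_apply MB)" by (rule generator_matrices)
  then show ?case using bounded_commutator_mat by blast
next
  case gen_B
  obtain MA MB CA CB CA' CB' where "banded MA CA" "banded (mat_comm MA) CA'" "pi_A q = graph_op (mat_apply MA)"
    "banded MB CB" "banded (mat_comm MB) CB'" "pi_B q = graph_op (mat_apply MB)" by (rule generator_matrices)
  then show ?case using bounded_commutator_mat by blast
next
  case gen_B_star
  obtain MA MB CA CB CA' CB' where "banded MA CA" "banded (mat_comm MA) CA'" "pi_A q = graph_op (mat_apply MA)"
    and B: "banded MB CB" "banded (mat_comm MB) CB'" "pi_B q = graph_op (mat_apply MB)" by (rule generator_matrices)
  have "adjoint (pi_B q) = graph_op (mat_apply (conj_transpose MB))"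
    unfolding B(3) by (rule adjoint_graph_mat[OF B(1)])
  then show ?case
    using bounded_commutator_mat[OF banded_conj_transpose[OF B(1)] banded_mat_comm_conj_transpose[OF B(2)]] by blast
next
  case unit
  show ?case using bounded_commutator_id graph_op_id by blast
next
  case (add a b)
  then obtain B B' where B: "has_bounded_commutator B" "a = graph_op B" "has_bounded_commutator B'" "b = graph_op B'"
    by blast
  show ?case unfolding B(2,4) graph_op_add using bounded_commutator_add[OF B(1,3)] by blast
next
  case (scale a c)
  then obtain B where B: "has_bounded_commutator B" "a = graph_op B" by blast
  show ?case unfolding B(2) graph_op_scale using bounded_commutator_scale[OF B(1)] by blast
next
  case (mult a b)
  then obtain B B' where B: "has_bounded_commutator B" "a = graph_op B" "has_bounded_commutator B'" "b = graph_op B'"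
    by blast
  have "bounded_fun B'" using B(3) by (simp add: has_bounded_commutator_def dom_preserving_def)
  then show ?case unfolding B(2,4) using graph_op_mult bounded_commutator_comp[OF B(1,3)] by blast
qed

end

section \<open>The perturbed Dirac operator\<close>

context podles
begin

text \<open>Level l = n + 1/2 carries 2 (2n + 2) labels with eigenvalue at least |w| q^(-n). With r
  = sqrt q the series is dominated by a multiple of the sum of (n + 1) r^n.\<close>

lemma summable_wt: "(\<lambda>i. 1 / sqrt (wt i)) summable_on labels"
proof -
  define h :: "nat \<times> nat \<times> summand \<Rightarrow> label" where
    "h = (\<lambda>(n, k, s). (s, real n + 1/2, - (real n + 1/2) + real k))"
  define A where "A = Sigma (UNIV :: nat set) (\<lambda>n. {..2 * n + 1} \<times> {Plus, Minus})"
  have lab: "labels = h ` A"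
  proof
    show "labels \<subseteq> h ` A"
    proof
      fix i assume i: "i \<in> labels"
      obtain s l m where slm: "i = (s, l, m)" by (cases i)
      obtain n k where nk: "l = real n + 1/2" "real k \<le> 2 * l" "m = - l + real k"
        using i unfolding slm labels_def by auto
      have "k \<le> 2 * n + 1" using nk(1,2) by linarith
      then have "(n, k, s) \<in> A" unfolding A_def by (cases s) auto
      moreover have "i = h (n, k, s)" unfolding slm h_def using nk by simp
      ultimately show "i \<in> h ` A" by blast
    qed
    show "h ` A \<subseteq> labels" unfolding A_def h_def labels_def by auto
  qed
  have inj: "inj_on h A" unfolding h_def by (auto simp: inj_on_def)
  define r where "r = sqrt q"
  have r: "0 < r" "r < 1" using q by (simp_all add: r_def)
  have bound: "1 / sqrt (wt (h (n, k, s))) \<le> 1 / sqrt (cmod w) * r ^ n" for n k s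
  proof -
    have "q powr (1 - (real n + 1/2 + 1/2)) \<le> qnum q (real n + 1/2 + 1/2)" by (rule qnum_ge) simp
    moreover have "q powr (1 - (real n + 1/2 + 1/2)) = inverse (q ^ n)"
      using q by (simp add: powr_minus powr_realpow)
    ultimately have "cmod w * inverse (q ^ n) \<le> wt (h (n, k, s))"
      unfolding wt_def h_def by (simp add: mult_left_mono)
    then have "sqrt (cmod w * inverse (q ^ n)) \<le> sqrt (wt (h (n, k, s)))" by (rule real_sqrt_le_mono)
    moreover have "sqrt (cmod w * inverse (q ^ n)) = sqrt (cmod w) * inverse (r ^ n)"
      by (simp only: real_sqrt_mult real_sqrt_power real_sqrt_inverse r_def)
    ultimately have le: "sqrt (cmod w) * inverse (r ^ n) \<le> sqrt (wt (h (n, k, s)))" by simp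
    have pos: "0 < sqrt (cmod w) * inverse (r ^ n)" using w r by simp
    have "1 / sqrt (wt (h (n, k, s))) \<le> 1 / (sqrt (cmod w) * inverse (r ^ n))"
      by (rule divide_left_mono[OF le]) (use pos less_le_trans[OF pos le] in simp_all)
    then show ?thesis using r by (simp add: field_simps)
  qed
  have "summable (\<lambda>n. real (Suc n) * r ^ n)"
    using geometric_deriv_sums[of r] r by (simp add: sums_iff)
  then have sm: "summable (\<lambda>n. (4 / sqrt (cmod w)) * (real (Suc n) * r ^ n))" by (rule summable_mult)
  have eq: "(\<Sum>y\<in>{..2 * n + 1} \<times> {Plus, Minus}. 1 / sqrt (cmod w) * r ^ n)
      = (4 / sqrt (cmod w)) * (real (Suc n) * r ^ n)" for n
    by (simp add: card_cartesian_product algebra_simps)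
  have "(\<lambda>n. \<Sum>y\<in>{..2 * n + 1} \<times> {Plus, Minus}. 1 / sqrt (cmod w) * r ^ n) summable_on UNIV"
    unfolding eq by (rule summable_nonneg_imp_summable_on[OF sm]) (use r in simp)
  then have "(\<lambda>(n, y). 1 / sqrt (cmod w) * r ^ n) summable_on A"
    unfolding A_def
    by (rule summable_on_SigmaI[rotated]) (use r in \<open>auto intro!: has_sum_finiteI\<close>)
  then have "(\<lambda>p. 1 / sqrt (wt (h p))) summable_on A"
  proof (rule summable_on_comparison_test)
    fix p assume p: "p \<in> A"
    obtain n k s where nks: "p = (n, k, s)" by (cases p)
    show "1 / sqrt (wt (h p)) \<le> (\<lambda>(n, y). 1 / sqrt (cmod w) * r ^ n) p" using bound nks by simp
    have "h p \<in> labels" using p lab by blast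
    then show "0 \<le> 1 / sqrt (wt (h p))" using wt_pos[of "h p"] by simp
  qed
  then show ?thesis unfolding lab using summable_on_reindex[OF inj, of "\<lambda>i. 1 / sqrt (wt i)"] by (simp add: comp_def)
qed

text \<open>Infinitely many labels below \<open>R\<close> would each contribute at least 1 / sqrt R
  to a convergent series.\<close>

lemma finite_wt_le: "finite {i \<in> labels. wt i \<le> R}"
proof (rule ccontr)
  let ?F = "{i \<in> labels. wt i \<le> R}"
  let ?g = "\<lambda>i. 1 / sqrt (wt i)"
  assume inf: "\<not> finite ?F"
  then obtain i0 where "i0 \<in> ?F" using infinite_imp_nonempty by blast
  then have R: "0 < R" using wt_pos[of i0] by simp
  obtain N where N: "infsum ?g labels * sqrt R < real N" using reals_Archimedean2 by blast
  obtain G where G: "G \<subseteq> ?F" "finite G" "card G = N"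
    using infinite_arbitrarily_large[OF inf] by blast
  have "real N * (1 / sqrt R) = (\<Sum>i\<in>G. 1 / sqrt R)" using G by simp
  also have "\<dots> \<le> (\<Sum>i\<in>G. ?g i)"
  proof (rule sum_mono)
    fix i assume "i \<in> G"
    then have "0 < wt i" "wt i \<le> R" using G(1) wt_pos[of i] by auto
    then show "1 / sqrt R \<le> ?g i" using R by (intro divide_left_mono) simp_all
  qed
  also have "\<dots> \<le> infsum ?g labels"
    by (rule finite_sum_le_infsum[OF summable_wt G(2)]) (use G(1) in blast, simp add: wt_pos less_imp_le)
  finally show False using N R by (simp add: divide_le_eq)
qed

lemma heat_sum_wt:
  obtains C where "0 \<le> C" "\<And>s. 0 < s \<Longrightarrow> heat_sum labels wt s \<le> ennreal (C / sqrt s)"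
proof -
  let ?g = "\<lambda>i. 1 / sqrt (wt i)"
  let ?C = "infsum ?g labels"
  have g0: "0 \<le> ?g i" if "i \<in> labels" for i using wt_pos[OF that] by simp
  have "0 \<le> ?C" by (rule infsum_nonneg[OF g0])
  moreover have "heat_sum labels wt s \<le> ennreal (?C / sqrt s)" if s: "0 < s" for s
  proof -
    have "heat_sum labels wt s \<le> (\<integral>\<^sup>+i. ennreal (1 / sqrt s * ?g i) \<partial>count_space labels)"
      unfolding heat_sum_def
    proof (rule nn_integral_mono)
      fix i assume "i \<in> space (count_space labels)"
      then have i: "0 < s * wt i" using wt_pos[of i] s by simp
      have "sqrt t \<le> 1 + t" if "0 < t" for t
        using that by (intro real_le_lsqrt) (auto simp: power2_eq_square algebra_simps)
      from this[OF i] have "sqrt (s * wt i) \<le> 1 + s * wt i" .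
      also have "\<dots> \<le> exp (s * wt i)" by (rule exp_ge_add_one_self)
      finally have "exp (- s * wt i) \<le> 1 / sqrt (s * wt i)"
        using i by (simp add: exp_minus field_simps)
      then show "ennreal (exp (- s * wt i)) \<le> ennreal (1 / sqrt s * ?g i)"
        by (intro ennreal_leI) (simp add: real_sqrt_mult)
    qed
    also have "\<dots> = ennreal (1 / sqrt s * ?C)"
      by (rule nn_integral_count_space_has_sum[OF _ has_sum_cmult_right[OF has_sum_infsum[OF summable_wt]]])
        (use g0 s in auto)
    finally show ?thesis by simp
  qed
  ultimately show ?thesis using that by blast
qed

text \<open>Outside the finite set \<open>F\<close> the squared eigenvalue exceeds \<open>R\<close>.
  This is compactness of the resolvent of the unperturbed operator, in the form used by
  \<open>compact_resolvent\<close>.\<close>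

lemma low_modes_bound:
  assumes x: "x \<in> domD" and R: "0 \<le> R" and F: "F = {i \<in> labels. (wt i)\<^sup>2 \<le> R}"
  shows "R * (vnorm x)\<^sup>2 \<le> (vnorm (wmul x))\<^sup>2 + R * (\<Sum>i\<in>F. (cmod (x i))\<^sup>2)"
proof -
  have "F \<subseteq> {i \<in> labels. wt i \<le> sqrt R}" using F R by (auto intro: real_le_rsqrt)
  then have fF: "finite F" using finite_wt_le finite_subset by blast
  have n: "((\<lambda>i. (cmod (y i))\<^sup>2) has_sum (vnorm y)\<^sup>2) labels" if "y \<in> hilb" for y
    unfolding vnorm_power2 by (rule has_sum_infsum[OF hilb_summable[OF that]])
  have "((\<lambda>i. if i \<in> F then (cmod (x i))\<^sup>2 else 0) has_sum (\<Sum>i\<in>F. (cmod (x i))\<^sup>2)) labels"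
    using fF F by (intro has_sum_finite_neutralI[of F]) auto
  then have "((\<lambda>i. (cmod (wmul x i))\<^sup>2 + R * (if i \<in> F then (cmod (x i))\<^sup>2 else 0))
      has_sum (vnorm (wmul x))\<^sup>2 + R * (\<Sum>i\<in>F. (cmod (x i))\<^sup>2)) labels"
    by (intro has_sum_add has_sum_cmult_right n domD_wmul x)
  with has_sum_cmult_right[OF n[OF domD_hilb[OF x]], of R] show ?thesis
  proof (rule has_sum_mono)
    fix i assume i: "i \<in> labels"
    have "(cmod (wmul x i))\<^sup>2 = (wt i)\<^sup>2 * (cmod (x i))\<^sup>2"
      by (simp add: wmul_def norm_mult power_mult_distrib)
    then show "R * (cmod (x i))\<^sup>2 \<le> (cmod (wmul x i))\<^sup>2 + R * (if i \<in> F then (cmod (x i))\<^sup>2 else 0)"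
      using i by (cases "i \<in> F") (auto simp: F intro!: mult_right_mono)
  qed
qed

section \<open>Perturbation by a bounded selfadjoint operator\<close>

context
  fixes A :: "vec \<Rightarrow> vec" and a :: real
  assumes A: "dom_preserving A" and sa: "selfadjoint (graph_op A)"
    and a: "0 < a" "\<And>x. x \<in> hilb \<Longrightarrow> vnorm (A x) \<le> a * vnorm x"
begin

definition DA :: oper where
  "DA = op_add (dirac q w) (graph_op A)"

lemma A_hilb: "x \<in> hilb \<Longrightarrow> A x \<in> hilb"
  by (rule bounded_funD(1)[OF dom_preservingD(1)[OF A]])

lemma A_sym: "x \<in> hilb \<Longrightarrow> y \<in> hilb \<Longrightarrow> ip x (A y) = ip (A x) y"
  by (rule selfadjoint_sym[OF sa]) (auto simp: graph_op_def)

lemma DA_iff: "(x, y) \<in> DA \<longleftrightarrow> x \<in> domD \<and> y = dirac_coeffs q w x + A x"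
proof
  assume "(x, y) \<in> DA"
  then show "x \<in> domD \<and> y = dirac_coeffs q w x + A x"
    unfolding DA_def op_add_def graph_op_def by (auto simp: dirac_iff)
next
  assume xy: "x \<in> domD \<and> y = dirac_coeffs q w x + A x"
  then have "(x, dirac_coeffs q w x) \<in> dirac q w" "(x, A x) \<in> graph_op A"
    using domD_hilb by (auto simp: dirac_iff graph_op_def)
  then show "(x, y) \<in> DA" unfolding DA_def op_add_def using xy by blast
qed

text \<open>A bounded symmetric perturbation preserves selfadjointness: if \<open>(x, y)\<close> is
  in the adjoint, then \<open>(x, y - A x)\<close> satisfies the defining relation of the adjoint of
  the Dirac operator.\<close>

lemma DA_selfadjoint: "selfadjoint DA"
proof -
  have lin: "linear_op DA"
    unfolding linear_op_def
  proof (intro conjI)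
    show "DA \<subseteq> hilb \<times> hilb"
      using domD_hilb dirac_coeffs_domD A_hilb by (auto simp: DA_iff)
    show "single_valued DA" unfolding single_valued_def by (auto simp: DA_iff)
    have "A 0 = 0" using bounded_funD(3)[OF dom_preservingD(1)[OF A], of 0 0] by simp
    then show "(0, 0) \<in> DA" by (simp add: DA_iff domD_zero dirac_coeffs_zero)
    show "\<forall>(x, y)\<in>DA. \<forall>(x', y')\<in>DA. (x + x', y + y') \<in> DA"
      using bounded_funD(2)[OF dom_preservingD(1)[OF A]] domD_hilb
      by (auto simp: DA_iff domD_add dirac_coeffs_add)
    show "\<forall>(x, y)\<in>DA. \<forall>c. (vscale c x, vscale c y) \<in> DA"
      using bounded_funD(3)[OF dom_preservingD(1)[OF A]] domD_hilb
      by (auto simp: DA_iff domD_scale dirac_coeffs_scale vscale_add)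
  qed
  have sub: "DA \<subseteq> adjoint DA"
  proof
    fix p assume p: "p \<in> DA"
    obtain x y where xy: "p = (x, y)" by (cases p)
    have x: "x \<in> domD" "y = dirac_coeffs q w x + A x" using p unfolding xy DA_iff by auto
    have "ip u y = ip v x" if "(u, v) \<in> DA" for u v
    proof -
      have u: "u \<in> domD" "v = dirac_coeffs q w u + A u" using that unfolding DA_iff by auto
      show ?thesis unfolding x(2) u(2)
        using domD_hilb[OF x(1)] domD_hilb[OF u(1)] dirac_coeffs_domD[OF x(1)] dirac_coeffs_domD[OF u(1)] A_hilb
        by (simp add: ip_add_left ip_add_right A_sym ip_dirac_coeffs)
    qed
    then show "p \<in> adjoint DA" using linear_op_hilb[OF lin p[unfolded xy]] unfolding xy adjoint_def by blast
  qed
  have "adjoint DA \<subseteq> DA"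
  proof
    fix p assume p: "p \<in> adjoint DA"
    obtain x y where xy: "p = (x, y)" by (cases p)
    have h: "x \<in> hilb" "y \<in> hilb" and adj: "\<And>u v. (u, v) \<in> DA \<Longrightarrow> ip u y = ip v x"
      using p unfolding xy adjoint_def by auto
    have "(x, y - A x) \<in> dirac q w"
    proof (rule selfadjoint_memI[OF dirac_selfadjoint h(1)])
      show "y - A x \<in> hilb" using h A_hilb by blast
      fix u v assume "(u, v) \<in> dirac q w"
      then have u: "u \<in> domD" "v = dirac_coeffs q w u" by (auto simp: dirac_iff)
      have "ip u y = ip (v + A u) x" by (rule adj) (use u in \<open>simp add: DA_iff\<close>)
      then show "ip u (y - A x) = ip v x"
        using h domD_hilb[OF u(1)] dirac_coeffs_domD[OF u(1)] A_hilb u(2)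
        by (simp add: ip_diff_right ip_add_left A_sym)
    qed
    then have "x \<in> domD" "y - A x = dirac_coeffs q w x" by (auto simp: dirac_iff)
    then have "y = dirac_coeffs q w x + A x" by (metis diff_add_cancel)
    then show "p \<in> DA" unfolding xy DA_iff using \<open>x \<in> domD\<close> by blast
  qed
  then show ?thesis using lin sub by (auto simp: selfadjoint_def)
qed

text \<open>The norm of \<open>wmul x\<close> equals that of the Dirac operator applied to
  \<open>x\<close>, so both parts are the triangle inequality. They carry the size of
  \<open>A\<close> into the comparison of heat traces.\<close>

lemma DA_norm_compare:
  assumes xy: "(x, y) \<in> DA"
  shows "vnorm (wmul x) \<le> vnorm y + a * vnorm x" "vnorm y \<le> vnorm (wmul x) + a * vnorm x"
proof -
  have x: "x \<in> domD" "y = dirac_coeffs q w x + A x" using xy unfolding DA_iff by auto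
  note h = domD_hilb[OF x(1)] dirac_coeffs_domD[OF x(1)] A_hilb[OF domD_hilb[OF x(1)]]
  have "dirac_coeffs q w x = y - A x" unfolding x(2) by (rule ext) simp
  then have "vnorm (dirac_coeffs q w x) \<le> vnorm y + vnorm (A x)"
    using vnorm_triangle_diff2[of y "A x"] h x(2) by auto
  then show "vnorm (wmul x) \<le> vnorm y + a * vnorm x"
    using a(2)[OF h(1)] dirac_coeffs_hilb(2)[OF h(1)] by simp
  show "vnorm y \<le> vnorm (wmul x) + a * vnorm x"
    using vnorm_triangle[OF h(2,3)] a(2)[OF h(1)] dirac_coeffs_hilb(2)[OF h(1)] x(2) by simp
qed

lemma DA_compact_resolvent: "compact_resolvent DA"
  unfolding compact_resolvent_def
proof
  fix K
  \<comment> \<open>Chosen such that R / 2 - a^2 = |K|, because the norm comparison bounds the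
    squared norm of \<open>wmul x\<close> by 2 ||y||^2 + 2 a^2 ||x||^2.\<close>
  define R where "R = 2 * \<bar>K\<bar> + 2 * a\<^sup>2"
  define F where "F = {i \<in> labels. (wt i)\<^sup>2 \<le> R}"
  have R: "0 \<le> R" by (simp add: R_def)
  have "F \<subseteq> {i \<in> labels. wt i \<le> sqrt R}" using R by (auto simp: F_def intro: real_le_rsqrt)
  then have "finite F" using finite_wt_le finite_subset by blast
  moreover have "K * (vnorm x)\<^sup>2 \<le> (vnorm y)\<^sup>2 + R / 2 * (\<Sum>i\<in>F. (cmod (x i))\<^sup>2)" if xy: "(x, y) \<in> DA" for x y
  proof -
    have x: "x \<in> domD" using xy unfolding DA_iff by auto
    have "(vnorm (wmul x))\<^sup>2 \<le> (vnorm y + a * vnorm x)\<^sup>2"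
      using DA_norm_compare(1)[OF xy] by (intro power_mono) auto
    also have "\<dots> \<le> 2 * (vnorm y)\<^sup>2 + 2 * (a\<^sup>2 * (vnorm x)\<^sup>2)"
      using sum_squares_bound[of "vnorm y" "a * vnorm x"] by (simp add: power2_sum power_mult_distrib)
    finally have "R * (vnorm x)\<^sup>2 \<le> 2 * (vnorm y)\<^sup>2 + 2 * (a\<^sup>2 * (vnorm x)\<^sup>2) + R * (\<Sum>i\<in>F. (cmod (x i))\<^sup>2)"
      using low_modes_bound[OF x R F_def] by linarith
    moreover have "R * (vnorm x)\<^sup>2 = 2 * (\<bar>K\<bar> * (vnorm x)\<^sup>2) + 2 * (a\<^sup>2 * (vnorm x)\<^sup>2)"
      by (simp add: R_def algebra_simps)
    ultimately have "\<bar>K\<bar> * (vnorm x)\<^sup>2 \<le> (vnorm y)\<^sup>2 + R / 2 * (\<Sum>i\<in>F. (cmod (x i))\<^sup>2)"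
      by simp
    moreover have "K * (vnorm x)\<^sup>2 \<le> \<bar>K\<bar> * (vnorm x)\<^sup>2" by (intro mult_right_mono) auto
    ultimately show ?thesis by linarith
  qed
  moreover have "0 \<le> R / 2" using R by simp
  ultimately show "\<exists>F k. finite F \<and> F \<subseteq> labels \<and> 0 \<le> k \<and>
     (\<forall>(x, y) \<in> DA. K * (vnorm x)\<^sup>2 \<le> (vnorm y)\<^sup>2 + k * (\<Sum>i\<in>F. (cmod (x i))\<^sup>2))"
    by (intro exI[of _ F] exI[of _ "R / 2"]) (auto simp: F_def)
qed

text \<open>A kernel vector \<open>x\<close> satisfies D x = - A x, which lies in
  \<open>domD\<close>, so \<open>x\<close> is in the domain of D^2. There X x = - D^2 x, so X D^(-2)
  maps the nonzero vector D^2 x to its negative, against the norm bound. The converse relation of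
  D^2 serves as D^(-2).\<close>

lemma DA_kernel:
  assumes X: "X = op_diff (op_mult DA DA) (op_mult (dirac q w) (dirac q w))"
    and norm: "op_norm (op_mult X (converse (op_mult (dirac q w) (dirac q w)))) < 1"
    and x: "(x, 0) \<in> DA"
  shows "x = 0"
proof (rule ccontr)
  assume "x \<noteq> 0"
  let ?D = "dirac q w"
  note lin = selfadjoint_linear[OF DA_selfadjoint]
  have xD: "x \<in> domD" and x0: "0 = dirac_coeffs q w x + A x" using x unfolding DA_iff by auto
  have Dx: "dirac_coeffs q w x = vscale (-1) (A x)"
  proof
    fix i show "dirac_coeffs q w x i = vscale (-1) (A x) i"
      using fun_cong[OF x0, of i] by (simp add: eq_neg_iff_add_eq_0)
  qed
  have DxD: "dirac_coeffs q w x \<in> domD"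
    unfolding Dx by (intro domD_scale dom_preservingD(2)[OF A] xD)
  define u where "u = dirac_coeffs q w (dirac_coeffs q w x)"
  have uh: "u \<in> hilb" unfolding u_def by (rule dirac_coeffs_domD[OF DxD])
  have D2: "(x, u) \<in> op_mult ?D ?D"
    unfolding op_mult_def u_def using xD DxD by (auto simp: dirac_iff)
  have u0: "vnorm u \<noteq> 0"
  proof
    assume "vnorm u = 0"
    then have "u = 0" using vnorm_eq_zero uh by blast
    have "x i = 0" for i
    proof (cases "i \<in> labels")
      case True
      have "ip (ket i) u = complex_of_real ((wt i)\<^sup>2) * ip (ket i) x"
        using D2 True unfolding dirac_square by (rule diag_opD(3))
      then show ?thesis using \<open>u = 0\<close> wt_pos[OF True] by (simp add: ip_ket[OF True])
    qed (rule hilb_outside[OF domD_hilb[OF xD]])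
    then show False using \<open>x \<noteq> 0\<close> by auto
  qed
  define c where "c = complex_of_real (1 / vnorm u)"
  have cnorm: "vnorm (vscale c u) = 1" using u0 by (simp add: c_def vnorm_scale norm_divide)
  have lin2: "linear_op (op_mult ?D ?D)" unfolding dirac_square by (rule diag_op_linear[OF onb_ket])
  have cx: "(vscale c x, 0) \<in> DA" using linear_op_scale[OF lin x, of c] by simp
  have "(vscale c x, 0) \<in> op_mult DA DA"
    unfolding op_mult_def using cx linear_op_zero[OF lin] by blast
  moreover have "(vscale c x, vscale c u) \<in> op_mult ?D ?D" by (rule linear_op_scale[OF lin2 D2])
  ultimately have "(vscale c x, 0 - vscale c u) \<in> X" unfolding X op_diff_def by blast
  then have mem: "(vscale c u, 0 - vscale c u) \<in> op_mult X (converse (op_mult ?D ?D))"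
    using \<open>(vscale c x, vscale c u) \<in> op_mult ?D ?D\<close> unfolding op_mult_def[of X] by blast
  have "vnorm (0 - vscale c u) = 1" using cnorm by (simp only: vnorm_minus_commute[of 0] diff_zero)
  then have "ennreal 1 \<le> op_norm (op_mult X (converse (op_mult ?D ?D)))"
    unfolding op_norm_def using mem cnorm
    by (intro SUP_upper2[where i = "(vscale c u, 0 - vscale c u)"]) auto
  then show False using norm by simp
qed

end

end

section \<open>Traces of functions of diagonal operators\<close>

lemma trace_fun_calc_diag_op:
  assumes o: "onb e J" and f: "f \<in> borel_measurable borel"
    and g: "\<And>j. j \<in> J \<Longrightarrow> f (l j) = g j" "\<And>j. j \<in> J \<Longrightarrow> 0 \<le> g j" "\<And>j. j \<in> J \<Longrightarrow> g j \<le> C"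
  shows "trace_class (fun_calc f (diag_op e J l)) \<longleftrightarrow> (\<integral>\<^sup>+j. ennreal (g j) \<partial>count_space J) < \<infinity>"
    and "op_trace (fun_calc f (diag_op e J l)) = complex_of_real (enn2real (\<integral>\<^sup>+j. ennreal (g j) \<partial>count_space J))"
proof -
  have "fun_calc f (diag_op e J l) = diag_op e J g"
    unfolding fun_calc_diag_op[OF o f] by (rule diag_op_cong[OF g(1)])
  then show "trace_class (fun_calc f (diag_op e J l)) \<longleftrightarrow> (\<integral>\<^sup>+j. ennreal (g j) \<partial>count_space J) < \<infinity>"
    "op_trace (fun_calc f (diag_op e J l)) = complex_of_real (enn2real (\<integral>\<^sup>+j. ennreal (g j) \<partial>count_space J))"
    using trace_diag_op[OF o g(2,3)] by simp_all
qed

lemma trace_heat_diag_op: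
  assumes o: "onb e J" and l: "\<And>j. j \<in> J \<Longrightarrow> 0 < l j" and t: "0 < t"
  shows "trace_class (fun_calc (\<lambda>x. exp (- t * x)) (diag_op e J l)) \<longleftrightarrow> heat_sum J l t < \<infinity>"
    and "op_trace (fun_calc (\<lambda>x. exp (- t * x)) (diag_op e J l)) = complex_of_real (enn2real (heat_sum J l t))"
proof -
  have le: "exp (- t * l j) \<le> 1" if "j \<in> J" for j using l[OF that] t by simp
  have m: "(\<lambda>x. exp (- t * x)) \<in> borel_measurable borel" by measurable
  show "trace_class (fun_calc (\<lambda>x. exp (- t * x)) (diag_op e J l)) \<longleftrightarrow> heat_sum J l t < \<infinity>"
    "op_trace (fun_calc (\<lambda>x. exp (- t * x)) (diag_op e J l)) = complex_of_real (enn2real (heat_sum J l t))"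
    unfolding heat_sum_def
    by (rule trace_fun_calc_diag_op[OF o m refl _ le]; simp)+
qed

text \<open>The scaled eigenvalues are positive, and there the extensional function agrees with the
  Laplace transform.\<close>

lemma trace_laplace_diag_op:
  assumes o: "onb e J" and l: "\<And>j. j \<in> J \<Longrightarrow> 0 < l j" and \<Lambda>: "0 < \<Lambda>"
    and phi: "sets \<phi> = sets (restrict_space borel {0<..})"
    and mom: "\<And>t. 0 \<le> t \<Longrightarrow> (\<integral>\<^sup>+s. ennreal (exp (s * t)) \<partial>\<phi>) < \<infinity>"
    and f: "f = restrict (laplace \<phi>) {0<..}"
  defines "T \<equiv> op_scale (complex_of_real (1 / \<Lambda>)) (diag_op e J l)"
    and "S \<equiv> \<integral>\<^sup>+j. ennreal (laplace \<phi> (l j / \<Lambda>)) \<partial>count_space J"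
  shows "trace_class (fun_calc f T) \<longleftrightarrow> S < \<infinity>" "op_trace (fun_calc f T) = complex_of_real (enn2real S)"
proof -
  have T: "T = diag_op e J (\<lambda>j. 1 / \<Lambda> * l j)"
    unfolding T_def by (rule op_scale_diag_op) (use \<Lambda> in simp)
  have m: "f \<in> borel_measurable borel" unfolding f by (rule laplace_measurable[OF phi mom])
  have nn: "0 \<le> l j / \<Lambda>" if "j \<in> J" for j using l[OF that] \<Lambda> by simp
  have v: "f (1 / \<Lambda> * l j) = laplace \<phi> (l j / \<Lambda>)" if "j \<in> J" for j
    using l[OF that] \<Lambda> by (simp add: f)
  note b = laplace_bounds[OF phi mom nn]
  show "trace_class (fun_calc f T) \<longleftrightarrow> S < \<infinity>" "op_trace (fun_calc f T) = complex_of_real (enn2real S)"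
    unfolding T S_def by (rule trace_fun_calc_diag_op[OF o m v b]; assumption)+
qed

context podles
begin

text \<open>Peierls' inequality in the eigenbasis of either operator, applied to the eigenvectors of the
  other one, bounds each heat sum by the other with all frequencies shifted by \<open>\<parallel>A\<parallel>\<close>.\<close>

theorem spectral_action_perturbation:
  fixes \<D> \<D>\<^sub>A :: oper
  assumes A: "dom_preserving A" and sa: "selfadjoint (graph_op A)"
    and a: "0 < a" "\<And>x. x \<in> hilb \<Longrightarrow> vnorm (A x) \<le> a * vnorm x"
    and ker: "\<And>x. (x, 0) \<in> DA A \<Longrightarrow> x = 0"
    and D: "\<D> = dirac q w" and DA: "\<D>\<^sub>A = DA A"
  shows "(\<forall>t>0. trace_class (fun_calc (\<lambda>x. exp (- t * x)) (op_abs \<D>\<^sub>A))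
              \<and> trace_class (fun_calc (\<lambda>x. exp (- t * x)) (op_abs \<D>)))"
    and "((\<lambda>t. op_trace (fun_calc (\<lambda>x. exp (- t * x)) (op_abs \<D>\<^sub>A))
            - op_trace (fun_calc (\<lambda>x. exp (- t * x)) (op_abs \<D>))) \<longlongrightarrow> 0) (at_right 0)"
    and "(\<forall>f \<in> class_C.
          (\<forall>\<Lambda>>0. trace_class (fun_calc f (op_scale (complex_of_real (1 / \<Lambda>)) (op_abs \<D>\<^sub>A)))
               \<longleftrightarrow> trace_class (fun_calc f (op_scale (complex_of_real (1 / \<Lambda>)) (op_abs \<D>))))
        \<and> ((\<lambda>\<Lambda>. op_trace (fun_calc f (op_scale (complex_of_real (1 / \<Lambda>)) (op_abs \<D>\<^sub>A)))
                - op_trace (fun_calc f (op_scale (complex_of_real (1 / \<Lambda>)) (op_abs \<D>)))) \<longlongrightarrow> 0) at_top)"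
proof -
  obtain \<Psi> l0 where o: "onb (\<lambda>x. x) \<Psi>" and T: "DA A = diag_op (\<lambda>x. x) \<Psi> l0"
    using spectral_theorem_compact_resolvent[OF DA_selfadjoint[OF A sa a] DA_compact_resolvent[OF A sa a]] by blast
  define l where "l x = \<bar>l0 x\<bar>" for x
  have unit: "vnorm x = 1" if "x \<in> \<Psi>" for x by (rule orthonormal_vnorm[OF onb_orthonormal[OF o] that])
  have ev: "(x, vscale (complex_of_real (l0 x)) x) \<in> DA A" if "x \<in> \<Psi>" for x
    unfolding T by (rule diag_op_basis[OF o that])
  \<comment> \<open>The trivial kernel makes all eigenvalues of the modulus positive, hence points
    where the test functions are specified.\<close>
  have l: "0 < l x" if "x \<in> \<Psi>" for x
  proof (rule ccontr)
    assume "\<not> 0 < l x"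
    then have "(x, 0) \<in> DA A" using ev[OF that] by (simp add: l_def)
    then show False using ker unit[OF that] by fastforce
  qed
  have absDA: "op_abs \<D>\<^sub>A = diag_op (\<lambda>x. x) \<Psi> l"
    unfolding DA T op_abs_diag_op[OF o] l_def[abs_def] ..
  have absD: "op_abs \<D> = diag_op ket labels wt"
  proof -
    have "op_mult (adjoint (dirac q w)) (dirac q w) = diag_op ket labels (\<lambda>i. (wt i)\<^sup>2)"
      using dirac_square dirac_selfadjoint by (simp add: selfadjoint_def)
    then have "op_abs \<D> = diag_op ket labels (\<lambda>i. \<bar>wt i\<bar>)"
      unfolding D by (rule op_abs_eq_diag_op[OF onb_ket])
    also have "\<dots> = diag_op ket labels wt" by (rule diag_op_cong) (use wt_pos in force)
    finally show ?thesis .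
  qed
  have h1: "heat_sum labels (\<lambda>i. wt i + a) s \<le> heat_sum \<Psi> l s" if s: "0 < s" for s
    unfolding heat_sum_def l_def
  proof (rule heat_sum_le[OF o onb_ket])
    fix i assume i: "i \<in> labels"
    show "0 < wt i + a" using wt_pos[OF i] a by simp
    have "wmul (ket i) = vscale (complex_of_real (wt i)) (ket i)"
      by (auto simp: wmul_def ket_def fun_eq_iff)
    then have w1: "vnorm (wmul (ket i)) = wt i"
      using wt_pos[OF i] orthonormal_vnorm[OF onb_orthonormal[OF onb_ket] i] by (simp add: vnorm_scale)
    have mem: "(ket i, dirac_coeffs q w (ket i) + A (ket i)) \<in> DA A"
      using domD_ket by (simp add: DA_iff[OF A sa a])
    then have "vnorm (dirac_coeffs q w (ket i) + A (ket i)) \<le> wt i + a"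
      using DA_norm_compare(2)[OF A sa a mem] w1 orthonormal_vnorm[OF onb_orthonormal[OF onb_ket] i] by simp
    with mem show "\<exists>y. (ket i, y) \<in> diag_op (\<lambda>x. x) \<Psi> l0 \<and> vnorm y \<le> wt i + a"
      unfolding T by blast
  qed (use s in simp)
  have h2: "heat_sum \<Psi> (\<lambda>x. l x + a) s \<le> heat_sum labels wt s" if s: "0 < s" for s
  proof -
    have "(\<integral>\<^sup>+x. ennreal (exp (- s * (l x + a))) \<partial>count_space \<Psi>)
        \<le> (\<integral>\<^sup>+i. ennreal (exp (- s * \<bar>wt i\<bar>)) \<partial>count_space labels)"
    proof (rule heat_sum_le[OF onb_ket o])
      fix x assume x: "x \<in> \<Psi>"
      show "0 < l x + a" using l[OF x] a by simp
      have xD: "x \<in> domD" using ev[OF x] by (simp add: DA_iff[OF A sa a])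
      have "(x, wmul x) \<in> diag_op ket labels wt"
        by (rule diag_opI[OF domD_hilb[OF xD] domD_wmul[OF xD]]) (simp add: ip_ket wmul_def)
      moreover have "vnorm (wmul x) \<le> l x + a"
        using DA_norm_compare(1)[OF A sa a ev[OF x]] unit[OF x] by (simp add: vnorm_scale l_def)
      ultimately show "\<exists>y. (x, y) \<in> diag_op ket labels wt \<and> vnorm y \<le> l x + a" by blast
    qed (use s in simp)
    also have "\<dots> = heat_sum labels wt s"
      unfolding heat_sum_def by (rule nn_integral_cong) (use wt_pos in \<open>simp add: less_imp_le\<close>)
    finally show ?thesis by (simp add: heat_sum_def)
  qed
  obtain C where C: "0 \<le> C" "\<And>s. 0 < s \<Longrightarrow> heat_sum labels wt s \<le> ennreal (C / sqrt s)"
    using heat_sum_wt by blast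
  have close: "heat_sum \<Psi> l s \<le> heat_sum labels wt s + ennreal (a * C * sqrt s * exp (s * a))"
    "heat_sum labels wt s \<le> heat_sum \<Psi> l s + ennreal (a * C * sqrt s * exp (s * a))"
    "heat_sum \<Psi> l s < \<infinity>" "heat_sum labels wt s < \<infinity>" if s: "0 < s" for s
    using heat_sum_close[OF a(1) C(1) s h1[OF s] h2[OF s] C(2)[OF s]] by blast+
  have tr\<Psi>: "trace_class (fun_calc (\<lambda>x. exp (- t * x)) (op_abs \<D>\<^sub>A)) \<longleftrightarrow> heat_sum \<Psi> l t < \<infinity>"
    "op_trace (fun_calc (\<lambda>x. exp (- t * x)) (op_abs \<D>\<^sub>A)) = complex_of_real (enn2real (heat_sum \<Psi> l t))"
    if t: "0 < t" for t
    unfolding absDA by (rule trace_heat_diag_op[OF o l t]; assumption)+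
  have trD: "trace_class (fun_calc (\<lambda>x. exp (- t * x)) (op_abs \<D>)) \<longleftrightarrow> heat_sum labels wt t < \<infinity>"
    "op_trace (fun_calc (\<lambda>x. exp (- t * x)) (op_abs \<D>)) = complex_of_real (enn2real (heat_sum labels wt t))"
    if t: "0 < t" for t
    unfolding absD by (rule trace_heat_diag_op[OF onb_ket wt_pos t]; assumption)+
  show "\<forall>t>0. trace_class (fun_calc (\<lambda>x. exp (- t * x)) (op_abs \<D>\<^sub>A))
              \<and> trace_class (fun_calc (\<lambda>x. exp (- t * x)) (op_abs \<D>))"
    using tr\<Psi>(1) trD(1) close(3,4) by simp
  show "((\<lambda>t. op_trace (fun_calc (\<lambda>x. exp (- t * x)) (op_abs \<D>\<^sub>A))
            - op_trace (fun_calc (\<lambda>x. exp (- t * x)) (op_abs \<D>))) \<longlongrightarrow> 0) (at_right 0)"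
  proof (rule Lim_null_comparison)
    show "\<forall>\<^sub>F t in at_right 0. norm (op_trace (fun_calc (\<lambda>x. exp (- t * x)) (op_abs \<D>\<^sub>A))
            - op_trace (fun_calc (\<lambda>x. exp (- t * x)) (op_abs \<D>))) \<le> a * C * sqrt t * exp (t * a)"
      using eventually_at_right_less[of 0]
    proof eventually_elim
      case (elim t)
      have "\<bar>enn2real (heat_sum \<Psi> l t) - enn2real (heat_sum labels wt t)\<bar> \<le> a * C * sqrt t * exp (t * a)"
        by (rule enn2real_close(1)[OF close(1,2)[OF elim]]) (use a C elim in simp)
      then show ?case
        by (simp only: tr\<Psi>(2)[OF elim] trD(2)[OF elim] of_real_diff[symmetric] norm_of_real real_norm_def)
    qed
    have "((\<lambda>t. a * C * sqrt t * exp (t * a)) \<longlongrightarrow> a * C * sqrt 0 * exp (0 * a)) (at_right 0)"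
      by (intro tendsto_intros)
    then show "((\<lambda>t. a * C * sqrt t * exp (t * a)) \<longlongrightarrow> 0) (at_right 0)" by simp
  qed
  show "\<forall>f \<in> class_C.
          (\<forall>\<Lambda>>0. trace_class (fun_calc f (op_scale (complex_of_real (1 / \<Lambda>)) (op_abs \<D>\<^sub>A)))
               \<longleftrightarrow> trace_class (fun_calc f (op_scale (complex_of_real (1 / \<Lambda>)) (op_abs \<D>))))
        \<and> ((\<lambda>\<Lambda>. op_trace (fun_calc f (op_scale (complex_of_real (1 / \<Lambda>)) (op_abs \<D>\<^sub>A)))
                - op_trace (fun_calc f (op_scale (complex_of_real (1 / \<Lambda>)) (op_abs \<D>)))) \<longlongrightarrow> 0) at_top"
  proof
    fix f assume "f \<in> class_C"
    then obtain \<phi> where phi: "sets \<phi> = sets (restrict_space borel {0<..})"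
      and mom: "\<And>t. 0 \<le> t \<Longrightarrow> (\<integral>\<^sup>+s. ennreal (exp (s * t)) \<partial>\<phi>) < \<infinity>"
      and f: "f = restrict (laplace \<phi>) {0<..}"
      unfolding class_C_def by blast
    define M where "M t = enn2real (\<integral>\<^sup>+s. ennreal (exp (s * t)) \<partial>\<phi>)" for t
    define S where "S \<Lambda> = (\<integral>\<^sup>+x. ennreal (laplace \<phi> (l x / \<Lambda>)) \<partial>count_space \<Psi>)" for \<Lambda>
    define S0 where "S0 \<Lambda> = (\<integral>\<^sup>+i. ennreal (laplace \<phi> (wt i / \<Lambda>)) \<partial>count_space labels)" for \<Lambda>
    have c: "countable \<Psi>" "countable labels"
      by (rule heat_sum_countable[OF close(3)[OF zero_less_one]], rule heat_sum_countable[OF close(4)[OF zero_less_one]])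
    have le: "S \<Lambda> \<le> S0 \<Lambda> + ennreal (a * C / sqrt \<Lambda> * M (1 + a / \<Lambda>))"
      "S0 \<Lambda> \<le> S \<Lambda> + ennreal (a * C / sqrt \<Lambda> * M (1 + a / \<Lambda>))" if "0 < \<Lambda>" for \<Lambda>
      unfolding S_def S0_def M_def
      by (rule nn_integral_laplace_close[OF phi mom a(1) C(1) that c l wt_pos close(1)]; assumption)
        (rule nn_integral_laplace_close[OF phi mom a(1) C(1) that c(2,1) wt_pos l close(2)]; assumption)
    have M0: "0 \<le> M t" for t by (simp add: M_def)
    have pos: "0 \<le> a * C / sqrt \<Lambda> * M (1 + a / \<Lambda>)" if "0 < \<Lambda>" for \<Lambda>
      using a C M0 that by simp
    have t\<Psi>: "trace_class (fun_calc f (op_scale (complex_of_real (1 / \<Lambda>)) (op_abs \<D>\<^sub>A))) \<longleftrightarrow> S \<Lambda> < \<infinity>"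
      "op_trace (fun_calc f (op_scale (complex_of_real (1 / \<Lambda>)) (op_abs \<D>\<^sub>A))) = complex_of_real (enn2real (S \<Lambda>))"
      if "0 < \<Lambda>" for \<Lambda>
      unfolding absDA S_def by (rule trace_laplace_diag_op[OF o l that phi mom f]; assumption)+
    have tD: "trace_class (fun_calc f (op_scale (complex_of_real (1 / \<Lambda>)) (op_abs \<D>))) \<longleftrightarrow> S0 \<Lambda> < \<infinity>"
      "op_trace (fun_calc f (op_scale (complex_of_real (1 / \<Lambda>)) (op_abs \<D>))) = complex_of_real (enn2real (S0 \<Lambda>))"
      if "0 < \<Lambda>" for \<Lambda>
      unfolding absD S0_def by (rule trace_laplace_diag_op[OF onb_ket wt_pos that phi mom f]; assumption)+
    show "(\<forall>\<Lambda>>0. trace_class (fun_calc f (op_scale (complex_of_real (1 / \<Lambda>)) (op_abs \<D>\<^sub>A)))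
               \<longleftrightarrow> trace_class (fun_calc f (op_scale (complex_of_real (1 / \<Lambda>)) (op_abs \<D>))))
        \<and> ((\<lambda>\<Lambda>. op_trace (fun_calc f (op_scale (complex_of_real (1 / \<Lambda>)) (op_abs \<D>\<^sub>A)))
                - op_trace (fun_calc f (op_scale (complex_of_real (1 / \<Lambda>)) (op_abs \<D>)))) \<longlongrightarrow> 0) at_top"
    proof (intro conjI allI impI)
      fix \<Lambda> :: real assume \<Lambda>: "0 < \<Lambda>"
      show "trace_class (fun_calc f (op_scale (complex_of_real (1 / \<Lambda>)) (op_abs \<D>\<^sub>A)))
          \<longleftrightarrow> trace_class (fun_calc f (op_scale (complex_of_real (1 / \<Lambda>)) (op_abs \<D>)))"
        using t\<Psi>(1)[OF \<Lambda>] tD(1)[OF \<Lambda>] enn2real_close(2)[OF le[OF \<Lambda>] pos[OF \<Lambda>]] by simp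
    next
      show "((\<lambda>\<Lambda>. op_trace (fun_calc f (op_scale (complex_of_real (1 / \<Lambda>)) (op_abs \<D>\<^sub>A)))
                - op_trace (fun_calc f (op_scale (complex_of_real (1 / \<Lambda>)) (op_abs \<D>)))) \<longlongrightarrow> 0) at_top"
      proof (rule Lim_null_comparison)
        show "\<forall>\<^sub>F \<Lambda> in at_top. norm (op_trace (fun_calc f (op_scale (complex_of_real (1 / \<Lambda>)) (op_abs \<D>\<^sub>A)))
                - op_trace (fun_calc f (op_scale (complex_of_real (1 / \<Lambda>)) (op_abs \<D>)))) \<le> a * C * M (1 + a) / sqrt \<Lambda>"
          \<comment> \<open>For \<Lambda> >= 1 the moment of order 1 + a / \<Lambda> is at most the
            one of order 1 + a, a constant independent of \<Lambda>.\<close>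
          using eventually_ge_at_top[of 1]
        proof eventually_elim
          case (elim \<Lambda>)
          then have \<Lambda>: "0 < \<Lambda>" by simp
          have "a / \<Lambda> \<le> a" using elim a(1) by (simp add: divide_le_eq)
          then have "M (1 + a / \<Lambda>) \<le> M (1 + a)"
            unfolding M_def using a(1) by (intro moment_mono[OF phi mom]) auto
          then have "a * C / sqrt \<Lambda> * M (1 + a / \<Lambda>) \<le> a * C / sqrt \<Lambda> * M (1 + a)"
            using a C \<Lambda> by (intro mult_left_mono) auto
          then have "\<bar>enn2real (S \<Lambda>) - enn2real (S0 \<Lambda>)\<bar> \<le> a * C * M (1 + a) / sqrt \<Lambda>"
            using enn2real_close(1)[OF le[OF \<Lambda>] pos[OF \<Lambda>]] by simp
          then show ?case
            by (simp only: t\<Psi>(2)[OF \<Lambda>] tD(2)[OF \<Lambda>] of_real_diff[symmetric] norm_of_real real_norm_def)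
        qed
        have "filterlim (\<lambda>\<Lambda>. sqrt \<Lambda>) at_top at_top" by (rule sqrt_at_top)
        then show "((\<lambda>\<Lambda>. a * C * M (1 + a) / sqrt \<Lambda>) \<longlongrightarrow> 0) at_top"
          by (intro tendsto_divide_0[OF tendsto_const] filterlim_at_top_imp_at_infinity)
      qed
    qed
  qed
qed

end

text \<open>The trace-class assertions accompany the limits because \<open>op_trace\<close> is an
  infinite sum with default value 0 where it diverges. For a test function the two operators are
  trace class simultaneously, so the difference never mixes a genuine trace with a default
  value.\<close>

theorem theorem5p6:
  fixes q :: real and w :: complex and n :: nat
    and a b :: "nat \<Rightarrow> oper" and \<D> \<A> \<D>\<^sub>\<A> X\<^sub>\<A> :: oper
  assumes "0 < q" and "q < 1" and "w \<noteq> 0"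
    and "\<D> = dirac q w"
    and "\<And>i. i < n \<Longrightarrow> a i \<in> podles_algebra q"
    and "\<And>i. i < n \<Longrightarrow> b i \<in> podles_algebra q"
    and "\<A> = one_form q w n a b"
    and "selfadjoint \<A>"
    and "\<D>\<^sub>\<A> = op_add \<D> \<A>"
    and "X\<^sub>\<A> = op_diff (op_mult \<D>\<^sub>\<A> \<D>\<^sub>\<A>) (op_mult \<D> \<D>)"
    and "op_norm (op_mult X\<^sub>\<A> (converse (op_mult \<D> \<D>))) < 1"
  shows "(\<forall>t>0. trace_class (fun_calc (\<lambda>x. exp (- t * x)) (op_abs \<D>\<^sub>\<A>))
              \<and> trace_class (fun_calc (\<lambda>x. exp (- t * x)) (op_abs \<D>)))
    \<and> ((\<lambda>t. op_trace (fun_calc (\<lambda>x. exp (- t * x)) (op_abs \<D>\<^sub>\<A>))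
            - op_trace (fun_calc (\<lambda>x. exp (- t * x)) (op_abs \<D>))) \<longlongrightarrow> 0) (at_right 0)
    \<and> (\<forall>f \<in> class_C.
          (\<forall>\<Lambda>>0. trace_class (fun_calc f (op_scale (complex_of_real (1 / \<Lambda>)) (op_abs \<D>\<^sub>\<A>)))
               \<longleftrightarrow> trace_class (fun_calc f (op_scale (complex_of_real (1 / \<Lambda>)) (op_abs \<D>))))
        \<and> ((\<lambda>\<Lambda>. op_trace (fun_calc f (op_scale (complex_of_real (1 / \<Lambda>)) (op_abs \<D>\<^sub>\<A>)))
                - op_trace (fun_calc f (op_scale (complex_of_real (1 / \<Lambda>)) (op_abs \<D>)))) \<longlongrightarrow> 0) at_top)"
proof -
  interpret podles q w by unfold_locales (use assms(1-3) in auto)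
  obtain A where A: "dom_preserving A" "one_form q w n a b = graph_op A"
    by (rule one_form_graph[of n a b]) (auto intro: podles_algebra_bounded_commutator assms(5,6))
  have sa: "selfadjoint (graph_op A)" using assms(7,8) A(2) by simp
  obtain c where c: "0 < c" "\<And>x. x \<in> hilb \<Longrightarrow> vnorm (A x) \<le> c * vnorm x"
    using bounded_fun_bound[OF dom_preservingD(1)[OF A(1)]] by blast
  have DA: "\<D>\<^sub>\<A> = DA A" using DA_def[OF A(1) sa c] assms(4,7,9) A(2) by simp
  have ker: "x = 0" if "(x, 0) \<in> DA A" for x
  proof (rule DA_kernel[OF A(1) sa c _ _ that])
    show "X\<^sub>\<A> = op_diff (op_mult (DA A) (DA A)) (op_mult (dirac q w) (dirac q w))"
      using assms(10) by (simp only: DA assms(4))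
    show "op_norm (op_mult X\<^sub>\<A> (converse (op_mult (dirac q w) (dirac q w)))) < 1"
      using assms(11) by (simp only: assms(4))
  qed
  show ?thesis
    by (intro conjI spectral_action_perturbation[OF A(1) sa c ker assms(4) DA])
qed

end
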